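(* Let $\vec{\mu}$ be a Schmidt vector of length $n$, let $|\psi_{\vec{\mu}}\rangle\in\mathbb{C}^n\otimes\mathbb{C}^n$ be a pure bipartite state with Schmidt vector $\vec{\mu}$, and let $\rho$ be a density matrix on $\mathbb{C}^n\otimes\mathbb{C}^n$. Then $\rho\in S_{\vec{\mu}}^{+}$ if and only if there exists a decomposition $\{p_i,|\psi_i\rangle\}$ of $\rho$ such that $$\sum_i p_i\,\vec{\lambda}_{\psi_i}\succ\vec{\mu}.$$ Furthermore, $|\psi_{\vec{\mu}}\rangle$ can be converted exactly into $\rho$ by LOCC if and only if $\rho\in S_{\vec{\mu}}^{+}$.
   Context: Setting: two parties, Alice and Bob, each hold a quantum system with Hilbert space $\mathbb{C}^n$. A Schmidt vector is $\vec{\mu}=(\mu^1,\dots,\mu^n)$ with $\mu^1\ge\mu^2\ge\dots\ge\mu^n\ge 0$ and $\sum_i\mu^i=1$. For a bipartite pure state $|\psi\rangle$, $\vec{\lambda}_\psi$ denotes the vector of Schmidt coefficients in decreasing order, i.e. the eigenvalues, in decreasing order, of $\mathrm{Tr}_A|\psi\rangle\langle\psi|$. Majorization: for vectors with entries in decreasing order and summing to 1, $\vec{\lambda}\succ\vec{\mu}$ means $\sum_{i=1}^k\lambda^i\ge\sum_{i=1}^k\mu^i$ for all $k=1,\dots,n$. A decomposition $\{p_i,|\psi_i\rangle\}$ of $\rho$ is a finite ensemble of normalized pure states with $p_i\ge0$, $\sum_ip_i=1$, $\rho=\sum_ip_i|\psi_i\rangle\langle\psi_i|$. LOCC operations: quantum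 operations built from local quantum operations (including measurements) by Alice and by Bob together with classical communication between them. Exact conversion of $|\psi_{\vec{\mu}}\rangle$ into $\rho$ means that some LOCC operation maps $|\psi_{\vec{\mu}}\rangle\langle\psi_{\vec{\mu}}|$ to $\rho$ deterministically (with probability 1). $\mathrm{LOCC}_1^A$ is the class of operations consisting of a local measurement/superoperator by Alice given by a set of commuting Kraus operators $A_i$ ($\sum_iA_i^\dagger A_i=\mathbf{1}$), followed by one-way classical communication from Alice to Bob, and local unitary transformations by Alice and Bob which may depend on Alice's outcome; i.e. maps $\mathcal{L}(\sigma)=\sum_i(U_iA_i\otimes V_i)\,\sigma\,(U_iA_i\otimes V_i)^\dagger$ with $U_i,V_i$ unitary. $S_{\vec{\mu}}$ is the convex closure of the set of (projectors onto) pure states $|\psi\rangle\in\mathbb{C}^n\otimes\mathbb{C}^n$ with $\vec{\lambda}_\psi\succ\vec{\mu}$; for a pure state, $|\psi\rangle\in S_{\vec{\mu}}$ means $|\psi\rangle\langle\psi|\in S_{\vec{\mu}}$. Further, $$S_{\vec{\mu}}^{+}=\{\mathcal{L}(|\psi\rangle\langle\psi|)\;|\;\mathcal{L}\in\mathrm{LOCC}_1^A,\ |\psi\rangle\in S_{\vec{\mu}}\}.$$ *)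

theory Defs
  imports "Jordan_Normal_Form.Schur_Decomposition"
begin

section \<open>Finite-dimensional quantum states\<close>

text \<open>
  Hilbert spaces \<open>\<complex>\<^sup>d\<close> are modelled by \<open>carrier_vec d\<close>, operators between them by complex matrices.
  Vectors and matrices with explicit carriers are used, rather than index types, because an LOCC
  protocol may change the dimensions of the local systems from one round to the next.
\<close>

type_synonym cvec = "complex vec"
type_synonym cmat = "complex mat"

text \<open>
  The type of matrices is not a commutative monoid (it has no dimension-independent zero), so finite
  sums of \<open>nr \<times> nc\<close> matrices are taken entrywise.
\<close>

definition mat_sum :: "nat \<Rightarrow> nat \<Rightarrow> 'i set \<Rightarrow> ('i \<Rightarrow> cmat) \<Rightarrow> cmat" where
  "mat_sum nr nc I X = mat nr nc (\<lambda>(a, b). \<Sum>i\<in>I. X i $$ (a, b))"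

definition mat_trace :: "cmat \<Rightarrow> complex" where
  "mat_trace A = (\<Sum>i<dim_row A. A $$ (i, i))"

definition unitary_mat :: "nat \<Rightarrow> cmat \<Rightarrow> bool" where
  "unitary_mat d U \<longleftrightarrow> U \<in> carrier_mat d d \<and>
     mat_adjoint U * U = 1\<^sub>m d \<and> U * mat_adjoint U = 1\<^sub>m d"

definition positive_semidefinite :: "nat \<Rightarrow> cmat \<Rightarrow> bool" where
  "positive_semidefinite d A \<longleftrightarrow> A \<in> carrier_mat d d \<and> mat_adjoint A = A \<and>
     (\<forall>v\<in>carrier_vec d. 0 \<le> (A *\<^sub>v v) \<bullet>c v)"

definition density_matrix :: "nat \<Rightarrow> cmat \<Rightarrow> bool" where
  "density_matrix d \<rho> \<longleftrightarrow> positive_semidefinite d \<rho> \<and> mat_trace \<rho> = 1"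

definition pure_state :: "nat \<Rightarrow> cvec \<Rightarrow> bool" where
  "pure_state d \<psi> \<longleftrightarrow> \<psi> \<in> carrier_vec d \<and> \<psi> \<bullet>c \<psi> = 1"

definition projector :: "cvec \<Rightarrow> cmat" where
  "projector \<psi> = mat (dim_vec \<psi>) (dim_vec \<psi>) (\<lambda>(a, b). \<psi> $ a * conjugate (\<psi> $ b))"

definition probability_weights :: "nat \<Rightarrow> (nat \<Rightarrow> real) \<Rightarrow> bool" where
  "probability_weights m p \<longleftrightarrow> (\<forall>i<m. 0 \<le> p i) \<and> (\<Sum>i<m. p i) = 1"

definition convex_combination :: "nat \<Rightarrow> nat \<Rightarrow> (nat \<Rightarrow> real) \<Rightarrow> (nat \<Rightarrow> cmat) \<Rightarrow> cmat" where
  "convex_combination d m p X = mat_sum d d {..<m} (\<lambda>i. complex_of_real (p i) \<cdot>\<^sub>m X i)"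

definition convex_closure :: "nat \<Rightarrow> cmat set \<Rightarrow> cmat set" where
  "convex_closure d X = {convex_combination d m p Y | m p Y.
     probability_weights m p \<and> (\<forall>i<m. Y i \<in> X)}"

definition pure_state_decomposition ::
    "nat \<Rightarrow> cmat \<Rightarrow> nat \<Rightarrow> (nat \<Rightarrow> real) \<Rightarrow> (nat \<Rightarrow> cvec) \<Rightarrow> bool" where
  "pure_state_decomposition d \<rho> m p \<phi> \<longleftrightarrow> probability_weights m p \<and>
     (\<forall>i<m. pure_state d (\<phi> i)) \<and> \<rho> = convex_combination d m p (\<lambda>i. projector (\<phi> i))"


section \<open>Bipartite systems and Schmidt vectors\<close>

text \<open>
  The basis vector \<open>e\<^sub>i \<otimes> e\<^sub>j\<close> of \<open>\<complex>\<^sup>a \<otimes> \<complex>\<^sup>b\<close> (Alice's factor first) is the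
  basis vector of \<open>\<complex>\<^sup>a\<^sup>b\<close> with index \<open>i * b + j\<close>.
\<close>

definition kronecker :: "cmat \<Rightarrow> cmat \<Rightarrow> cmat" (infixr \<open>\<otimes>\<^sub>k\<close> 75) where
  "A \<otimes>\<^sub>k B = mat (dim_row A * dim_row B) (dim_col A * dim_col B)
     (\<lambda>(i, j). A $$ (i div dim_row B, j div dim_col B) * B $$ (i mod dim_row B, j mod dim_col B))"

definition partial_trace_A :: "nat \<Rightarrow> nat \<Rightarrow> cmat \<Rightarrow> cmat" where
  "partial_trace_A a b \<sigma> = mat b b (\<lambda>(j, j'). \<Sum>i<a. \<sigma> $$ (i * b + j, i * b + j'))"

text \<open>
  Eigenvalues counted with algebraic multiplicity. Taking real parts loses nothing for Hermitian
  matrices, the only ones to which this is applied.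
\<close>

definition decreasing_eigenvalues :: "cmat \<Rightarrow> real vec" where
  "decreasing_eigenvalues A =
     vec_of_list (rev (sorted_list_of_multiset (image_mset Re (proots (char_poly A)))))"

definition schmidt_coefficients :: "nat \<Rightarrow> cvec \<Rightarrow> real vec" where
  "schmidt_coefficients n \<psi> = decreasing_eigenvalues (partial_trace_A n n (projector \<psi>))"

definition schmidt_vector :: "nat \<Rightarrow> real vec \<Rightarrow> bool" where
  "schmidt_vector n \<mu> \<longleftrightarrow> \<mu> \<in> carrier_vec n \<and> (\<forall>i j. i \<le> j \<and> j < n \<longrightarrow> \<mu> $ j \<le> \<mu> $ i) \<and>
     (\<forall>i<n. 0 \<le> \<mu> $ i) \<and> (\<Sum>i<n. \<mu> $ i) = 1"

text \<open>Intended for vectors with decreasing entries that sum to 1; no sorting is performed.\<close>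

definition majorizes :: "real vec \<Rightarrow> real vec \<Rightarrow> bool" (infix \<open>\<succ>\<close> 50) where
  "v \<succ> w \<longleftrightarrow> dim_vec v = dim_vec w \<and>
     (\<forall>k\<in>{1..dim_vec w}. (\<Sum>i<k. v $ i) \<ge> (\<Sum>i<k. w $ i))"


section \<open>LOCC operations\<close>

definition kraus_map :: "nat \<Rightarrow> nat \<Rightarrow> (nat \<Rightarrow> cmat) \<Rightarrow> cmat \<Rightarrow> cmat" where
  "kraus_map d m K \<sigma> = mat_sum d d {..<m} (\<lambda>i. K i * \<sigma> * mat_adjoint (K i))"

text \<open>
  An instrument on \<open>\<complex>\<^sup>a\<close> with outcomes \<open>j < m\<close>: outcome \<open>j\<close> leaves a system of dimension \<open>d j\<close> and
  is realised by the Kraus operators \<open>K j l\<close>, \<open>l < r j\<close>, between which the measuring party does not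
  discriminate. Unitaries, adding or discarding ancillas and arbitrary measurements are all
  special cases.
\<close>

definition instrument ::
    "nat \<Rightarrow> nat \<Rightarrow> (nat \<Rightarrow> nat) \<Rightarrow> (nat \<Rightarrow> nat) \<Rightarrow> (nat \<Rightarrow> nat \<Rightarrow> cmat) \<Rightarrow> bool" where
  "instrument a m d r K \<longleftrightarrow> (\<forall>j<m. \<forall>l<r j. K j l \<in> carrier_mat (d j) a) \<and>
     mat_sum a a {..<m} (\<lambda>j. mat_sum a a {..<r j} (\<lambda>l. mat_adjoint (K j l) * K j l)) = 1\<^sub>m a"

text \<open>
  \<open>locc a' b' a b L\<close>: the map \<open>L\<close>, from operators on \<open>\<complex>\<^sup>a \<otimes> \<complex>\<^sup>b\<close> to operators on
  \<open>\<complex>\<^sup>a\<^sup>' \<otimes> \<complex>\<^sup>b\<^sup>'\<close>, is implemented by an LOCC protocol with finitely many rounds. In each round one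
  party applies an instrument to its own system and announces the outcome \<open>j\<close>; the parties then
  continue with a protocol \<open>L j\<close> that may depend on \<open>j\<close>. All outcomes are collected at the end,
  so that \<open>L\<close> describes the protocol as a deterministic operation.
\<close>

inductive locc :: "nat \<Rightarrow> nat \<Rightarrow> nat \<Rightarrow> nat \<Rightarrow> (cmat \<Rightarrow> cmat) \<Rightarrow> bool" for a' b' where
  stop: "locc a' b' a' b' (\<lambda>\<sigma>. \<sigma>)"
| alice: "instrument a m d r K \<Longrightarrow> (\<And>j. j < m \<Longrightarrow> locc a' b' (d j) b (L j)) \<Longrightarrow>
    locc a' b' a b (\<lambda>\<sigma>. mat_sum (a' * b') (a' * b') {..<m}
      (\<lambda>j. L j (kraus_map (d j * b) (r j) (\<lambda>l. K j l \<otimes>\<^sub>k 1\<^sub>m b) \<sigma>)))"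
| bob: "instrument b m d r K \<Longrightarrow> (\<And>j. j < m \<Longrightarrow> locc a' b' a (d j) (L j)) \<Longrightarrow>
    locc a' b' a b (\<lambda>\<sigma>. mat_sum (a' * b') (a' * b') {..<m}
      (\<lambda>j. L j (kraus_map (a * d j) (r j) (\<lambda>l. 1\<^sub>m a \<otimes>\<^sub>k K j l) \<sigma>)))"

definition locc_convertible :: "nat \<Rightarrow> cvec \<Rightarrow> cmat \<Rightarrow> bool" where
  "locc_convertible n \<psi> \<rho> \<longleftrightarrow> (\<exists>L. locc n n n n L \<and> L (projector \<psi>) = \<rho>)"

definition LOCC1A :: "nat \<Rightarrow> (cmat \<Rightarrow> cmat) set" where
  "LOCC1A n = {kraus_map (n * n) m (\<lambda>i. (U i * A i) \<otimes>\<^sub>k V i) | m A U V.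
     (\<forall>i<m. A i \<in> carrier_mat n n \<and> unitary_mat n (U i) \<and> unitary_mat n (V i)) \<and>
     (\<forall>i<m. \<forall>j<m. A i * A j = A j * A i) \<and>
     mat_sum n n {..<m} (\<lambda>i. mat_adjoint (A i) * A i) = 1\<^sub>m n}"


section \<open>The sets of states associated with a Schmidt vector\<close>

definition S_set :: "nat \<Rightarrow> real vec \<Rightarrow> cmat set" where
  "S_set n \<mu> = convex_closure (n * n)
     {projector \<psi> | \<psi>. pure_state (n * n) \<psi> \<and> schmidt_coefficients n \<psi> \<succ> \<mu>}"

definition S_plus :: "nat \<Rightarrow> real vec \<Rightarrow> cmat set" where
  "S_plus n \<mu> = {L (projector \<psi>) | L \<psi>.
     L \<in> LOCC1A n \<and> pure_state (n * n) \<psi> \<and> projector \<psi> \<in> S_set n \<mu>}"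

end

theory Submission
  imports Defs
begin

text \<open>
  A bipartite vector is treated as its \<open>n \<times> n\<close> coefficient matrix \<open>M\<close>, on which \<open>A \<otimes> B\<close>
  acts as \<open>A M B\<^sup>T\<close>. The equivalences are proved as a cycle.

  Decomposition to \<open>S_plus\<close>: start from the state with the averaged Schmidt vector \<open>l\<close> and let Alice
  apply the diagonal Kraus operators with entries \<open>sqrt (p\<^sub>i \<lambda>\<^sub>i\<^sup>k / l\<^sup>k)\<close>.

  \<open>S_plus\<close> to LOCC: a pure state in a convex hull of pure states is one of them, so Nielsen's protocol
  reaches it; the protocol comes from writing \<open>\<mu>\<close> as a convex combination of permutations of the
  majorizing vector.

  LOCC to decomposition: every protocol has Kraus operators of product form. The sum of all but the
  \<open>k\<close> largest Schmidt coefficients is the squared distance to the states of Schmidt rank at most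
  \<open>k\<close> (Eckart-Young). Product operators preserve the Schmidt rank bound, and the squared norms of the
  branches add up, so on average this distance does not increase.
\<close>

section \<open>Orthonormal systems\<close>

text \<open>The decreasing Schmidt vector is not linear in the state, so its average over branches
  cannot be followed through a protocol directly. A minimum over low-rank matrices can: one fixed
  competitor for the initial state is mapped to competitors for all branches at once. Bounds on
  tails become bounds on prefixes because the Schmidt coefficients of a unit vector sum to 1. In the
  constructions the square roots are forced: completeness of diagonal Kraus operators concerns
  squares, and it says exactly that the weighted vectors add up to the given one. The quotients lose
  their meaning where the denominator vanishes; the numerators vanish there too, and the entry can
  be chosen to suit completeness. A rank-one projector forces every vector of positive weight in a
  mixture to be parallel to its range, which disposes of the convex closure. Branches are carried as
  unnormalised vectors whose squared norm is the probability, so continuations must be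
  homogeneous.\<close>

lemma mat_adjoint_eq: "mat_adjoint A = mat (dim_col A) (dim_row A) (\<lambda>(i, j). cnj (A $$ (j, i)))"
  by (rule eq_matI) (auto simp: mat_adjoint_def mat_of_rows_def)

lemma mat_adjoint_dim [simp]:
  "dim_row (mat_adjoint (A :: cmat)) = dim_col A" "dim_col (mat_adjoint (A :: cmat)) = dim_row A"
  by (simp_all add: mat_adjoint_eq)

lemma mat_adjoint_index [simp]:
  "i < dim_col A \<Longrightarrow> j < dim_row A \<Longrightarrow> mat_adjoint A $$ (i, j) = cnj (A $$ (j, i))"
  by (simp add: mat_adjoint_eq)

lemma mat_adjoint_carrier [simp, intro]:
  "A \<in> carrier_mat a b \<Longrightarrow> mat_adjoint (A :: cmat) \<in> carrier_mat b a"
  by (rule carrier_matI) simp_all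

lemma mat_adjoint_adjoint [simp]: "mat_adjoint (mat_adjoint A) = (A :: cmat)"
  by (rule eq_matI) auto

text \<open>The premises concern dimensions only, so the simplifier can discharge them and
  reassociate long products of rectangular matrices.\<close>

lemma mult_mat_assoc:
  "dim_col A = dim_row B \<Longrightarrow> dim_col B = dim_row C \<Longrightarrow> A * B * C = A * (B * C :: cmat)"
  by (rule assoc_mult_mat[of A "dim_row A" "dim_col A" B "dim_col B" C "dim_col C"]) auto

lemma mat_adjoint_mult:
  assumes "dim_col A = dim_row B"
  shows "mat_adjoint (A * B) = mat_adjoint B * mat_adjoint (A :: cmat)"
  using assms by (intro eq_matI) (auto simp: scalar_prod_def mult.commute)

lemma mat_adjoint_one [simp]: "mat_adjoint (1\<^sub>m n) = (1\<^sub>m n :: cmat)"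
  by (rule eq_matI) auto

text \<open>For square matrices a left inverse is also a right inverse, so one of the two equations
  suffices.\<close>

lemma unitary_matI:
  assumes "U \<in> carrier_mat n n" "mat_adjoint U * U = 1\<^sub>m n"
  shows "unitary_mat n U"
  using assms mat_mult_left_right_inverse[of "mat_adjoint U" n U] by (simp add: unitary_mat_def)

lemma unitary_matD:
  assumes "unitary_mat n U"
  shows "U \<in> carrier_mat n n" "mat_adjoint U * U = 1\<^sub>m n" "U * mat_adjoint U = 1\<^sub>m n"
  using assms by (auto simp: unitary_mat_def)

lemma unitary_mat_adjoint: "unitary_mat n U \<Longrightarrow> unitary_mat n (mat_adjoint U)"
  by (auto simp: unitary_mat_def)

lemma unitary_mat_mult:
  assumes "unitary_mat n U" "unitary_mat n V"
  shows "unitary_mat n (U * V)"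
proof (rule unitary_matI)
  note U = unitary_matD[OF assms(1)] and V = unitary_matD[OF assms(2)]
  show "U * V \<in> carrier_mat n n" using U V by simp
  have "mat_adjoint (U * V) * (U * V) = mat_adjoint V * (mat_adjoint U * U) * V"
    using U(1) V(1) by (simp add: mat_adjoint_mult mult_mat_assoc)
  also have "\<dots> = 1\<^sub>m n" using U V by simp
  finally show "mat_adjoint (U * V) * (U * V) = 1\<^sub>m n" .
qed

text \<open>Bob's operator acts on coefficient matrices through its transpose; a unitary wanted on
  the right of a coefficient matrix has to be transposed to become an operation of Bob.\<close>

lemma unitary_mat_transpose:
  assumes "unitary_mat n U"
  shows "unitary_mat n (transpose_mat U)"
proof (rule unitary_matI)
  note U = unitary_matD[OF assms]
  show "transpose_mat U \<in> carrier_mat n n" using U by simp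
  have "mat_adjoint (transpose_mat U) = transpose_mat (mat_adjoint U)"
    using U(1) by (intro eq_matI) auto
  moreover have "transpose_mat (mat_adjoint U) * transpose_mat U = transpose_mat (U * mat_adjoint U)"
    using U(1) by (subst transpose_mult[of _ n n _ n]) auto
  ultimately show "mat_adjoint (transpose_mat U) * transpose_mat U = 1\<^sub>m n"
    using U by simp
qed

section \<open>Inner product and squared norm\<close>

lemma cscalar_prod_sum:
  assumes "v \<in> carrier_vec n" "w \<in> carrier_vec n"
  shows "v \<bullet>c w = (\<Sum>a<n. v $ a * cnj (w $ a))"
  using assms by (simp add: scalar_prod_def lessThan_atLeast0)

lemma cscalar_prod_cnj:
  assumes "v \<in> carrier_vec n" "w \<in> carrier_vec n"
  shows "cnj (v \<bullet>c w) = w \<bullet>c v"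
  using assms by (simp add: cscalar_prod_sum mult.commute)

text \<open>The product \<open>\<bullet>c\<close> is complex valued, while the later estimates
  compare reals: probabilities and distances are both squared norms.\<close>

definition norm2 :: "cvec \<Rightarrow> real" where
  "norm2 v = (\<Sum>a<dim_vec v. (cmod (v $ a))\<^sup>2)"

lemma norm2_nonneg: "0 \<le> norm2 v"
  by (simp add: norm2_def sum_nonneg)

lemma norm2_eq_0: "norm2 v = 0 \<longleftrightarrow> v = 0\<^sub>v (dim_vec v)"
proof
  assume "norm2 v = 0"
  then show "v = 0\<^sub>v (dim_vec v)" by (intro eq_vecI) (auto simp: norm2_def sum_nonneg_eq_0_iff)
next
  assume "v = 0\<^sub>v (dim_vec v)"
  then have "v $ i = 0" if "i < dim_vec v" for i using that by (metis index_zero_vec(1))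
  then show "norm2 v = 0" by (simp add: norm2_def)
qed

lemma norm2_smult: "norm2 (c \<cdot>\<^sub>v v) = (cmod c)\<^sup>2 * norm2 v"
  by (simp add: norm2_def norm_mult power_mult_distrib sum_distrib_left)

lemma cscalar_prod_self: "v \<bullet>c v = complex_of_real (norm2 v)"
  by (simp add: cscalar_prod_sum[of v "dim_vec v"] norm2_def complex_norm_square
      del: of_real_power)

lemma pure_state_iff: "pure_state d v \<longleftrightarrow> v \<in> carrier_vec d \<and> norm2 v = 1"
  by (simp add: pure_state_def cscalar_prod_self del: of_real_eq_1_iff)
    (metis of_real_eq_1_iff)

definition orthonormal :: "nat \<Rightarrow> nat \<Rightarrow> (nat \<Rightarrow> cvec) \<Rightarrow> bool" where
  "orthonormal n m u \<longleftrightarrow> (\<forall>i<m. u i \<in> carrier_vec n) \<and>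
     (\<forall>i<m. \<forall>j<m. u i \<bullet>c u j = (if i = j then 1 else 0))"

text \<open>Orthogonality to fewer than \<open>n\<close> vectors is a homogeneous linear system. Its
  matrix, filled up with zero rows to a square one, is singular, and a normalised kernel vector
  solves it.\<close>

lemma exists_unit_orthogonal:
  fixes y :: "nat \<Rightarrow> cvec"
  assumes "k < n" "\<And>i. i < k \<Longrightarrow> y i \<in> carrier_vec n"
  obtains z where "z \<in> carrier_vec n" "z \<bullet>c z = 1" "\<And>i. i < k \<Longrightarrow> z \<bullet>c y i = 0"
proof -
  \<comment> \<open>Conjugation turns the bilinear product of a row with \<open>v\<close> into the
    inner product with \<open>y i\<close>; the zero default keeps every row in the carrier.\<close>
  define c where "c = (\<lambda>i. if i < k then conjugate (y i) else 0\<^sub>v n)"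
  have c: "c i \<in> carrier_vec n" for i using assms(2) by (auto simp: c_def)
  define A where "A = mat\<^sub>r n n (\<lambda>i. if i = k then 0\<^sub>v n else c i)"
  have A: "A \<in> carrier_mat n n" by (simp add: A_def)
  have "det A = 0" unfolding A_def using c by (intro det_row_0 assms(1)) auto
  then obtain v where v: "v \<in> carrier_vec n" "v \<noteq> 0\<^sub>v n" "A *\<^sub>v v = 0\<^sub>v n"
    using det_0_iff_vec_prod_zero[OF A] by auto
  have y: "v \<bullet>c y i = 0" if i: "i < k" for i
  proof -
    have "row A i = conjugate (y i)"
      using i assms c[of i] by (simp add: A_def row_mat_of_row_fun c_def)
    moreover have "v \<bullet>c y i = conjugate (y i) \<bullet> v"
      using assms(2)[OF i] v(1) by (rule conjugate_vec_sprod_comm[rotated])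
    ultimately have "v \<bullet>c y i = (A *\<^sub>v v) $ i"
      using i assms(1) A by simp
    also have "\<dots> = 0" using v i assms(1) by simp
    finally show ?thesis .
  qed
  define r where "r = norm2 v"
  have "r \<noteq> 0" using v by (auto simp: r_def norm2_eq_0)
  then have r: "r > 0" using norm2_nonneg[of v] by (simp add: r_def)
  define z where "z = complex_of_real (1 / sqrt r) \<cdot>\<^sub>v v"
  have "norm2 z = 1" using r by (simp add: z_def norm2_smult r_def[symmetric] norm_divide power_divide)
  then have "z \<bullet>c z = 1" by (simp add: cscalar_prod_self)
  moreover have "z \<in> carrier_vec n" using v by (simp add: z_def)
  moreover have "z \<bullet>c y i = 0" if "i < k" for i
    using that v assms y[OF that] by (simp add: z_def)
  ultimately show ?thesis using that by blast
qed

lemma orthonormal_Suc: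
  assumes "orthonormal n m u" "z \<in> carrier_vec n" "z \<bullet>c z = 1" "\<And>i. i < m \<Longrightarrow> z \<bullet>c u i = 0"
  shows "orthonormal n (Suc m) (u(m := z))"
proof -
  have "u i \<bullet>c z = 0" if "i < m" for i
    using cscalar_prod_cnj[of z n "u i"] assms(1,2,4) that by (auto simp: orthonormal_def)
  then show ?thesis using assms by (auto simp: orthonormal_def less_Suc_eq)
qed

text \<open>Only \<open>u\<close> is orthonormal; \<open>y\<close> is an arbitrary family that the
  new vector has to be orthogonal to as well. Together they have fewer than \<open>n\<close>
  members.\<close>

lemma orthonormal_extend_step:
  assumes "orthonormal n m u" "m + k < n" "\<And>i. i < k \<Longrightarrow> y i \<in> carrier_vec n"
  obtains z where "orthonormal n (Suc m) (u(m := z))" "\<And>i. i < k \<Longrightarrow> z \<bullet>c y i = 0"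
proof -
  define w where "w = (\<lambda>i. if i < m then u i else y (i - m))"
  have "w i \<in> carrier_vec n" if "i < m + k" for i
    using that assms by (cases "i < m") (simp_all add: w_def orthonormal_def)
  then obtain z where z: "z \<in> carrier_vec n" "z \<bullet>c z = 1" "\<And>i. i < m + k \<Longrightarrow> z \<bullet>c w i = 0"
    using exists_unit_orthogonal[OF assms(2)] by blast
  have "z \<bullet>c u i = 0" if "i < m" for i using z(3)[of i] that by (simp add: w_def)
  moreover have "z \<bullet>c y i = 0" if "i < k" for i using z(3)[of "m + i"] that by (simp add: w_def)
  ultimately show ?thesis using that orthonormal_Suc assms(1) z by blast
qed

lemma orthonormal_extend:
  assumes "orthonormal n m u" "m \<le> n"
  obtains w where "orthonormal n n w" "\<And>i. i < m \<Longrightarrow> w i = u i"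
proof -
  have "\<exists>w. orthonormal n (m + d) w \<and> (\<forall>i<m. w i = u i)" if "m + d \<le> n" for d
    using that
  proof (induction d)
    case 0
    then show ?case using assms by auto
  next
    case (Suc d)
    then obtain w where w: "orthonormal n (m + d) w" "\<forall>i<m. w i = u i" by auto
    obtain z where "orthonormal n (Suc (m + d)) (w(m + d := z))"
      by (rule orthonormal_extend_step[OF w(1), of 0]) (use Suc in auto)
    then show ?case using w by (intro exI[of _ "w(m + d := z)"]) (auto simp: fun_upd_def)
  qed
  from this[of "n - m"] show ?thesis using assms that by auto
qed

text \<open>Linearly dependent \<open>y\<close> only enlarge the complement. Applied to the rows of
  a matrix with \<open>k\<close> rows, this supplies \<open>n - k\<close> orthonormal kernel
  vectors.\<close>

lemma orthonormal_complement:
  assumes "k \<le> n" "\<And>i. i < k \<Longrightarrow> y i \<in> carrier_vec n"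
  obtains u where "orthonormal n (n - k) u" "\<And>i j. i < n - k \<Longrightarrow> j < k \<Longrightarrow> u i \<bullet>c y j = 0"
proof -
  have "\<exists>u. orthonormal n m u \<and> (\<forall>i<m. \<forall>j<k. u i \<bullet>c y j = 0)" if "m + k \<le> n" for m
    using that
  proof (induction m)
    case 0
    then show ?case by (auto simp: orthonormal_def)
  next
    case (Suc m)
    then obtain u where u: "orthonormal n m u" "\<forall>i<m. \<forall>j<k. u i \<bullet>c y j = 0" by auto
    obtain z where z: "orthonormal n (Suc m) (u(m := z))" "\<And>i. i < k \<Longrightarrow> z \<bullet>c y i = 0"
      by (rule orthonormal_extend_step[OF u(1), of k y]) (use Suc assms in auto)
    then show ?case using u by (intro exI[of _ "u(m := z)"]) (auto simp: less_Suc_eq fun_upd_def)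
  qed
  from this[of "n - k"] show ?thesis using assms that by auto
qed

lemma orthonormal_unitary:
  assumes "orthonormal n n u"
  shows "unitary_mat n (mat n n (\<lambda>(i, j). u j $ i))"
proof (rule unitary_matI)
  let ?W = "mat n n (\<lambda>(i, j). u j $ i)"
  show "mat_adjoint ?W * ?W = 1\<^sub>m n"
  proof (rule eq_matI)
    fix i j assume ij: "i < dim_row (1\<^sub>m n)" "j < dim_col (1\<^sub>m n)"
    then have "(mat_adjoint ?W * ?W) $$ (i, j) = (\<Sum>a<n. u j $ a * cnj (u i $ a))"
      by (simp add: scalar_prod_def lessThan_atLeast0 mult.commute)
    also have "\<dots> = u j \<bullet>c u i"
      using assms ij by (simp add: cscalar_prod_sum[of _ n] orthonormal_def)
    finally show "(mat_adjoint ?W * ?W) $$ (i, j) = 1\<^sub>m n $$ (i, j)"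
      using assms ij by (auto simp: orthonormal_def)
  qed auto
qed auto


section \<open>The spectral theorem for Hermitian matrices\<close>

lemma mult_mat_vec_assoc:
  "dim_col A = dim_row B \<Longrightarrow> dim_col B = dim_vec v \<Longrightarrow> A * B *\<^sub>v v = A *\<^sub>v (B *\<^sub>v (v :: cvec))"
  by (rule assoc_mult_mat_vec[of A "dim_row A" "dim_col A" B "dim_col B"]) auto

lemma cscalar_prod_adjoint:
  fixes A :: cmat
  assumes "A \<in> carrier_mat a b" "v \<in> carrier_vec b" "w \<in> carrier_vec a"
  shows "(A *\<^sub>v v) \<bullet>c w = v \<bullet>c (mat_adjoint A *\<^sub>v w)"
proof -
  have "(A *\<^sub>v v) \<bullet>c w = (\<Sum>i<a. \<Sum>j<b. A $$ (i, j) * v $ j * cnj (w $ i))"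
    using assms by (simp add: cscalar_prod_sum[of _ a] scalar_prod_def sum_distrib_right lessThan_atLeast0)
  also have "\<dots> = (\<Sum>j<b. \<Sum>i<a. A $$ (i, j) * v $ j * cnj (w $ i))"
    by (rule sum.swap)
  also have "\<dots> = v \<bullet>c (mat_adjoint A *\<^sub>v w)"
    using assms by (simp add: cscalar_prod_sum[of _ b] scalar_prod_def sum_distrib_left lessThan_atLeast0 ac_simps)
  finally show ?thesis .
qed

text \<open>The eigenvalue is the number \<open>(A *\<^sub>v v) \<bullet>c v\<close>, which
  self-adjointness makes equal to its own conjugate.\<close>

lemma hermitian_eigenvalue_real:
  assumes "A \<in> carrier_mat n n" "mat_adjoint A = A" "v \<in> carrier_vec n" "v \<bullet>c v = 1"
    and "A *\<^sub>v v = e \<cdot>\<^sub>v v"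
  shows "e = complex_of_real (Re e)"
proof -
  have "(A *\<^sub>v v) \<bullet>c v = e" using assms by simp
  moreover have "cnj ((A *\<^sub>v v) \<bullet>c v) = (A *\<^sub>v v) \<bullet>c v"
    using assms cscalar_prod_adjoint[of A n n v v] by (subst cscalar_prod_cnj[of _ n]) auto
  ultimately show ?thesis by (simp add: complex_eq_iff)
qed

lemma exists_eigenvector:
  assumes "A \<in> carrier_mat n n" "0 < n"
  obtains v e where "v \<in> carrier_vec n" "v \<noteq> 0\<^sub>v n" "A *\<^sub>v v = (e :: complex) \<cdot>\<^sub>v v"
proof -
  have "degree (char_poly A) = n" using degree_monic_char_poly[OF assms(1)] by simp
  then have "\<not> constant (poly (char_poly A))" using assms(2) by (simp add: constant_degree)
  then obtain e where "poly (char_poly A) e = 0" using fundamental_theorem_of_algebra by blast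
  then have "eigenvalue A e" using eigenvalue_root_char_poly[OF assms(1)] by simp
  then show ?thesis using that assms(1) by (auto simp: eigenvalue_def eigenvector_def)
qed

text \<open>The orthogonal complement of the eigenvectors found so far is invariant under
  \<open>H\<close>. In a basis extending them \<open>H\<close> is block diagonal, and an eigenvector
  of the lower block, padded with zeros, is the next one.\<close>

lemma hermitian_eigenvector_step:
  assumes H: "H \<in> carrier_mat n n" "mat_adjoint H = H"
    and u: "orthonormal n m u" and m: "m < n"
    and ev: "\<And>i. i < m \<Longrightarrow> H *\<^sub>v u i = complex_of_real (d i) \<cdot>\<^sub>v u i"
  obtains z e where "orthonormal n (Suc m) (u(m := z))" "H *\<^sub>v z = complex_of_real e \<cdot>\<^sub>v z"
proof -
  obtain w where w: "orthonormal n n w" "\<And>i. i < m \<Longrightarrow> w i = u i"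
    using orthonormal_extend[OF u] m by (metis less_imp_le)
  have wc: "w i \<in> carrier_vec n" if "i < n" for i using w that by (auto simp: orthonormal_def)
  define W where "W = mat n n (\<lambda>(i, j). w j $ i)"
  have uW: "unitary_mat n W" unfolding W_def by (rule orthonormal_unitary[OF w(1)])
  note W = unitary_matD[OF uW]
  have dW: "dim_row W = n" "dim_col W = n" using W by auto
  have dH: "dim_row H = n" "dim_col H = n" using H by auto
  have adjW: "(mat_adjoint W *\<^sub>v x) $ i = x \<bullet>c w i" if "i < n" "x \<in> carrier_vec n" for i x
    using that wc[OF that(1)]
    by (simp add: scalar_prod_def W_def lessThan_atLeast0 mult.commute)
  define T where "T = mat_adjoint W * H * W"
  have T: "T \<in> carrier_mat n n" using W H by (auto simp: T_def)
  have T_herm: "mat_adjoint T = T"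
    using dW dH by (simp add: T_def mat_adjoint_mult mult_mat_assoc H(2))
  have T_col: "T $$ (j, i) = 0" if "i < m" "m \<le> j" "j < n" for i j
  proof -
    have i: "i < n" using that m by simp
    have "col W i = w i" using i wc[OF i] by (intro eq_vecI) (auto simp: W_def)
    have "T $$ (j, i) = (T *\<^sub>v unit_vec n i) $ j"
      using i that T by simp
    also have "T *\<^sub>v unit_vec n i = mat_adjoint W *\<^sub>v (H *\<^sub>v (W *\<^sub>v unit_vec n i))"
      using dW dH by (simp add: T_def mult_mat_vec_assoc)
    also have "W *\<^sub>v unit_vec n i = w i"
      using i wc[OF i] W by (intro eq_vecI) (auto simp: W_def)
    also have "H *\<^sub>v w i = complex_of_real (d i) \<cdot>\<^sub>v w i"
      using ev[OF that(1)] w(2)[OF that(1)] by simp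
    also have "(mat_adjoint W *\<^sub>v (complex_of_real (d i) \<cdot>\<^sub>v w i)) $ j = complex_of_real (d i) * (w i \<bullet>c w j)"
      using that wc[OF i] wc[OF that(3)] by (subst adjW) auto
    also have "\<dots> = 0" using w(1) i that by (auto simp: orthonormal_def)
    finally show ?thesis .
  qed
  \<comment> \<open>The eigenvector equations determine the columns; self-adjointness of
    \<open>T\<close> transfers their zeros to the rows.\<close>
  have T_row: "T $$ (i, j) = 0" if "i < m" "m \<le> j" "j < n" for i j
    using T_col[OF that] mat_adjoint_index[of i T j] T T_herm that m by simp
  define K where "K = mat (n - m) (n - m) (\<lambda>(i, j). T $$ (m + i, m + j))"
  have "K \<in> carrier_mat (n - m) (n - m)" by (simp add: K_def)
  then obtain y e where y: "y \<in> carrier_vec (n - m)" "y \<noteq> 0\<^sub>v (n - m)" "K *\<^sub>v y = e \<cdot>\<^sub>v y"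
    using exists_eigenvector[of K "n - m"] m by auto
  define x where "x = vec n (\<lambda>i. if i < m then 0 else y $ (i - m))"
  have x: "x \<in> carrier_vec n" by (simp add: x_def)
  have Tx: "T *\<^sub>v x = e \<cdot>\<^sub>v x"
  proof (rule eq_vecI)
    fix i assume "i < dim_vec (e \<cdot>\<^sub>v x)"
    then have i: "i < n" by (simp add: x_def)
    have "(T *\<^sub>v x) $ i = (\<Sum>j\<in>{..<n}. T $$ (i, j) * x $ j)"
      using i T x by (simp add: scalar_prod_def lessThan_atLeast0)
    also have "\<dots> = (\<Sum>j\<in>{m..<n}. T $$ (i, j) * x $ j)"
      by (rule sum.mono_neutral_right) (auto simp: x_def)
    also have "\<dots> = (\<Sum>j<n - m. T $$ (i, m + j) * y $ j)"
      using m by (intro sum.reindex_bij_witness[of _ "\<lambda>j. m + j" "\<lambda>j. j - m"]) (auto simp: x_def)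
    also have "\<dots> = (e \<cdot>\<^sub>v x) $ i"
    proof (cases "i < m")
      case True
      then show ?thesis using T_row m by (auto simp: x_def intro!: sum.neutral)
    next
      case False
      then have "(\<Sum>j<n - m. T $$ (i, m + j) * y $ j) = (K *\<^sub>v y) $ (i - m)"
        using i y(1) by (simp add: K_def scalar_prod_def lessThan_atLeast0)
      also have "\<dots> = e * y $ (i - m)" using y i False by simp
      finally show ?thesis using i False by (simp add: x_def)
    qed
    finally show "(T *\<^sub>v x) $ i = (e \<cdot>\<^sub>v x) $ i" .
  qed (use T x in auto)
  define z0 where "z0 = W *\<^sub>v x"
  have z0: "z0 \<in> carrier_vec n" using W x by (simp add: z0_def)
  have WT: "W * T = H * W"
  proof -
    have "W * T = (W * mat_adjoint W) * H * W" using dW dH by (simp add: T_def mult_mat_assoc)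
    then show ?thesis using W H by simp
  qed
  have Wz: "mat_adjoint W *\<^sub>v z0 = x"
    using W x by (simp add: z0_def mult_mat_vec_assoc[symmetric])
  have Hz: "H *\<^sub>v z0 = e \<cdot>\<^sub>v z0"
  proof -
    have "H *\<^sub>v z0 = (H * W) *\<^sub>v x" using W H x by (simp add: z0_def mult_mat_vec_assoc)
    also have "\<dots> = W *\<^sub>v (T *\<^sub>v x)" using W T x by (simp add: WT[symmetric] mult_mat_vec_assoc)
    also have "\<dots> = e \<cdot>\<^sub>v z0" unfolding Tx z0_def using W x by (simp add: mult_mat_vec)
    finally show ?thesis .
  qed
  \<comment> \<open>The products of \<open>z0\<close> with the basis \<open>w\<close> are the
    coordinates of \<open>x\<close>, and the first \<open>m\<close> of these are zero.\<close>
  have orth: "z0 \<bullet>c u i = 0" if "i < m" for i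
    using adjW[of i z0] z0 Wz that m w(2)[OF that] by (simp add: x_def)
  have "z0 \<noteq> 0\<^sub>v n"
  proof
    assume "z0 = 0\<^sub>v n"
    then have x0: "x = 0\<^sub>v n"
      using Wz adjW[of _ z0] wc x z0 by (intro eq_vecI) auto
    have "y $ i = 0" if "i < n - m" for i
      using arg_cong[OF x0, of "\<lambda>v. v $ (m + i)"] that by (simp add: x_def)
    then show False using y by (auto intro!: eq_vecI)
  qed
  define r where "r = norm2 z0"
  have "r \<noteq> 0" using z0 \<open>z0 \<noteq> 0\<^sub>v n\<close> by (auto simp: r_def norm2_eq_0)
  then have r: "r > 0" using norm2_nonneg[of z0] by (simp add: r_def)
  define z where "z = complex_of_real (1 / sqrt r) \<cdot>\<^sub>v z0"
  have z: "z \<in> carrier_vec n" using z0 by (simp add: z_def)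
  have "norm2 z = 1" using r by (simp add: z_def norm2_smult r_def[symmetric] norm_divide power_divide)
  then have zz: "z \<bullet>c z = 1" by (simp add: cscalar_prod_self)
  have Hzz: "H *\<^sub>v z = e \<cdot>\<^sub>v z"
    using H z0 Hz by (simp add: z_def mult_mat_vec smult_smult_assoc mult.commute)
  have uc: "u i \<in> carrier_vec n" if "i < m" for i using u that by (auto simp: orthonormal_def)
  have "orthonormal n (Suc m) (u(m := z))"
  proof (rule orthonormal_Suc[OF u z zz])
    fix i assume i: "i < m"
    show "z \<bullet>c u i = 0"
      using orth[OF i] uc[OF i] z0 by (simp add: z_def)
  qed
  then show ?thesis using that hermitian_eigenvalue_real[OF H z zz Hzz] Hzz by metis
qed

lemma hermitian_eigenbasis:
  assumes H: "H \<in> carrier_mat n n" "mat_adjoint H = H"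
  obtains u d where "orthonormal n n u" "\<And>i. i < n \<Longrightarrow> H *\<^sub>v u i = complex_of_real (d i) \<cdot>\<^sub>v u i"
proof -
  have "\<exists>u d. orthonormal n m u \<and> (\<forall>i<m. H *\<^sub>v u i = complex_of_real (d i) \<cdot>\<^sub>v u i)" if "m \<le> n" for m
    using that
  proof (induction m)
    case 0
    then show ?case by (auto simp: orthonormal_def)
  next
    case (Suc m)
    then obtain u d where ud: "orthonormal n m u" "\<And>i. i < m \<Longrightarrow> H *\<^sub>v u i = complex_of_real (d i) \<cdot>\<^sub>v u i"
      by auto
    obtain z e where "orthonormal n (Suc m) (u(m := z))" "H *\<^sub>v z = complex_of_real e \<cdot>\<^sub>v z"
      by (rule hermitian_eigenvector_step[OF H ud(1) _ ud(2)]) (use Suc in auto)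
    then show ?case using ud
      by (intro exI[of _ "u(m := z)"] exI[of _ "d(m := e)"]) (auto simp: less_Suc_eq fun_upd_def)
  qed
  then show ?thesis using that by blast
qed

text \<open>The characteristic polynomial factors with the eigenvalues in arbitrary order
  \<open>ds\<close>, while the result is in the decreasing order \<open>es\<close>; the roots only
  see the common multiset.\<close>

lemma decreasing_eigenvalues_eqI:
  assumes "mset ds = mset es" "sorted (rev es)" "char_poly A = (\<Prod>e\<leftarrow>ds. [:- complex_of_real e, 1:])"
  shows "decreasing_eigenvalues A = vec_of_list es"
proof -
  have "proots (char_poly A) = image_mset complex_of_real (mset ds)"
    unfolding assms(3)
  proof (induction ds)
    case (Cons a ds)
    have "(\<Prod>e\<leftarrow>ds. [:- complex_of_real e, 1:]) \<noteq> 0" by (auto simp: prod_list_zero_iff)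
    then show ?case using Cons
      by (simp add: proots_mult del: mult_pCons_left)
  qed simp
  then have "image_mset Re (proots (char_poly A)) = mset (rev es)"
    using assms(1) by (simp add: image_mset.compositionality o_def)
  moreover have "sorted_list_of_multiset (mset (rev es)) = rev es"
    using assms(2) by (simp only: sorted_list_of_multiset_mset) (rule sorted_sort_id)
  ultimately show ?thesis by (simp only: decreasing_eigenvalues_def rev_rev_ident)
qed

text \<open>Diagonalisation gives the characteristic polynomial and hence the multiset of
  eigenvalues; equality of multisets yields the permutation that renumbers the eigenbasis to fit the
  decreasing order.\<close>

theorem hermitian_spectral:
  assumes H: "H \<in> carrier_mat n n" "mat_adjoint H = H"
  defines "l \<equiv> decreasing_eigenvalues H"
  obtains u where "orthonormal n n u" "\<And>i. i < n \<Longrightarrow> H *\<^sub>v u i = complex_of_real (l $ i) \<cdot>\<^sub>v u i"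
    "l \<in> carrier_vec n" "\<And>i j. i \<le> j \<Longrightarrow> j < n \<Longrightarrow> l $ j \<le> l $ i"
proof -
  obtain u d where u: "orthonormal n n u" and d: "\<And>i. i < n \<Longrightarrow> H *\<^sub>v u i = complex_of_real (d i) \<cdot>\<^sub>v u i"
    using hermitian_eigenbasis[OF H] by blast
  have uc: "u i \<in> carrier_vec n" if "i < n" for i using u that by (auto simp: orthonormal_def)
  define W where "W = mat n n (\<lambda>(i, j). u j $ i)"
  have "unitary_mat n W" unfolding W_def by (rule orthonormal_unitary[OF u])
  note W = unitary_matD[OF this]
  let ?D = "mat_diag n (\<lambda>i. complex_of_real (d i))"
  have HW: "H * W = W * ?D"
  proof (rule eq_matI)
    fix i j assume ij: "i < dim_row (W * ?D)" "j < dim_col (W * ?D)"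
    then have ij: "i < n" "j < n" using W by (auto simp: mat_diag_def)
    have "col W j = u j" using ij uc[OF ij(2)] by (intro eq_vecI) (auto simp: W_def)
    then have "(H * W) $$ (i, j) = (H *\<^sub>v u j) $ i" using ij H W by simp
    also have "\<dots> = complex_of_real (d j) * u j $ i" using d[OF ij(2)] uc[OF ij(2)] ij by simp
    also have "\<dots> = (W * ?D) $$ (i, j)" using ij W by (simp add: mat_diag_mult_right[of _ n] W_def)
    finally show "(H * W) $$ (i, j) = (W * ?D) $$ (i, j)" .
  qed (use H W in \<open>auto simp: mat_diag_def\<close>)
  have HD: "H = W * ?D * mat_adjoint W"
  proof -
    have "H = H * (W * mat_adjoint W)" using W H by simp
    also have "\<dots> = H * W * mat_adjoint W" using W(1) H by (simp add: mult_mat_assoc)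
    finally show ?thesis using HW by simp
  qed
  have "similar_mat H ?D"
    unfolding similar_mat_def similar_mat_wit_def
    using W H HD by (intro exI[of _ W] exI[of _ "mat_adjoint W"]) (auto simp: Let_def)
  then have "char_poly H = char_poly ?D" by (rule char_poly_similar)
  also have "\<dots> = (\<Prod>a\<leftarrow>diag_mat ?D. [:- a, 1:])"
    by (rule char_poly_upper_triangular[of _ n]) (auto simp: mat_diag_def)
  also have "diag_mat ?D = map (\<lambda>e. complex_of_real e) (map d [0..<n])"
    by (simp add: diag_mat_def mat_diag_def)
  finally have cp: "char_poly H = (\<Prod>e\<leftarrow>map d [0..<n]. [:- complex_of_real e, 1:])"
    by (simp add: o_def)
  define es where "es = rev (sort (map d [0..<n]))"
  have es: "mset es = mset (map d [0..<n])" "sorted (rev es)" by (simp_all add: es_def)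
  have l: "l = vec_of_list es"
    unfolding l_def by (rule decreasing_eigenvalues_eqI[OF es(1)[symmetric] es(2) cp])
  have len: "length es = n" by (simp add: es_def)
  obtain p where p: "p permutes {..<n}" "permute_list p (map d [0..<n]) = es"
    using mset_eq_permutation[OF es(1)] by auto
  have lp: "l $ i = d (p i)" if "i < n" for i
  proof -
    have "p i < n" using p(1) that permutes_in_image by fastforce
    then have "es ! i = d (p i)" using that p by (subst p(2)[symmetric], subst permute_list_nth) auto
    then show ?thesis using l by (simp add: vec_of_list_index)
  qed
  show ?thesis
  proof (rule that[of "\<lambda>i. u (p i)"])
    have pn: "p i < n" if "i < n" for i using p(1) that permutes_in_image by fastforce
    show "orthonormal n n (\<lambda>i. u (p i))"
      using u pn permutes_inj[OF p(1)] unfolding orthonormal_def by (auto dest: injD)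
    show "H *\<^sub>v u (p i) = complex_of_real (l $ i) \<cdot>\<^sub>v u (p i)" if "i < n" for i
      using d[OF pn[OF that]] lp[OF that] by simp
    show "l \<in> carrier_vec n" using l len by (simp add: carrier_vecI)
    show "l $ j \<le> l $ i" if "i \<le> j" "j < n" for i j
      using sorted_rev_nth_mono[OF es(2), of i j] that len by (simp add: l vec_of_list_index)
  qed
qed


section \<open>Schmidt decomposition\<close>

text \<open>Row-major flattening, matching the index convention of \<open>kronecker\<close>. Its
  inverse \<open>tensor_mat\<close> takes the dimensions as arguments, since a vector determines
  only their product.\<close>

definition tensor_vec :: "cmat \<Rightarrow> cvec" where
  "tensor_vec M = vec (dim_row M * dim_col M) (\<lambda>x. M $$ (x div dim_col M, x mod dim_col M))"

definition tensor_mat :: "nat \<Rightarrow> nat \<Rightarrow> cvec \<Rightarrow> cmat" where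
  "tensor_mat a b v = mat a b (\<lambda>(i, j). v $ (i * b + j))"

lemma pair_index_less: "i < a \<Longrightarrow> j < b \<Longrightarrow> i * b + j < a * (b :: nat)"
proof -
  assume "i < a" "j < b"
  then have "i * b + j < Suc i * b" by simp
  also have "\<dots> \<le> a * b" using \<open>i < a\<close> by (intro mult_le_mono1) simp
  finally show ?thesis .
qed

lemma div_mod_less:
  assumes "x < a * (b :: nat)"
  shows "x div b < a" "x mod b < b"
  using assms by (auto simp: less_mult_imp_div_less intro!: mod_less_divisor gr0I)

lemma sum_pair_index: "(\<Sum>x<a * b. f x) = (\<Sum>i<a. \<Sum>j<b. f (i * b + j))"
  for f :: "nat \<Rightarrow> 'a :: comm_monoid_add"
proof -
  have "(\<Sum>x<a * b. f x) = (\<Sum>(i, j)\<in>{..<a} \<times> {..<b}. f (i * b + j))"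
    by (rule sum.reindex_bij_witness[of _ "\<lambda>(i, j). i * b + j" "\<lambda>x. (x div b, x mod b)"])
      (auto simp: div_mod_less pair_index_less)
  then show ?thesis by (simp add: sum.cartesian_product)
qed

lemma tensor_mat_carrier [simp]: "tensor_mat a b v \<in> carrier_mat a b"
  by (simp add: tensor_mat_def)

lemma tensor_vec_carrier: "M \<in> carrier_mat a b \<Longrightarrow> tensor_vec M \<in> carrier_vec (a * b)"
  by (auto simp: tensor_vec_def)

lemma tensor_vec_mat: "v \<in> carrier_vec (a * b) \<Longrightarrow> tensor_vec (tensor_mat a b v) = v"
  by (intro eq_vecI) (auto simp: tensor_vec_def tensor_mat_def div_mod_less)

lemma tensor_vec_index:
  "M \<in> carrier_mat a b \<Longrightarrow> i < a \<Longrightarrow> j < b \<Longrightarrow> tensor_vec M $ (i * b + j) = M $$ (i, j)"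
  by (auto simp: tensor_vec_def pair_index_less)

lemma tensor_vec_smult: "tensor_vec (c \<cdot>\<^sub>m M) = c \<cdot>\<^sub>v tensor_vec M"
  by (intro eq_vecI) (auto simp: tensor_vec_def div_mod_less)

lemma tensor_vec_minus:
  "M \<in> carrier_mat a b \<Longrightarrow> N \<in> carrier_mat a b \<Longrightarrow> tensor_vec (M - N) = tensor_vec M - tensor_vec N"
  by (intro eq_vecI) (auto simp: tensor_vec_def div_mod_less)

section \<open>Kronecker products acting on coefficient matrices\<close>

lemma kronecker_dim [simp]:
  "dim_row (A \<otimes>\<^sub>k B) = dim_row A * dim_row B" "dim_col (A \<otimes>\<^sub>k B) = dim_col A * dim_col B"
  by (simp_all add: kronecker_def)

lemma kronecker_carrier:
  "A \<in> carrier_mat a a' \<Longrightarrow> B \<in> carrier_mat b b' \<Longrightarrow> A \<otimes>\<^sub>k B \<in> carrier_mat (a * b) (a' * b')"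
  by (intro carrier_matI) simp_all

lemma kronecker_index:
  "x < dim_row A * dim_row B \<Longrightarrow> y < dim_col A * dim_col B \<Longrightarrow>
    (A \<otimes>\<^sub>k B) $$ (x, y) = A $$ (x div dim_row B, y div dim_col B) * B $$ (x mod dim_row B, y mod dim_col B)"
  by (simp add: kronecker_def)

text \<open>A plain transpose appears, not an adjoint, since no entry is conjugated. In this form
  local operators multiply a factorisation \<open>X * Y\<close> from the outside, so its inner
  dimension, the bound on the Schmidt rank, is preserved.\<close>

lemma kronecker_mult_tensor_vec:
  assumes "A \<in> carrier_mat a' a" "B \<in> carrier_mat b' b" "M \<in> carrier_mat a b"
  shows "(A \<otimes>\<^sub>k B) *\<^sub>v tensor_vec M = tensor_vec (A * M * transpose_mat B)"
proof (rule eq_vecI)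
  fix x assume "x < dim_vec (tensor_vec (A * M * transpose_mat B))"
  then have x: "x < a' * b'" using assms by (simp add: tensor_vec_def)
  have "((A \<otimes>\<^sub>k B) *\<^sub>v tensor_vec M) $ x = (\<Sum>y<a * b. (A \<otimes>\<^sub>k B) $$ (x, y) * tensor_vec M $ y)"
    using x assms tensor_vec_carrier[OF assms(3)] by (simp add: scalar_prod_def lessThan_atLeast0)
  also have "\<dots> = (\<Sum>i<a. \<Sum>j<b. A $$ (x div b', i) * B $$ (x mod b', j) * M $$ (i, j))"
    using x assms by (simp add: sum_pair_index kronecker_index tensor_vec_index[OF assms(3)] pair_index_less)
  also have "\<dots> = (A * M * transpose_mat B) $$ (x div b', x mod b')"
    using x assms div_mod_less[OF x]
    by (simp add: mult_mat_assoc scalar_prod_def lessThan_atLeast0 sum_distrib_left ac_simps)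
  also have "\<dots> = tensor_vec (A * M * transpose_mat B) $ x"
    using x assms by (simp add: tensor_vec_def)
  finally show "((A \<otimes>\<^sub>k B) *\<^sub>v tensor_vec M) $ x = tensor_vec (A * M * transpose_mat B) $ x" .
qed (use assms in \<open>auto simp: tensor_vec_def\<close>)

lemma kronecker_mult:
  assumes "dim_col A = dim_row C" "dim_col B = dim_row D"
  shows "(A \<otimes>\<^sub>k B) * (C \<otimes>\<^sub>k D) = (A * C) \<otimes>\<^sub>k (B * D)"
proof (rule eq_matI)
  fix x y assume "x < dim_row ((A * C) \<otimes>\<^sub>k (B * D))" "y < dim_col ((A * C) \<otimes>\<^sub>k (B * D))"
  then have xy: "x < dim_row A * dim_row B" "y < dim_col C * dim_col D" by auto
  have "((A \<otimes>\<^sub>k B) * (C \<otimes>\<^sub>k D)) $$ (x, y) =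
      (\<Sum>z<dim_row C * dim_row D. (A \<otimes>\<^sub>k B) $$ (x, z) * (C \<otimes>\<^sub>k D) $$ (z, y))"
    using xy assms by (simp add: scalar_prod_def lessThan_atLeast0)
  also have "\<dots> = (\<Sum>i<dim_row C. \<Sum>j<dim_row D. A $$ (x div dim_row B, i) * B $$ (x mod dim_row B, j) *
      (C $$ (i, y div dim_col D) * D $$ (j, y mod dim_col D)))"
    using xy assms by (simp add: sum_pair_index kronecker_index pair_index_less)
  also have "\<dots> = (A * C) $$ (x div dim_row B, y div dim_col D) * (B * D) $$ (x mod dim_row B, y mod dim_col D)"
    using assms div_mod_less[OF xy(1)] div_mod_less[OF xy(2)]
    by (simp add: scalar_prod_def lessThan_atLeast0 sum_product ac_simps)
  also have "\<dots> = ((A * C) \<otimes>\<^sub>k (B * D)) $$ (x, y)" using xy by (simp add: kronecker_index)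
  finally show "((A \<otimes>\<^sub>k B) * (C \<otimes>\<^sub>k D)) $$ (x, y) = ((A * C) \<otimes>\<^sub>k (B * D)) $$ (x, y)" .
qed (use assms in auto)

lemma kronecker_adjoint: "mat_adjoint (A \<otimes>\<^sub>k B) = mat_adjoint A \<otimes>\<^sub>k mat_adjoint B"
  by (intro eq_matI) (auto simp: kronecker_index div_mod_less)

lemma kronecker_one: "1\<^sub>m a \<otimes>\<^sub>k 1\<^sub>m b = 1\<^sub>m (a * b)"
proof (intro eq_matI)
  fix x y assume "x < dim_row (1\<^sub>m (a * b))" "y < dim_col (1\<^sub>m (a * b))"
  then have xy: "x < a * b" "y < a * b" by auto
  have "x div b = y div b \<and> x mod b = y mod b \<longleftrightarrow> x = y" by (metis div_mult_mod_eq)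
  then show "(1\<^sub>m a \<otimes>\<^sub>k 1\<^sub>m b) $$ (x, y) = 1\<^sub>m (a * b) $$ (x, y)"
    using xy div_mod_less[OF xy(1)] div_mod_less[OF xy(2)] by (auto simp: kronecker_index)
qed auto

text \<open>The squared Frobenius norm, which is \<open>norm2\<close> of a state expressed through
  its coefficient matrix.\<close>

definition frob :: "cmat \<Rightarrow> real" where
  "frob M = (\<Sum>i<dim_row M. \<Sum>j<dim_col M. (cmod (M $$ (i, j)))\<^sup>2)"

lemma norm2_tensor_vec: "norm2 (tensor_vec M) = frob M"
proof -
  have "norm2 (tensor_vec M) = (\<Sum>x<dim_row M * dim_col M. (cmod (tensor_vec M $ x))\<^sup>2)"
    by (simp add: norm2_def tensor_vec_def)
  then show ?thesis by (simp add: sum_pair_index frob_def tensor_vec_index[of _ "dim_row M" "dim_col M"])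
qed

lemma frob_adjoint: "frob (mat_adjoint M) = frob M"
  unfolding frob_def by (simp, rule sum.swap)

lemma frob_trace: "complex_of_real (frob M) = (\<Sum>i<dim_row M. (M * mat_adjoint M) $$ (i, i))"
  by (simp add: frob_def scalar_prod_def lessThan_atLeast0 complex_norm_square del: of_real_power)

text \<open>The number is the trace of \<open>M * mat_adjoint M\<close>, in which \<open>W\<close>
  meets its own adjoint and cancels.\<close>

lemma frob_mult_unitary:
  assumes "M \<in> carrier_mat a n" "unitary_mat n W"
  shows "frob (M * W) = frob M"
proof -
  note W = unitary_matD[OF assms(2)]
  have "M * W * mat_adjoint (M * W) = M * (W * mat_adjoint W) * mat_adjoint M"
    using assms(1) W(1) by (simp add: mat_adjoint_mult mult_mat_assoc)
  also have "\<dots> = M * mat_adjoint M" using assms(1) W by simp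
  finally have "complex_of_real (frob (M * W)) = complex_of_real (frob M)"
    using assms(1) by (simp only: frob_trace) simp
  then show ?thesis by simp
qed

lemma frob_unitary_mult:
  assumes "M \<in> carrier_mat n a" "unitary_mat n W"
  shows "frob (W * M) = frob M"
proof -
  have "frob (W * M) = frob (mat_adjoint M * mat_adjoint W)"
    using assms unitary_matD(1)[OF assms(2)] by (subst frob_adjoint[symmetric]) (simp add: mat_adjoint_mult)
  also have "\<dots> = frob M"
    using assms by (subst frob_mult_unitary) (auto simp: frob_adjoint unitary_mat_adjoint)
  finally show ?thesis .
qed

lemma unitary_row_norm:
  assumes "unitary_mat n W" "a < n"
  shows "(\<Sum>i<n. (cmod (W $$ (a, i)))\<^sup>2) = 1"
proof -
  note W = unitary_matD[OF assms(1)]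
  have "complex_of_real (\<Sum>i<n. (cmod (W $$ (a, i)))\<^sup>2) = (W * mat_adjoint W) $$ (a, a)"
    using W(1) assms(2) 
    by (simp add: scalar_prod_def lessThan_atLeast0 complex_norm_square del: of_real_power)
  also have "\<dots> = 1" using W assms by simp
  finally show ?thesis by (simp del: of_real_sum)
qed

lemma unitary_col_norm:
  assumes "unitary_mat n W" "a < n"
  shows "(\<Sum>i<n. (cmod (W $$ (i, a)))\<^sup>2) = 1"
  using unitary_row_norm[OF unitary_mat_adjoint[OF assms(1)] assms(2)] unitary_matD(1)[OF assms(1)] assms(2)
  by simp

text \<open>Tracing out Alice yields the transpose of \<open>mat_adjoint M * M\<close>, and
  transposition leaves the characteristic polynomial unchanged.\<close>

lemma schmidt_coefficients_tensor_vec: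
  assumes "M \<in> carrier_mat n n"
  shows "schmidt_coefficients n (tensor_vec M) = decreasing_eigenvalues (mat_adjoint M * M)"
proof -
  have "partial_trace_A n n (projector (tensor_vec M)) = transpose_mat (mat_adjoint M * M)"
    using assms tensor_vec_carrier[OF assms]
    by (intro eq_matI) (auto simp: partial_trace_A_def projector_def tensor_vec_index[OF assms]
        pair_index_less scalar_prod_def lessThan_atLeast0 mult.commute)
  moreover have "char_poly (transpose_mat (mat_adjoint M * M)) = char_poly (mat_adjoint M * M)"
    by (rule char_poly_transpose_mat[of _ n]) (use assms in auto)
  ultimately show ?thesis
    by (simp add: schmidt_coefficients_def decreasing_eigenvalues_def)
qed

text \<open>Amplitudes are square roots of Schmidt coefficients: for decreasing nonnegative
  \<open>l\<close> this is the coefficient matrix of a state with Schmidt vector \<open>l\<close>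
  and the standard bases as Schmidt bases.\<close>

definition sqrt_diag :: "nat \<Rightarrow> real vec \<Rightarrow> cmat" where
  "sqrt_diag n l = mat_diag n (\<lambda>i. complex_of_real (sqrt (l $ i)))"

lemma sqrt_diag_carrier [simp]: "sqrt_diag n l \<in> carrier_mat n n"
  by (simp add: sqrt_diag_def)

lemma sqrt_diag_dim [simp]: "dim_row (sqrt_diag n l) = n" "dim_col (sqrt_diag n l) = n"
  by (simp_all add: sqrt_diag_def mat_diag_def)

lemma frob_mat_diag: "frob (mat_diag n f) = (\<Sum>i<n. (cmod (f i))\<^sup>2)"
proof -
  have "(\<Sum>j<n. (cmod (mat_diag n f $$ (i, j)))\<^sup>2) = (cmod (f i))\<^sup>2" if "i < n" for i
    using that by (subst sum.remove[of _ i]) (auto simp: mat_diag_def intro!: sum.neutral)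
  then show ?thesis by (simp add: frob_def mat_diag_def)
qed

text \<open>This is the singular value decomposition of the coefficient matrix \<open>M\<close>. The
  eigenvectors \<open>u\<close> of \<open>mat_adjoint M * M\<close> are mapped by \<open>M\<close>
  to orthogonal vectors of squared norms \<open>l $ i\<close>; normalising the nonzero images gives
  left singular vectors.\<close>

theorem schmidt_decomposition:
  assumes v: "v \<in> carrier_vec (n * n)"
  defines "l \<equiv> schmidt_coefficients n v"
  obtains U V where "unitary_mat n U" "unitary_mat n V" "v = tensor_vec (U * sqrt_diag n l * V)"
    "l \<in> carrier_vec n" "\<And>i j. i \<le> j \<Longrightarrow> j < n \<Longrightarrow> l $ j \<le> l $ i" "\<And>i. i < n \<Longrightarrow> 0 \<le> l $ i"
    "(\<Sum>i<n. l $ i) = norm2 v"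
proof -
  define M where "M = tensor_mat n n v"
  have M: "M \<in> carrier_mat n n" by (simp add: M_def)
  have vM: "v = tensor_vec M" using v by (simp add: M_def tensor_vec_mat)
  define H where "H = mat_adjoint M * M"
  have H: "H \<in> carrier_mat n n" "mat_adjoint H = H" using M by (auto simp: H_def mat_adjoint_mult)
  have l: "l = decreasing_eigenvalues H"
    using schmidt_coefficients_tensor_vec[OF M] by (simp add: l_def vM H_def)
  obtain u where u: "orthonormal n n u" "\<And>i. i < n \<Longrightarrow> H *\<^sub>v u i = complex_of_real (l $ i) \<cdot>\<^sub>v u i"
    and lc: "l \<in> carrier_vec n" and sorted: "\<And>i j. i \<le> j \<Longrightarrow> j < n \<Longrightarrow> l $ j \<le> l $ i"
    using hermitian_spectral[OF H] l by metis
  have uc: "u i \<in> carrier_vec n" if "i < n" for i using u that by (auto simp: orthonormal_def)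
  have Mu: "(M *\<^sub>v u i) \<bullet>c (M *\<^sub>v u j) = (if i = j then complex_of_real (l $ i) else 0)"
    if "i < n" "j < n" for i j
  proof -
    have "(M *\<^sub>v u i) \<bullet>c (M *\<^sub>v u j) = cnj ((M *\<^sub>v u j) \<bullet>c (M *\<^sub>v u i))"
      using M uc that by (subst cscalar_prod_cnj[of _ n]) auto
    also have "(M *\<^sub>v u j) \<bullet>c (M *\<^sub>v u i) = u j \<bullet>c (H *\<^sub>v u i)"
      using M uc[OF that(1)] uc[OF that(2)] by (subst cscalar_prod_adjoint[of _ n n]) (auto simp: H_def mult_mat_vec_assoc)
    also have "\<dots> = complex_of_real (l $ i) * (u j \<bullet>c u i)"
      using u(2)[OF that(1)] uc[OF that(1)] uc[OF that(2)] by (simp add: conjugate_smult_vec)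
    finally show ?thesis using u(1) that by (auto simp: orthonormal_def)
  qed
  have l_norm: "norm2 (M *\<^sub>v u i) = l $ i" if "i < n" for i
    using Mu[OF that that] by (simp add: cscalar_prod_self)
  have nonneg: "0 \<le> l $ i" if "i < n" for i using l_norm[OF that] norm2_nonneg by metis
  txt \<open>The rank: the first \<open>r\<close> columns determine \<open>U\<close>, the others are filled up arbitrarily.\<close>
  define r where "r = (LEAST i. n \<le> i \<or> l $ i = 0)"
  have r: "r \<le> n" "r = n \<or> l $ r = 0" "\<And>i. i < r \<Longrightarrow> l $ i \<noteq> 0"
    using LeastI[of "\<lambda>i. n \<le> i \<or> l $ i = 0" n] Least_le[of "\<lambda>i. n \<le> i \<or> l $ i = 0" n]
      not_less_Least[of _ "\<lambda>i. n \<le> i \<or> l $ i = 0"] unfolding r_def[symmetric] by auto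
  \<comment> \<open>A decreasing nonnegative vector stays zero after its first zero.\<close>
  have l0: "l $ i = 0" if "r \<le> i" "i < n" for i
    using r(1,2) sorted[OF that] nonneg[OF that(2)] that by auto
  have lpos: "l $ i > 0" if "i < r" for i using r(1,3) nonneg[of i] that by (metis less_le_trans less_le)
  define x where "x = (\<lambda>i. complex_of_real (1 / sqrt (l $ i)) \<cdot>\<^sub>v (M *\<^sub>v u i))"
  have "orthonormal n r x"
    unfolding orthonormal_def
  proof (intro conjI allI impI)
    fix i j assume i: "i < r" and j: "j < r"
    then have ij: "i < n" "j < n" using r by auto
    show "x i \<in> carrier_vec n" by (intro carrier_vecI) (use M in \<open>simp add: x_def\<close>)
    have "x i \<bullet>c x j = complex_of_real (1 / sqrt (l $ i)) * complex_of_real (1 / sqrt (l $ j)) * ((M *\<^sub>v u i) \<bullet>c (M *\<^sub>v u j))"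
      using M uc ij by (simp add: x_def conjugate_smult_vec)
    also have "\<dots> = (if i = j then 1 else 0)"
      unfolding Mu[OF ij] using lpos[OF i]
      by (auto simp: of_real_mult[symmetric] simp del: of_real_mult of_real_divide)
    finally show "x i \<bullet>c x j = (if i = j then 1 else 0)" .
  qed
  then obtain w where w: "orthonormal n n w" "\<And>i. i < r \<Longrightarrow> w i = x i"
    using orthonormal_extend r(1) by blast
  have wc: "w i \<in> carrier_vec n" if "i < n" for i using w that by (auto simp: orthonormal_def)
  have Muw: "M *\<^sub>v u i = complex_of_real (sqrt (l $ i)) \<cdot>\<^sub>v w i" if "i < n" for i
  proof (cases "i < r")
    case True
    then show ?thesis using lpos[OF True] w(2)[OF True]
      by (simp add: x_def smult_smult_assoc of_real_mult[symmetric] del: of_real_mult of_real_divide)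
  next
    case False
    then have "norm2 (M *\<^sub>v u i) = 0" using l0[of i] l_norm that by simp
    then have "M *\<^sub>v u i = 0\<^sub>v n" using M by (simp add: norm2_eq_0)
    then show ?thesis using l0[of i] False that wc[OF that] by (auto intro!: eq_vecI)
  qed
  define U where "U = mat n n (\<lambda>(i, j). w j $ i)"
  define W where "W = mat n n (\<lambda>(i, j). u j $ i)"
  have U: "unitary_mat n U" unfolding U_def by (rule orthonormal_unitary[OF w(1)])
  have W: "unitary_mat n W" unfolding W_def by (rule orthonormal_unitary[OF u(1)])
  note Uc = unitary_matD(1)[OF U] and WD = unitary_matD[OF W]
  have "M * W = U * sqrt_diag n l"
  proof (rule eq_matI)
    fix i j assume "i < dim_row (U * sqrt_diag n l)" "j < dim_col (U * sqrt_diag n l)"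
    then have ij: "i < n" "j < n" using Uc by (auto simp: sqrt_diag_def mat_diag_def)
    have "col W j = u j" using ij uc[OF ij(2)] by (intro eq_vecI) (auto simp: W_def)
    then have "(M * W) $$ (i, j) = (M *\<^sub>v u j) $ i" using ij M WD by simp
    also have "\<dots> = (U * sqrt_diag n l) $$ (i, j)"
      using ij Uc wc[OF ij(2)] unfolding Muw[OF ij(2)]
      by (simp add: sqrt_diag_def mat_diag_mult_right[of _ n] U_def)
    finally show "(M * W) $$ (i, j) = (U * sqrt_diag n l) $$ (i, j)" .
  qed (use M Uc WD in \<open>auto simp: sqrt_diag_def mat_diag_def\<close>)
  moreover have "M = M * W * mat_adjoint W" using M WD by (simp add: mult_mat_assoc)
  ultimately have MU: "M = U * sqrt_diag n l * mat_adjoint W" by simp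
  have "norm2 v = frob (sqrt_diag n l)"
    using Uc W U unfolding vM norm2_tensor_vec MU
    by (subst frob_mult_unitary[of _ n n]) (auto simp: unitary_mat_adjoint frob_unitary_mult[of _ n n])
  also have "\<dots> = (\<Sum>i<n. l $ i)"
    using nonneg by (simp add: sqrt_diag_def frob_mat_diag)
  finally show ?thesis
    using that[OF U unitary_mat_adjoint[OF W] _ lc sorted nonneg] vM MU by simp
qed

text \<open>The diagonal is decreasing already, so the sorting inside
  \<open>decreasing_eigenvalues\<close> returns it unchanged.\<close>

lemma schmidt_coefficients_diag:
  assumes "l \<in> carrier_vec n" "\<And>i j. i \<le> j \<Longrightarrow> j < n \<Longrightarrow> l $ j \<le> l $ i" "\<And>i. i < n \<Longrightarrow> 0 \<le> l $ i"
  shows "schmidt_coefficients n (tensor_vec (sqrt_diag n l)) = l"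
proof -
  have "mat_adjoint (sqrt_diag n l) * sqrt_diag n l = mat_diag n (\<lambda>i. complex_of_real (l $ i))"
  proof -
    have "mat_adjoint (sqrt_diag n l) = sqrt_diag n l"
      by (intro eq_matI) (auto simp: sqrt_diag_def mat_diag_def)
    then show ?thesis using assms(3)
      by (auto simp: sqrt_diag_def of_real_mult[symmetric] simp del: of_real_mult)
        (auto simp: mat_diag_def)
  qed
  then have "schmidt_coefficients n (tensor_vec (sqrt_diag n l)) =
      decreasing_eigenvalues (mat_diag n (\<lambda>i. complex_of_real (l $ i)))"
    by (simp add: schmidt_coefficients_tensor_vec)
  also have "\<dots> = vec_of_list (map (\<lambda>i. l $ i) [0..<n])"
  proof (rule decreasing_eigenvalues_eqI[OF refl])
    show "sorted (rev (map (($) l) [0..<n]))"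
      using assms(2) by (auto simp: sorted_rev_iff_nth_mono)
    have "diag_mat (mat_diag n (\<lambda>i. complex_of_real (l $ i))) = map (\<lambda>e. complex_of_real e) (map (($) l) [0..<n])"
      by (simp add: diag_mat_def mat_diag_def)
    then show "char_poly (mat_diag n (\<lambda>i. complex_of_real (l $ i))) = (\<Prod>e\<leftarrow>map (($) l) [0..<n]. [:- complex_of_real e, 1:])"
      by (subst char_poly_upper_triangular[of _ n]) (auto simp: mat_diag_def o_def)
  qed
  also have "\<dots> = l" using assms(1) by (intro eq_vecI) (auto simp: vec_of_list_index)
  finally show ?thesis .
qed


section \<open>Approximation by states of bounded Schmidt rank\<close>

text \<open>The weighted sum is least when full weight sits on the smallest entries. With threshold
  \<open>t\<close> and tail indicator \<open>b\<close>, both factors of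
  \<open>(l i - t) * (c i - b i)\<close> are nonnegative before \<open>k\<close> and nonpositive
  from \<open>k\<close> on, and the totals of \<open>c\<close> and \<open>b\<close> agree.\<close>

lemma sum_tail_le_weighted_sum:
  fixes l c :: "nat \<Rightarrow> real"
  assumes "k \<le> n" "\<And>i j. i \<le> j \<Longrightarrow> j < n \<Longrightarrow> l j \<le> l i" "\<And>i. i < n \<Longrightarrow> 0 \<le> c i" "\<And>i. i < n \<Longrightarrow> c i \<le> 1"
    and "(\<Sum>i<n. c i) = real (n - k)"
  shows "(\<Sum>i=k..<n. l i) \<le> (\<Sum>i<n. l i * c i)"
proof (cases "k = n")
  case True
  then have "c i = 0" if "i < n" for i
    using assms(3,5) that sum_nonneg_eq_0_iff[of "{..<n}" c] by simp
  then show ?thesis using True by simp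
next
  case False
  \<comment> \<open>Here \<open>k < n\<close>, so \<open>l k\<close> is an entry in the range where
    \<open>l\<close> is known to decrease.\<close>
  define t where "t = l k"
  define b :: "nat \<Rightarrow> real" where "b = (\<lambda>i. if k \<le> i then 1 else 0)"
  have set: "{i. i < n \<and> k \<le> i} = {k..<n}" by auto
  have b: "(\<Sum>i<n. f i * b i) = (\<Sum>i=k..<n. f i)" for f
  proof -
    have "(\<Sum>i<n. f i * b i) = (\<Sum>i<n. if k \<le> i then f i else 0)"
      by (rule sum.cong) (auto simp: b_def)
    then show ?thesis by (simp add: sum.inter_filter[symmetric] set)
  qed
  have "0 \<le> (\<Sum>i<n. (l i - t) * (c i - b i))"
  proof (rule sum_nonneg)
    fix i assume "i \<in> {..<n}"
    then have i: "i < n" by simp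
    show "0 \<le> (l i - t) * (c i - b i)"
    proof (cases "k \<le> i")
      case True
      then show ?thesis using assms(2)[of k i] assms(4)[OF i] i
        by (intro mult_nonpos_nonpos) (auto simp: t_def b_def)
    next
      case False
      then show ?thesis using assms(2)[of i k] assms(3)[OF i] assms(1) \<open>k \<noteq> n\<close>
        by (intro mult_nonneg_nonneg) (auto simp: t_def b_def)
    qed
  qed
  also have "\<dots> = (\<Sum>i<n. l i * c i) - (\<Sum>i<n. l i * b i) - t * ((\<Sum>i<n. c i) - (\<Sum>i<n. 1 * b i))"
    by (simp add: algebra_simps sum.distrib sum_subtractf sum_distrib_left)
  also have "\<dots> = (\<Sum>i<n. l i * c i) - (\<Sum>i=k..<n. l i)"
    unfolding b using assms(1,5) by simp
  finally show ?thesis by simp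
qed

lemma norm2_unitary_mult:
  assumes "unitary_mat n U" "x \<in> carrier_vec n"
  shows "norm2 (U *\<^sub>v x) = norm2 x"
proof -
  note U = unitary_matD[OF assms(1)]
  have "(U *\<^sub>v x) \<bullet>c (U *\<^sub>v x) = x \<bullet>c (mat_adjoint U *\<^sub>v (U *\<^sub>v x))"
    using U(1) assms(2) by (intro cscalar_prod_adjoint[of _ n n]) auto
  also have "mat_adjoint U *\<^sub>v (U *\<^sub>v x) = x"
    using U assms(2) by (simp add: mult_mat_vec_assoc[symmetric])
  finally show ?thesis by (simp add: cscalar_prod_self)
qed

text \<open>
  A matrix of rank \<open>k\<close> vanishes on \<open>n - k\<close> orthonormal vectors, so there the difference is \<open>M\<close> itself.
\<close>

lemma eckart_young_lower:
  assumes v: "v \<in> carrier_vec (n * n)" and k: "k \<le> n"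
    and X: "X \<in> carrier_mat n k" and Y: "Y \<in> carrier_mat k n"
  shows "(\<Sum>i=k..<n. schmidt_coefficients n v $ i) \<le> norm2 (v - tensor_vec (X * Y))"
proof -
  define l where "l = schmidt_coefficients n v"
  obtain U V where U: "unitary_mat n U" and V: "unitary_mat n V"
    and vM: "v = tensor_vec (U * sqrt_diag n l * V)"
    and l: "\<And>i j. i \<le> j \<Longrightarrow> j < n \<Longrightarrow> l $ j \<le> l $ i" "\<And>i. i < n \<Longrightarrow> 0 \<le> l $ i"
    using schmidt_decomposition[OF v] unfolding l_def by metis
  note Uc = unitary_matD(1)[OF U] and Vc = unitary_matD(1)[OF V]
  define M where "M = U * sqrt_diag n l * V"
  have M: "M \<in> carrier_mat n n" using Uc Vc by (simp add: M_def mult_carrier_mat[of _ n n])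
  \<comment> \<open>Conjugated, so that orthogonality to \<open>y\<close> says that the rows of
    \<open>Y\<close> annihilate the vector.\<close>
  define y where "y = (\<lambda>j. conjugate (row Y j))"
  have yc: "y j \<in> carrier_vec n" for j using Y by (simp add: y_def carrier_vecI)
  obtain u where u: "orthonormal n (n - k) u" "\<And>i j. i < n - k \<Longrightarrow> j < k \<Longrightarrow> u i \<bullet>c y j = 0"
    by (rule orthonormal_complement[OF k, of y]) (use yc in auto)
  obtain w where w: "orthonormal n n w" "\<And>i. i < n - k \<Longrightarrow> w i = u i"
    using orthonormal_extend[OF u(1)] by auto
  have wc: "w i \<in> carrier_vec n" if "i < n" for i using w that by (auto simp: orthonormal_def)
  define W where "W = mat n n (\<lambda>(i, j). w j $ i)"
  have W: "unitary_mat n W" unfolding W_def by (rule orthonormal_unitary[OF w(1)])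
  note Wc = unitary_matD(1)[OF W]
  have colW: "col W i = w i" if "i < n" for i
    using that wc[OF that] by (intro eq_vecI) (auto simp: W_def)
  have YW: "(Y * W) $$ (j, i) = 0" if "j < k" "i < n - k" for i j
  proof -
    have "(Y * W) $$ (j, i) = row Y j \<bullet> w i" using that Y Wc k colW by simp
    also have "\<dots> = w i \<bullet>c y j"
      using that wc Y by (simp add: y_def comm_scalar_prod[of _ n])
    finally show ?thesis using u(2) w(2) that by simp
  qed
  define N where "N = M - X * Y"
  have N: "N \<in> carrier_mat n n" unfolding N_def by (intro minus_carrier_mat mult_carrier_mat[OF X Y])
  have NW: "(N * W) $$ (a, i) = (M * W) $$ (a, i)" if "a < n" "i < n - k" for a i
  proof -
    have "N * W = M * W - X * (Y * W)"
      using M X Y Wc by (simp add: N_def minus_mult_distrib_mat[of _ n n] mult_mat_assoc)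
    moreover have "(X * (Y * W)) $$ (a, i) = 0"
    proof -
      have "col (Y * W) i = 0\<^sub>v k" using YW[of _ i] that Y Wc by (intro eq_vecI) auto
      then show ?thesis using that X Y Wc by (simp del: col_mult2)
    qed
    ultimately show ?thesis using that M X Y Wc by simp
  qed
  \<comment> \<open>The columns of \<open>Z\<close> are the vectors \<open>w\<close> in the
    coordinates given by \<open>V\<close>, where \<open>M\<close> acts diagonally up to the unitary
    \<open>U\<close>.\<close>
  define Z where "Z = V * W"
  have Z: "unitary_mat n Z" unfolding Z_def by (rule unitary_mat_mult[OF V W])
  note Zc = unitary_matD(1)[OF Z]
  have SZ: "sqrt_diag n l * Z = mat n n (\<lambda>(a, i). complex_of_real (sqrt (l $ a)) * Z $$ (a, i))"
    using Zc by (simp add: sqrt_diag_def mat_diag_mult_left[of _ n n])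
  \<comment> \<open>The weight of row \<open>a\<close> in the first \<open>n - k\<close> columns of
    a unitary: at most 1 because rows are unit vectors, with total \<open>n - k\<close> because
    columns are.\<close>
  define c where "c = (\<lambda>a. \<Sum>i<n - k. (cmod (Z $$ (a, i)))\<^sup>2)"
  have "(\<Sum>a=k..<n. l $ a) \<le> (\<Sum>a<n. l $ a * c a)"
  proof (rule sum_tail_le_weighted_sum[OF k l(1)])
    show "0 \<le> c a" for a by (simp add: c_def sum_nonneg)
    show "c a \<le> 1" if "a < n" for a
      unfolding c_def unitary_row_norm[OF Z that, symmetric] by (rule sum_mono2) auto
    have "(\<Sum>a<n. c a) = (\<Sum>i<n - k. \<Sum>a<n. (cmod (Z $$ (a, i)))\<^sup>2)"
      unfolding c_def by (rule sum.swap)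
    also have "\<dots> = (\<Sum>i<n - k. 1)" by (rule sum.cong) (auto simp: unitary_col_norm[OF Z])
    finally show "(\<Sum>a<n. c a) = real (n - k)" by simp
  qed
  also have "(\<Sum>a<n. l $ a * c a) = (\<Sum>a<n. \<Sum>i<n - k. (cmod ((sqrt_diag n l * Z) $$ (a, i)))\<^sup>2)"
    unfolding SZ using l(2)
    by (intro sum.cong refl) (auto simp: c_def norm_mult power_mult_distrib sum_distrib_left)
  also have "\<dots> = (\<Sum>i<n - k. \<Sum>a<n. (cmod ((sqrt_diag n l * Z) $$ (a, i)))\<^sup>2)"
    by (rule sum.swap)
  also have "\<dots> = (\<Sum>i<n - k. \<Sum>a<n. (cmod ((M * W) $$ (a, i)))\<^sup>2)"
  proof (rule sum.cong[OF refl])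
    fix i assume "i \<in> {..<n - k}"
    then have i: "i < n" by simp
    have "M * W = U * (sqrt_diag n l * Z)"
      using Uc Vc Wc by (simp add: M_def Z_def mult_mat_assoc carrier_matD[OF sqrt_diag_carrier])
    then have "col (M * W) i = U *\<^sub>v col (sqrt_diag n l * Z) i"
      using i Zc Uc by (intro eq_vecI) (simp_all del: col_mult2)
    then have "norm2 (col (M * W) i) = norm2 (col (sqrt_diag n l * Z) i)"
      by (simp add: norm2_unitary_mult[OF U] carrier_vecI carrier_matD[OF sqrt_diag_carrier])
    then show "(\<Sum>a<n. (cmod ((sqrt_diag n l * Z) $$ (a, i)))\<^sup>2) = (\<Sum>a<n. (cmod ((M * W) $$ (a, i)))\<^sup>2)"
      using i M Wc Zc by (simp add: norm2_def carrier_matD[OF sqrt_diag_carrier])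
  qed
  \<comment> \<open>On these columns \<open>X * Y\<close> contributes nothing, so \<open>M\<close>
    may be replaced by the difference \<open>N\<close>. Adding the remaining columns then only
    increases the sum.\<close>
  also have "\<dots> = (\<Sum>i<n - k. \<Sum>a<n. (cmod ((N * W) $$ (a, i)))\<^sup>2)"
    by (intro sum.cong refl) (simp add: NW)
  also have "\<dots> = (\<Sum>a<n. \<Sum>i<n - k. (cmod ((N * W) $$ (a, i)))\<^sup>2)"
    by (rule sum.swap)
  also have "\<dots> \<le> (\<Sum>a<n. \<Sum>i<n. (cmod ((N * W) $$ (a, i)))\<^sup>2)"
    by (intro sum_mono sum_mono2) auto
  also have "\<dots> = frob (N * W)" using N Wc by (simp add: frob_def)
  also have "\<dots> = frob N" by (rule frob_mult_unitary[OF N W])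
  also have "\<dots> = norm2 (v - tensor_vec (X * Y))"
    using M X Y by (simp add: norm2_tensor_vec[symmetric] N_def tensor_vec_minus[of _ n n] vM M_def)
  finally show ?thesis by (simp add: l_def)
qed

text \<open>Truncation of the singular value decomposition: \<open>X\<close> takes the first
  \<open>k\<close> columns of \<open>U\<close>, \<open>Y\<close> the first \<open>k\<close> rows of
  \<open>V\<close> scaled by the singular values. The remainder is diagonal between the same
  unitaries, so its norm can be read off.\<close>

lemma eckart_young_upper:
  assumes v: "v \<in> carrier_vec (n * n)" and k: "k \<le> n"
  obtains X Y where "X \<in> carrier_mat n k" "Y \<in> carrier_mat k n"
    "norm2 (v - tensor_vec (X * Y)) = (\<Sum>i=k..<n. schmidt_coefficients n v $ i)"
proof -
  define l where "l = schmidt_coefficients n v"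
  obtain U V where U: "unitary_mat n U" and V: "unitary_mat n V"
    and vM: "v = tensor_vec (U * sqrt_diag n l * V)" and l: "\<And>i. i < n \<Longrightarrow> 0 \<le> l $ i"
    using schmidt_decomposition[OF v] unfolding l_def by metis
  note Uc = unitary_matD(1)[OF U] and Vc = unitary_matD(1)[OF V]
  let ?D = "mat_diag n (\<lambda>i. if i < k then 0 else complex_of_real (sqrt (l $ i)))"
  define X where "X = mat n k (\<lambda>(a, i). U $$ (a, i))"
  define Y where "Y = mat k n (\<lambda>(i, b). complex_of_real (sqrt (l $ i)) * V $$ (i, b))"
  have XY: "X \<in> carrier_mat n k" "Y \<in> carrier_mat k n" by (simp_all add: X_def Y_def)
  have US: "U * mat_diag n f = mat n n (\<lambda>(i, j). U $$ (i, j) * f j)" for f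
    using Uc by (rule mat_diag_mult_right)
  have "U * sqrt_diag n l * V - X * Y = U * ?D * V"
  proof (rule eq_matI)
    fix a b assume "a < dim_row (U * ?D * V)" "b < dim_col (U * ?D * V)"
    then have ab: "a < n" "b < n" using Uc Vc by auto
    define g where "g = (\<lambda>i. U $$ (a, i) * complex_of_real (sqrt (l $ i)) * V $$ (i, b))"
    have "(U * sqrt_diag n l * V) $$ (a, b) = (\<Sum>i<n. g i)"
      using ab Vc by (simp add: sqrt_diag_def US scalar_prod_def lessThan_atLeast0 g_def)
    moreover have "(X * Y) $$ (a, b) = (\<Sum>i<k. g i)"
      using ab by (simp add: X_def Y_def scalar_prod_def lessThan_atLeast0 g_def mult.assoc)
    moreover have "(U * ?D * V) $$ (a, b) = (\<Sum>i<n. if i < k then 0 else g i)"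
      using ab Vc Uc by (simp add: US scalar_prod_def lessThan_atLeast0 g_def if_distrib if_distribR cong: if_cong)
    moreover have "(\<Sum>i<n. g i) = (\<Sum>i<k. g i) + (\<Sum>i<n. if i < k then 0 else g i)"
    proof -
      have "(\<Sum>i<n. g i) = (\<Sum>i<n. if i < k then g i else 0) + (\<Sum>i<n. if i < k then 0 else g i)"
        by (subst sum.distrib[symmetric]) (intro sum.cong, auto)
      moreover have "(\<Sum>i<n. if i < k then g i else 0) = (\<Sum>i<k. g i)"
        using k by (subst sum.inter_filter[symmetric]) (auto intro: sum.cong)
      ultimately show ?thesis by simp
    qed
    ultimately show "(U * sqrt_diag n l * V - X * Y) $$ (a, b) = (U * ?D * V) $$ (a, b)"
      using ab XY Uc Vc by simp
  qed (use Uc Vc XY in auto)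
  then have "v - tensor_vec (X * Y) = tensor_vec (U * ?D * V)"
    using XY Uc Vc by (simp add: vM tensor_vec_minus[of _ n n, symmetric] mult_carrier_mat[of _ n n])
  then have "norm2 (v - tensor_vec (X * Y)) = frob ?D"
    using Uc U V by (simp add: norm2_tensor_vec frob_mult_unitary[of _ n n] frob_unitary_mult[of _ n n] mult_carrier_mat[of _ n n])
  also have "\<dots> = (\<Sum>i<n. if i < k then 0 else l $ i)"
    unfolding frob_mat_diag using l by (intro sum.cong) auto
  also have "\<dots> = (\<Sum>i=k..<n. l $ i)"
  proof -
    have "(\<Sum>i<n. if i < k then 0 else l $ i) = (\<Sum>i<n. if k \<le> i then l $ i else 0)"
      by (rule sum.cong) auto
    moreover have "{i. i < n \<and> k \<le> i} = {k..<n}" by auto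
    ultimately show ?thesis by (simp add: sum.inter_filter[symmetric])
  qed
  finally show ?thesis using that XY by (simp add: l_def)
qed


section \<open>LOCC operations are separable\<close>

lemma mat_sum_carrier [simp]: "mat_sum nr nc I X \<in> carrier_mat nr nc"
  by (simp add: mat_sum_def)

lemma mat_sum_dim [simp]: "dim_row (mat_sum nr nc I X) = nr" "dim_col (mat_sum nr nc I X) = nc"
  by (simp_all add: mat_sum_def)

lemma mat_sum_index [simp]:
  "x < nr \<Longrightarrow> y < nc \<Longrightarrow> mat_sum nr nc I X $$ (x, y) = (\<Sum>i\<in>I. X i $$ (x, y))"
  by (simp add: mat_sum_def)

lemma mat_sum_cong: "(\<And>i. i \<in> I \<Longrightarrow> X i = Y i) \<Longrightarrow> mat_sum nr nc I X = mat_sum nr nc I Y"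
  by (intro eq_matI) auto

lemma mult3_index:
  assumes "C \<in> carrier_mat a b" "S \<in> carrier_mat b c" "D \<in> carrier_mat c d" "x < a" "y < d"
  shows "(C * S * D) $$ (x, y) = (\<Sum>p<b. \<Sum>q<c. C $$ (x, p) * S $$ (p, q) * (D :: cmat) $$ (q, y))"
  using assms by (simp add: scalar_prod_def lessThan_atLeast0 sum_distrib_left mult.assoc)

lemma mat_sum_mult_mult:
  assumes "C \<in> carrier_mat a b" "D \<in> carrier_mat c d" "\<And>i. i \<in> I \<Longrightarrow> X i \<in> carrier_mat b c"
  shows "C * mat_sum b c I X * D = mat_sum a d I (\<lambda>i. C * X i * D)"
proof (rule eq_matI)
  fix x y assume "x < dim_row (mat_sum a d I (\<lambda>i. C * X i * D))" "y < dim_col (mat_sum a d I (\<lambda>i. C * X i * D))"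
  then have xy: "x < a" "y < d" by auto
  have "(C * mat_sum b c I X * D) $$ (x, y) =
      (\<Sum>p<b. \<Sum>q<c. \<Sum>i\<in>I. C $$ (x, p) * X i $$ (p, q) * D $$ (q, y))"
    using assms xy by (subst mult3_index[of _ a b _ c _ d]) (auto simp: sum_distrib_left sum_distrib_right)
  also have "\<dots> = (\<Sum>p<b. \<Sum>i\<in>I. \<Sum>q<c. C $$ (x, p) * X i $$ (p, q) * D $$ (q, y))"
    by (intro sum.cong refl sum.swap)
  also have "\<dots> = (\<Sum>i\<in>I. \<Sum>p<b. \<Sum>q<c. C $$ (x, p) * X i $$ (p, q) * D $$ (q, y))"
    by (rule sum.swap)
  also have "\<dots> = mat_sum a d I (\<lambda>i. C * X i * D) $$ (x, y)"
    using xy mult3_index[OF assms(1) assms(3) assms(2) xy]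
    by (simp del: index_mult_mat(1) assoc_mult_mat)
  finally show "(C * mat_sum b c I X * D) $$ (x, y) = mat_sum a d I (\<lambda>i. C * X i * D) $$ (x, y)" .
qed (use assms in auto)

text \<open>Lists of outcomes index the Kraus operators, so that rounds compose by prepending outcomes.\<close>

definition separable :: "nat \<Rightarrow> nat \<Rightarrow> nat \<Rightarrow> nat \<Rightarrow> (cmat \<Rightarrow> cmat) \<Rightarrow> bool" where
  "separable a' b' a b L \<longleftrightarrow> (\<exists>(I :: nat list set) A B. finite I \<and>
     (\<forall>i\<in>I. A i \<in> carrier_mat a' a \<and> B i \<in> carrier_mat b' b) \<and>
     mat_sum (a * b) (a * b) I (\<lambda>i. mat_adjoint (A i \<otimes>\<^sub>k B i) * (A i \<otimes>\<^sub>k B i)) = 1\<^sub>m (a * b) \<and>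
     (\<forall>\<sigma>\<in>carrier_mat (a * b) (a * b).
        L \<sigma> = mat_sum (a' * b') (a' * b') I (\<lambda>i. (A i \<otimes>\<^sub>k B i) * \<sigma> * mat_adjoint (A i \<otimes>\<^sub>k B i))))"

text \<open>The announced outcome \<open>j\<close> and the undiscriminated Kraus index
  \<open>l\<close> are separate list entries, so a round prepends two numbers.\<close>

lemma sum_image_Cons2:
  assumes "\<And>j. j < m \<Longrightarrow> finite (I j)"
  shows "sum g {j # l # x | j l x. j < m \<and> l < r j \<and> x \<in> I j} =
    (\<Sum>j<(m :: nat). \<Sum>l<(r j :: nat). \<Sum>x\<in>I j. g (j # l # x))"
proof -
  have "{j # l # x | j l x. j < m \<and> l < r j \<and> x \<in> I j} =
      (\<lambda>(j, l, x). j # l # x) ` (SIGMA j:{..<m}. SIGMA l:{..<r j}. I j)"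
    by force
  moreover have "inj_on (\<lambda>(j, l, x). j # l # x) (SIGMA j:{..<m}. SIGMA l:{..<r j}. I j)"
    by (auto simp: inj_on_def)
  ultimately have "sum g {j # l # x | j l x. j < m \<and> l < r j \<and> x \<in> I j} =
      (\<Sum>(j, l, x)\<in>(SIGMA j:{..<m}. SIGMA l:{..<r j}. I j). g (j # l # x))"
    by (simp add: sum.reindex split_def)
  also have "\<dots> = (\<Sum>j<m. \<Sum>(l, x)\<in>(SIGMA l:{..<r j}. I j). g (j # l # x))"
    using assms by (subst sum.Sigma[symmetric]) auto
  also have "\<dots> = (\<Sum>j<m. \<Sum>l<r j. \<Sum>x\<in>I j. g (j # l # x))"
    using assms by (intro sum.cong refl) (subst sum.Sigma[symmetric], auto)
  finally show ?thesis .
qed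

text \<open>With both local factors \<open>P\<close> and \<open>Q\<close> general, one statement
  covers a round of either party, the passive one applying the identity. The outcome-dependent
  dimensions occur only inside the products \<open>C j i * E j l\<close>.\<close>

lemma separable_compose:
  fixes m :: nat and r :: "nat \<Rightarrow> nat"
  assumes P: "\<And>j l. j < m \<Longrightarrow> l < r j \<Longrightarrow> P j l \<in> carrier_mat (da j) a"
    and Q: "\<And>j l. j < m \<Longrightarrow> l < r j \<Longrightarrow> Q j l \<in> carrier_mat (db j) b"
    and norm: "\<And>x y. x < a * b \<Longrightarrow> y < a * b \<Longrightarrow>
      (\<Sum>j<m. \<Sum>l<r j. (mat_adjoint (P j l \<otimes>\<^sub>k Q j l) * (P j l \<otimes>\<^sub>k Q j l)) $$ (x, y)) = 1\<^sub>m (a * b) $$ (x, y)"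
    and L: "\<And>j. j < m \<Longrightarrow> separable a' b' (da j) (db j) (L j)"
  shows "separable a' b' a b (\<lambda>\<sigma>. mat_sum (a' * b') (a' * b') {..<m}
      (\<lambda>j. L j (kraus_map (da j * db j) (r j) (\<lambda>l. P j l \<otimes>\<^sub>k Q j l) \<sigma>)))"
proof -
  define E where "E = (\<lambda>j l. P j l \<otimes>\<^sub>k Q j l)"
  have Ec: "E j l \<in> carrier_mat (da j * db j) (a * b)" if "j < m" "l < r j" for j l
    unfolding E_def using P Q that by (intro kronecker_carrier) auto
  \<comment> \<open>The premise \<open>j < m\<close> stands inside the existential quantifiers so
    that choice delivers functions defined for every \<open>j\<close>.\<close>
  have "\<forall>j. \<exists>I A B. j < m \<longrightarrow> finite (I :: nat list set) \<and>
     (\<forall>i\<in>I. A i \<in> carrier_mat a' (da j) \<and> B i \<in> carrier_mat b' (db j)) \<and>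
     mat_sum (da j * db j) (da j * db j) I (\<lambda>i. mat_adjoint (A i \<otimes>\<^sub>k B i) * (A i \<otimes>\<^sub>k B i)) = 1\<^sub>m (da j * db j) \<and>
     (\<forall>\<sigma>\<in>carrier_mat (da j * db j) (da j * db j).
        L j \<sigma> = mat_sum (a' * b') (a' * b') I (\<lambda>i. (A i \<otimes>\<^sub>k B i) * \<sigma> * mat_adjoint (A i \<otimes>\<^sub>k B i)))"
    using L unfolding separable_def by (simp only: ex_simps) (rule allI, rule impI)
  then obtain I A B where T: "\<forall>j. j < m \<longrightarrow> finite (I j :: nat list set) \<and>
     (\<forall>i\<in>I j. A j i \<in> carrier_mat a' (da j) \<and> B j i \<in> carrier_mat b' (db j)) \<and>
     mat_sum (da j * db j) (da j * db j) (I j) (\<lambda>i. mat_adjoint (A j i \<otimes>\<^sub>k B j i) * (A j i \<otimes>\<^sub>k B j i)) = 1\<^sub>m (da j * db j) \<and>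
     (\<forall>\<sigma>\<in>carrier_mat (da j * db j) (da j * db j).
        L j \<sigma> = mat_sum (a' * b') (a' * b') (I j) (\<lambda>i. (A j i \<otimes>\<^sub>k B j i) * \<sigma> * mat_adjoint (A j i \<otimes>\<^sub>k B j i)))"
    unfolding choice_iff by blast
  define C where "C = (\<lambda>j i. A j i \<otimes>\<^sub>k B j i)"
  have I: "finite (I j)" if "j < m" for j using T that by blast
  have A: "A j i \<in> carrier_mat a' (da j)" and B: "B j i \<in> carrier_mat b' (db j)"
    if "j < m" "i \<in> I j" for j i using T that by blast+
  have Cc: "C j i \<in> carrier_mat (a' * b') (da j * db j)" if "j < m" "i \<in> I j" for j i
    unfolding C_def using A B that by (intro kronecker_carrier) auto
  have C1: "mat_sum (da j * db j) (da j * db j) (I j) (\<lambda>i. mat_adjoint (C j i) * C j i) = 1\<^sub>m (da j * db j)"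
    if "j < m" for j using T that by (simp add: C_def)
  have CL: "L j \<sigma> = mat_sum (a' * b') (a' * b') (I j) (\<lambda>i. C j i * \<sigma> * mat_adjoint (C j i))"
    if "j < m" "\<sigma> \<in> carrier_mat (da j * db j) (da j * db j)" for j \<sigma>
    using T that by (simp add: C_def)
  define J :: "nat list set" where "J = {j # l # x | j l x. j < m \<and> l < r j \<and> x \<in> I j}"
  \<comment> \<open>In a list from \<open>J\<close>, entry 0 is the announced outcome, entry 1 the
    Kraus index of this round, and the rest an outcome of the continuing protocol.\<close>
  define A' where "A' = (\<lambda>z. A (z ! 0) (drop 2 z) * P (z ! 0) (z ! 1))"
  define B' where "B' = (\<lambda>z. B (z ! 0) (drop 2 z) * Q (z ! 0) (z ! 1))"
  have C': "A' (j # l # x) \<otimes>\<^sub>k B' (j # l # x) = C j x * E j l" if "j < m" "l < r j" "x \<in> I j" for j l x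
    using A[OF that(1,3)] B[OF that(1,3)] P[OF that(1,2)] Q[OF that(1,2)]
    by (simp add: A'_def B'_def C_def E_def kronecker_mult)
  have "finite J"
  proof -
    have "J = (\<Union>j\<in>{..<m}. \<Union>l\<in>{..<r j}. (\<lambda>x. j # l # x) ` I j)" by (auto simp: J_def)
    then show ?thesis using I by simp
  qed
  moreover have "\<forall>z\<in>J. A' z \<in> carrier_mat a' a \<and> B' z \<in> carrier_mat b' b"
  proof
    fix z assume "z \<in> J"
    then obtain j l x where z: "z = j # l # x" "j < m" "l < r j" "x \<in> I j" by (auto simp: J_def)
    show "A' z \<in> carrier_mat a' a \<and> B' z \<in> carrier_mat b' b"
      using mult_carrier_mat[OF A[OF z(2,4)] P[OF z(2,3)]] mult_carrier_mat[OF B[OF z(2,4)] Q[OF z(2,3)]]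
      by (simp add: z(1) A'_def B'_def)
  qed
  moreover have "mat_sum (a * b) (a * b) J (\<lambda>z. mat_adjoint (A' z \<otimes>\<^sub>k B' z) * (A' z \<otimes>\<^sub>k B' z)) = 1\<^sub>m (a * b)"
  proof (rule eq_matI)
    fix x y assume "x < dim_row (1\<^sub>m (a * b))" "y < dim_col (1\<^sub>m (a * b))"
    then have xy: "x < a * b" "y < a * b" by auto
    \<comment> \<open>Summing over the continuation turns the inner
      \<open>mat_adjoint (C j i) * C j i\<close> into the identity and leaves the completeness sum
      of the present round.\<close>
    have step: "(\<Sum>i\<in>I j. (mat_adjoint (A' (j # l # i) \<otimes>\<^sub>k B' (j # l # i)) * (A' (j # l # i) \<otimes>\<^sub>k B' (j # l # i))) $$ (x, y))
        = (mat_adjoint (E j l) * E j l) $$ (x, y)" if jl: "j < m" "l < r j" for j l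
    proof -
      have "mat_adjoint (E j l) * E j l =
          mat_adjoint (E j l) * mat_sum (da j * db j) (da j * db j) (I j) (\<lambda>i. mat_adjoint (C j i) * C j i) * E j l"
        using Ec[OF jl] by (simp add: C1[OF jl(1)])
      also have "\<dots> = mat_sum (a * b) (a * b) (I j) (\<lambda>i. mat_adjoint (E j l) * (mat_adjoint (C j i) * C j i) * E j l)"
        using Ec[OF jl] Cc[OF jl(1)] by (intro mat_sum_mult_mult) (auto intro: mult_carrier_mat)
      also have "\<dots> = mat_sum (a * b) (a * b) (I j) (\<lambda>i. mat_adjoint (A' (j # l # i) \<otimes>\<^sub>k B' (j # l # i)) * (A' (j # l # i) \<otimes>\<^sub>k B' (j # l # i)))"
      proof (rule mat_sum_cong)
        fix i assume i: "i \<in> I j"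
        show "mat_adjoint (E j l) * (mat_adjoint (C j i) * C j i) * E j l =
            mat_adjoint (A' (j # l # i) \<otimes>\<^sub>k B' (j # l # i)) * (A' (j # l # i) \<otimes>\<^sub>k B' (j # l # i))"
          using Ec[OF jl] Cc[OF jl(1) i] by (simp add: C'[OF jl i] mat_adjoint_mult mult_mat_assoc)
      qed
      finally show ?thesis using xy by simp
    qed
    show "mat_sum (a * b) (a * b) J (\<lambda>z. mat_adjoint (A' z \<otimes>\<^sub>k B' z) * (A' z \<otimes>\<^sub>k B' z)) $$ (x, y) = 1\<^sub>m (a * b) $$ (x, y)"
      using xy I unfolding J_def
      by (simp add: sum_image_Cons2 step norm[unfolded E_def[symmetric]] del: index_one_mat(1) index_mult_mat(1))
        (simp add: E_def norm del: index_one_mat(1) index_mult_mat(1))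
  qed auto
  moreover have "mat_sum (a' * b') (a' * b') {..<m} (\<lambda>j. L j (kraus_map (da j * db j) (r j) (\<lambda>l. P j l \<otimes>\<^sub>k Q j l) \<sigma>))
      = mat_sum (a' * b') (a' * b') J (\<lambda>z. (A' z \<otimes>\<^sub>k B' z) * \<sigma> * mat_adjoint (A' z \<otimes>\<^sub>k B' z))"
    if \<sigma>: "\<sigma> \<in> carrier_mat (a * b) (a * b)" for \<sigma>
  proof (rule eq_matI)
    let ?R = "mat_sum (a' * b') (a' * b') J (\<lambda>z. (A' z \<otimes>\<^sub>k B' z) * \<sigma> * mat_adjoint (A' z \<otimes>\<^sub>k B' z))"
    fix x y assume "x < dim_row ?R" "y < dim_col ?R"
    then have xy: "x < a' * b'" "y < a' * b'" by auto
    \<comment> \<open>Each Kraus operator of the continuation is distributed over the sum in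
      \<open>kraus_map\<close>; the products of successive operators form the combined
      family.\<close>
    have step: "L j (kraus_map (da j * db j) (r j) (E j) \<sigma>) $$ (x, y) =
      (\<Sum>l<r j. \<Sum>i\<in>I j. ((A' (j # l # i) \<otimes>\<^sub>k B' (j # l # i)) * \<sigma> * mat_adjoint (A' (j # l # i) \<otimes>\<^sub>k B' (j # l # i))) $$ (x, y))"
      if j: "j < m" for j
    proof -
      have EsE: "E j l * \<sigma> * mat_adjoint (E j l) \<in> carrier_mat (da j * db j) (da j * db j)" if "l < r j" for l
        using Ec[OF j that] \<sigma> by (auto intro: mult_carrier_mat)
      have one: "(C j i * kraus_map (da j * db j) (r j) (E j) \<sigma> * mat_adjoint (C j i)) $$ (x, y) =
         (\<Sum>l<r j. ((A' (j # l # i) \<otimes>\<^sub>k B' (j # l # i)) * \<sigma> * mat_adjoint (A' (j # l # i) \<otimes>\<^sub>k B' (j # l # i))) $$ (x, y))"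
        if i: "i \<in> I j" for i
      proof -
        have "C j i * kraus_map (da j * db j) (r j) (E j) \<sigma> * mat_adjoint (C j i) =
           mat_sum (a' * b') (a' * b') {..<r j} (\<lambda>l. C j i * (E j l * \<sigma> * mat_adjoint (E j l)) * mat_adjoint (C j i))"
          unfolding kraus_map_def using Cc[OF j i] EsE by (intro mat_sum_mult_mult) auto
        also have "\<dots> = mat_sum (a' * b') (a' * b') {..<r j}
            (\<lambda>l. (A' (j # l # i) \<otimes>\<^sub>k B' (j # l # i)) * \<sigma> * mat_adjoint (A' (j # l # i) \<otimes>\<^sub>k B' (j # l # i)))"
        proof (rule mat_sum_cong)
          fix l assume "l \<in> {..<r j}"
          then have l: "l < r j" by simp
          show "C j i * (E j l * \<sigma> * mat_adjoint (E j l)) * mat_adjoint (C j i) =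
              (A' (j # l # i) \<otimes>\<^sub>k B' (j # l # i)) * \<sigma> * mat_adjoint (A' (j # l # i) \<otimes>\<^sub>k B' (j # l # i))"
            using Cc[OF j i] Ec[OF j l] \<sigma>
            by (simp add: C'[OF j l i] mat_adjoint_mult mult_mat_assoc carrier_matD)
        qed
        finally show ?thesis using xy by simp
      qed
      have "L j (kraus_map (da j * db j) (r j) (E j) \<sigma>) $$ (x, y) =
          (\<Sum>i\<in>I j. (C j i * kraus_map (da j * db j) (r j) (E j) \<sigma> * mat_adjoint (C j i)) $$ (x, y))"
        using xy by (subst CL[OF j]) (simp_all add: kraus_map_def del: index_mult_mat(1))
      then show ?thesis by (simp add: one sum.swap[of _ "I j"] del: index_mult_mat(1))
    qed
    show "mat_sum (a' * b') (a' * b') {..<m} (\<lambda>j. L j (kraus_map (da j * db j) (r j) (\<lambda>l. P j l \<otimes>\<^sub>k Q j l) \<sigma>)) $$ (x, y)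
      = ?R $$ (x, y)"
      using xy I step unfolding J_def E_def by (simp add: sum_image_Cons2 del: index_mult_mat(1))
  qed auto
  ultimately show ?thesis unfolding separable_def by blast
qed

lemma mat_sum_single: "X i \<in> carrier_mat nr nc \<Longrightarrow> mat_sum nr nc {i} X = X i"
  by (intro eq_matI) auto

text \<open>The empty list is the only outcome of a protocol without rounds.\<close>

lemma separable_id: "separable a b a b (\<lambda>\<sigma>. \<sigma>)"
  unfolding separable_def
  by (rule exI[of _ "{[]}"], rule exI[of _ "\<lambda>_. 1\<^sub>m a"], rule exI[of _ "\<lambda>_. 1\<^sub>m b"])
    (simp add: kronecker_one mat_sum_single)

lemma instrument_sum:
  assumes "instrument a m d r K" "x < a" "y < a"
  shows "(\<Sum>j<m. \<Sum>l<r j. (mat_adjoint (K j l) * K j l) $$ (x, y)) = 1\<^sub>m a $$ (x, y)"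
  using assms by (auto simp: instrument_def simp del: index_one_mat(1) index_mult_mat(1) dest!: arg_cong[where f = "\<lambda>M. M $$ (x, y)"])

lemma locc_separable: "locc a' b' a b L \<Longrightarrow> separable a' b' a b L"
proof (induction rule: locc.induct)
  case stop
  show ?case by (rule separable_id)
next
  case (alice a m d r K b L)
  show ?case
  proof (rule separable_compose[where P = K and Q = "\<lambda>j l. 1\<^sub>m b"])
    show K: "K j l \<in> carrier_mat (d j) a" if "j < m" "l < r j" for j l
      using alice(1) that by (simp add: instrument_def)
    fix x y assume xy: "x < a * b" "y < a * b"
    have "(\<Sum>j<m. \<Sum>l<r j. (mat_adjoint (K j l \<otimes>\<^sub>k 1\<^sub>m b) * (K j l \<otimes>\<^sub>k 1\<^sub>m b)) $$ (x, y)) =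
        (\<Sum>j<m. \<Sum>l<r j. (mat_adjoint (K j l) * K j l) $$ (x div b, y div b) * 1\<^sub>m b $$ (x mod b, y mod b))"
    proof (intro sum.cong refl)
      fix j l assume "j \<in> {..<m}" "l \<in> {..<r j}"
      then have "K j l \<in> carrier_mat (d j) a" using K by simp
      moreover from this have "mat_adjoint (K j l \<otimes>\<^sub>k 1\<^sub>m b) * (K j l \<otimes>\<^sub>k 1\<^sub>m b) = (mat_adjoint (K j l) * K j l) \<otimes>\<^sub>k 1\<^sub>m b"
        by (simp add: kronecker_adjoint kronecker_mult)
      ultimately show "(mat_adjoint (K j l \<otimes>\<^sub>k 1\<^sub>m b) * (K j l \<otimes>\<^sub>k 1\<^sub>m b)) $$ (x, y) =
          (mat_adjoint (K j l) * K j l) $$ (x div b, y div b) * 1\<^sub>m b $$ (x mod b, y mod b)"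
        using xy by (simp add: kronecker_index del: index_one_mat(1) index_mult_mat(1))
    qed
    \<comment> \<open>The identity of the passive party is pulled out, and completeness of the
      instrument applies to the remaining sum.\<close>
    also have "\<dots> = 1\<^sub>m a $$ (x div b, y div b) * 1\<^sub>m b $$ (x mod b, y mod b)"
      using instrument_sum[OF alice(1)] div_mod_less[OF xy(1)] div_mod_less[OF xy(2)]
      by (simp add: sum_distrib_right[symmetric] del: index_one_mat(1) index_mult_mat(1))
    also have "\<dots> = (1\<^sub>m a \<otimes>\<^sub>k 1\<^sub>m b) $$ (x, y)" using xy by (simp add: kronecker_index del: index_one_mat(1))
    finally show "(\<Sum>j<m. \<Sum>l<r j. (mat_adjoint (K j l \<otimes>\<^sub>k 1\<^sub>m b) * (K j l \<otimes>\<^sub>k 1\<^sub>m b)) $$ (x, y)) = 1\<^sub>m (a * b) $$ (x, y)"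
      by (simp only: kronecker_one)
  qed (use alice in auto)
next
  case (bob b m d r K a L)
  show ?case
  proof (rule separable_compose[where Q = K and P = "\<lambda>j l. 1\<^sub>m a"])
    show K: "K j l \<in> carrier_mat (d j) b" if "j < m" "l < r j" for j l
      using bob(1) that by (simp add: instrument_def)
    fix x y assume xy: "x < a * b" "y < a * b"
    have "(\<Sum>j<m. \<Sum>l<r j. (mat_adjoint (1\<^sub>m a \<otimes>\<^sub>k K j l) * (1\<^sub>m a \<otimes>\<^sub>k K j l)) $$ (x, y)) =
        (\<Sum>j<m. \<Sum>l<r j. 1\<^sub>m a $$ (x div b, y div b) * (mat_adjoint (K j l) * K j l) $$ (x mod b, y mod b))"
    proof (intro sum.cong refl)
      fix j l assume "j \<in> {..<m}" "l \<in> {..<r j}"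
      then have "K j l \<in> carrier_mat (d j) b" using K by simp
      moreover from this have "mat_adjoint (1\<^sub>m a \<otimes>\<^sub>k K j l) * (1\<^sub>m a \<otimes>\<^sub>k K j l) = (1\<^sub>m a) \<otimes>\<^sub>k (mat_adjoint (K j l) * K j l)"
        by (simp add: kronecker_adjoint kronecker_mult)
      ultimately show "(mat_adjoint (1\<^sub>m a \<otimes>\<^sub>k K j l) * (1\<^sub>m a \<otimes>\<^sub>k K j l)) $$ (x, y) =
          1\<^sub>m a $$ (x div b, y div b) * (mat_adjoint (K j l) * K j l) $$ (x mod b, y mod b)"
        using xy by (simp add: kronecker_index del: index_one_mat(1) index_mult_mat(1))
    qed
    also have "\<dots> = 1\<^sub>m a $$ (x div b, y div b) * 1\<^sub>m b $$ (x mod b, y mod b)"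
      using instrument_sum[OF bob(1)] div_mod_less[OF xy(1)] div_mod_less[OF xy(2)]
      by (simp add: sum_distrib_left[symmetric] del: index_one_mat(1) index_mult_mat(1))
    also have "\<dots> = (1\<^sub>m a \<otimes>\<^sub>k 1\<^sub>m b) $$ (x, y)" using xy by (simp add: kronecker_index del: index_one_mat(1))
    finally show "(\<Sum>j<m. \<Sum>l<r j. (mat_adjoint (1\<^sub>m a \<otimes>\<^sub>k K j l) * (1\<^sub>m a \<otimes>\<^sub>k K j l)) $$ (x, y)) = 1\<^sub>m (a * b) $$ (x, y)"
      by (simp only: kronecker_one)
  qed (use bob in auto)
qed


section \<open>Majorization under separable operations\<close>

lemma projector_carrier: "v \<in> carrier_vec d \<Longrightarrow> projector v \<in> carrier_mat d d"
  by (auto simp: projector_def)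

lemma projector_index: "v \<in> carrier_vec d \<Longrightarrow> x < d \<Longrightarrow> y < d \<Longrightarrow> projector v $$ (x, y) = v $ x * cnj (v $ y)"
  by (auto simp: projector_def)

lemma projector_smult: "projector (c \<cdot>\<^sub>v v) = complex_of_real ((cmod c)\<^sup>2) \<cdot>\<^sub>m projector v"
  by (intro eq_matI) (auto simp: projector_def complex_norm_square simp del: of_real_power)

text \<open>A single Kraus operator keeps pure states pure up to norm, so each one contributes one
  member to the resulting ensemble.\<close>

lemma mult_projector_adjoint:
  assumes "C \<in> carrier_mat a b" "v \<in> carrier_vec b"
  shows "C * projector v * mat_adjoint C = projector (C *\<^sub>v v)"
proof (rule eq_matI)
  fix x y assume "x < dim_row (projector (C *\<^sub>v v))" "y < dim_col (projector (C *\<^sub>v v))"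
  then have xy: "x < a" "y < a" using assms by (auto simp: projector_def)
  have "(C * projector v * mat_adjoint C) $$ (x, y) = (\<Sum>p<b. \<Sum>q<b. C $$ (x, p) * v $ p * cnj (C $$ (y, q) * v $ q))"
    using assms xy projector_carrier[OF assms(2)]
    by (subst mult3_index[of _ a b _ b _ a]) (auto simp: projector_index[OF assms(2)] ac_simps intro!: sum.cong)
  also have "\<dots> = projector (C *\<^sub>v v) $$ (x, y)"
    using assms xy by (simp add: projector_def scalar_prod_def lessThan_atLeast0 sum_product)
  finally show "(C * projector v * mat_adjoint C) $$ (x, y) = projector (C *\<^sub>v v) $$ (x, y)" .
qed (use assms in \<open>auto simp: projector_def\<close>)

text \<open>Needed for arbitrary vectors: on a state it says that the branch probabilities sum to 1,
  on a difference of vectors that the branch errors sum to the original squared distance.\<close>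

lemma kraus_norm2:
  assumes C: "\<And>i. i \<in> I \<Longrightarrow> C i \<in> carrier_mat a b"
    and one: "mat_sum b b I (\<lambda>i. mat_adjoint (C i) * C i) = 1\<^sub>m b"
    and v: "v \<in> carrier_vec b"
  shows "(\<Sum>i\<in>I. norm2 (C i *\<^sub>v v)) = norm2 v"
proof -
  have one_index: "(\<Sum>i\<in>I. (mat_adjoint (C i) * C i) $$ (x, y)) = 1\<^sub>m b $$ (x, y)" if "x < b" "y < b" for x y
    using arg_cong[OF one, of "\<lambda>M. M $$ (x, y)"] that by simp
  have "complex_of_real (\<Sum>i\<in>I. norm2 (C i *\<^sub>v v)) = (\<Sum>i\<in>I. (C i *\<^sub>v v) \<bullet>c (C i *\<^sub>v v))"
    by (simp add: cscalar_prod_self)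
  also have "\<dots> = (\<Sum>i\<in>I. \<Sum>x<b. \<Sum>y<b. v $ x * cnj ((mat_adjoint (C i) * C i) $$ (x, y) * v $ y))"
  proof (rule sum.cong[OF refl])
    fix i assume i: "i \<in> I"
    have CC: "mat_adjoint (C i) * C i \<in> carrier_mat b b" using C[OF i] by (auto intro: mult_carrier_mat)
    have "(C i *\<^sub>v v) \<bullet>c (C i *\<^sub>v v) = v \<bullet>c (mat_adjoint (C i) *\<^sub>v (C i *\<^sub>v v))"
      using C[OF i] v by (intro cscalar_prod_adjoint) auto
    also have "mat_adjoint (C i) *\<^sub>v (C i *\<^sub>v v) = (mat_adjoint (C i) * C i) *\<^sub>v v"
      using C[OF i] v by (simp add: mult_mat_vec_assoc)
    also have "v \<bullet>c \<dots> = (\<Sum>x<b. \<Sum>y<b. v $ x * cnj ((mat_adjoint (C i) * C i) $$ (x, y) * v $ y))"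
      using CC v by (subst cscalar_prod_sum[of _ b])
        (auto simp: scalar_prod_def lessThan_atLeast0 sum_distrib_left simp del: index_mult_mat(1))
    finally show "(C i *\<^sub>v v) \<bullet>c (C i *\<^sub>v v) =
      (\<Sum>x<b. \<Sum>y<b. v $ x * cnj ((mat_adjoint (C i) * C i) $$ (x, y) * v $ y))" .
  qed
  also have "\<dots> = (\<Sum>x<b. \<Sum>i\<in>I. \<Sum>y<b. v $ x * cnj ((mat_adjoint (C i) * C i) $$ (x, y) * v $ y))"
    by (rule sum.swap)
  also have "\<dots> = (\<Sum>x<b. \<Sum>y<b. \<Sum>i\<in>I. v $ x * cnj ((mat_adjoint (C i) * C i) $$ (x, y) * v $ y))"
    by (intro sum.cong refl sum.swap)
  also have "\<dots> = (\<Sum>x<b. \<Sum>y<b. v $ x * cnj (1\<^sub>m b $$ (x, y) * v $ y))"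
    by (intro sum.cong refl)
      (simp add: one_index[symmetric] sum_distrib_left sum_distrib_right del: index_mult_mat(1) index_one_mat(1))
  also have "\<dots> = (\<Sum>x<b. v $ x * cnj (v $ x))"
  proof (intro sum.cong refl)
    fix x assume "x \<in> {..<b}"
    then show "(\<Sum>y<b. v $ x * cnj (1\<^sub>m b $$ (x, y) * v $ y)) = v $ x * cnj (v $ x)"
      by (subst sum.remove[of _ x]) (auto intro!: sum.neutral)
  qed
  also have "\<dots> = complex_of_real (norm2 v)"
    using v by (simp add: cscalar_prod_self[symmetric] cscalar_prod_sum)
  finally show ?thesis by (simp only: of_real_eq_iff)
qed

lemma schmidt_coefficients_sum:
  assumes "pure_state (n * n) v"
  shows "(\<Sum>i<n. schmidt_coefficients n v $ i) = 1"
proof -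
  have "v \<in> carrier_vec (n * n)" "norm2 v = 1" using assms by (auto simp: pure_state_iff)
  then show ?thesis using schmidt_decomposition by metis
qed

lemma sum_split_at:
  fixes f :: "nat \<Rightarrow> real"
  shows "k \<le> n \<Longrightarrow> (\<Sum>i<n. f i) = (\<Sum>i<k. f i) + (\<Sum>i=k..<n. f i)"
  by (metis lessThan_atLeast0 sum.atLeastLessThan_concat le0)

text \<open>A best approximation \<open>w\<close> of \<open>\<psi>\<close> of rank at most
  \<open>k\<close> is carried through every branch, where it is an admissible competitor but perhaps
  not an optimal one. The branch errors add up to the error of \<open>w\<close>, so expected tails
  cannot grow.\<close>

lemma separable_majorizes:
  assumes L: "separable n n n n L" and \<psi>: "pure_state (n * n) \<psi>"
  shows "\<exists>m p \<phi>. pure_state_decomposition (n * n) (L (projector \<psi>)) m p \<phi> \<and>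
    vec n (\<lambda>k. \<Sum>i<m. p i * schmidt_coefficients n (\<phi> i) $ k) \<succ> schmidt_coefficients n \<psi>"
proof -
  obtain I A B where I: "finite (I :: nat list set)"
    and AB: "\<And>i. i \<in> I \<Longrightarrow> A i \<in> carrier_mat n n \<and> B i \<in> carrier_mat n n"
    and one: "mat_sum (n * n) (n * n) I (\<lambda>i. mat_adjoint (A i \<otimes>\<^sub>k B i) * (A i \<otimes>\<^sub>k B i)) = 1\<^sub>m (n * n)"
    and Leq: "\<And>\<sigma>. \<sigma> \<in> carrier_mat (n * n) (n * n) \<Longrightarrow>
      L \<sigma> = mat_sum (n * n) (n * n) I (\<lambda>i. (A i \<otimes>\<^sub>k B i) * \<sigma> * mat_adjoint (A i \<otimes>\<^sub>k B i))"
    using L unfolding separable_def by blast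
  have \<psi>c: "\<psi> \<in> carrier_vec (n * n)" and \<psi>n: "norm2 \<psi> = 1" using \<psi> by (auto simp: pure_state_iff)
  define C where "C = (\<lambda>i. A i \<otimes>\<^sub>k B i)"
  have Cc: "C i \<in> carrier_mat (n * n) (n * n)" if "i \<in> I" for i
    unfolding C_def using AB[OF that] by (intro kronecker_carrier) auto
  define m where "m = card I"
  \<comment> \<open>Ensembles are indexed by numbers below \<open>m\<close>, Kraus operators by
    lists of outcomes.\<close>
  obtain h where h: "bij_betw h {..<m} I"
    using ex_bij_betw_nat_finite[OF I] by (auto simp: m_def lessThan_atLeast0)
  have hI: "h i \<in> I" if "i < m" for i using h that by (auto simp: bij_betw_def)
  define p where "p = (\<lambda>i. norm2 (C (h i) *\<^sub>v \<psi>))"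
  \<comment> \<open>A branch of probability zero has no normalised state; \<open>\<psi>\<close>
    fills its place with weight zero.\<close>
  define \<phi> where "\<phi> = (\<lambda>i. if p i = 0 then \<psi> else complex_of_real (1 / sqrt (p i)) \<cdot>\<^sub>v (C (h i) *\<^sub>v \<psi>))"
  have np: "norm2 (C (h i) *\<^sub>v \<psi>) = p i" for i by (simp add: p_def)
  have p0: "0 \<le> p i" for i by (simp add: p_def norm2_nonneg)
  have C\<psi>c: "C (h i) *\<^sub>v \<psi> \<in> carrier_vec (n * n)" if "i < m" for i
    using Cc[OF hI[OF that]] \<psi>c by (rule mult_mat_vec_carrier)
  have C\<psi>: "C (h i) *\<^sub>v \<psi> = complex_of_real (sqrt (p i)) \<cdot>\<^sub>v \<phi> i" if i: "i < m" for i
  proof (cases "p i = 0")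
    case True
    then have "C (h i) *\<^sub>v \<psi> = 0\<^sub>v (n * n)" using C\<psi>c[OF i] norm2_eq_0 by (metis carrier_vecD p_def)
    then show ?thesis using True \<psi>c by (auto intro!: eq_vecI simp: \<phi>_def)
  next
    case False
    then show ?thesis using p0[of i]
      by (simp add: \<phi>_def smult_smult_assoc of_real_mult[symmetric] del: of_real_mult of_real_divide)
  qed
  have \<phi>: "pure_state (n * n) (\<phi> i)" if i: "i < m" for i
  proof (cases "p i = 0")
    case False
    then have "norm2 (\<phi> i) = 1"
      using p0[of i] by (simp add: \<phi>_def norm2_smult np norm_divide power_divide)
    then show ?thesis using False C\<psi>c[OF i] by (simp add: pure_state_iff \<phi>_def)
  qed (simp add: \<phi>_def \<psi>)
  have norm_h: "(\<Sum>i<m. norm2 (C (h i) *\<^sub>v v)) = norm2 v" if "v \<in> carrier_vec (n * n)" for v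
  proof -
    have "(\<Sum>i<m. norm2 (C (h i) *\<^sub>v v)) = (\<Sum>i\<in>I. norm2 (C i *\<^sub>v v))"
      using sum.reindex_bij_betw[OF h, of "\<lambda>i. norm2 (C i *\<^sub>v v)"] .
    also have "\<dots> = norm2 v" using one by (intro kraus_norm2[OF Cc _ that]) (simp_all add: C_def)
    finally show ?thesis .
  qed
  have p1: "(\<Sum>i<m. p i) = 1" using norm_h[OF \<psi>c] \<psi>n by (simp add: p_def)
  have "pure_state_decomposition (n * n) (L (projector \<psi>)) m p \<phi>"
    unfolding pure_state_decomposition_def probability_weights_def
  proof (intro conjI allI impI p0 p1 \<phi>)
    have "L (projector \<psi>) = mat_sum (n * n) (n * n) I (\<lambda>i. projector (C i *\<^sub>v \<psi>))"
      unfolding Leq[OF projector_carrier[OF \<psi>c]]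
      using mult_projector_adjoint[OF Cc \<psi>c] by (intro mat_sum_cong) (simp add: C_def)
    also have "\<dots> = mat_sum (n * n) (n * n) {..<m} (\<lambda>i. projector (C (h i) *\<^sub>v \<psi>))"
      by (intro eq_matI) (auto simp: sum.reindex_bij_betw[OF h, symmetric])
    also have "\<dots> = convex_combination (n * n) m p (\<lambda>i. projector (\<phi> i))"
      unfolding convex_combination_def
      by (intro mat_sum_cong) (auto simp: C\<psi> projector_smult p0)
    finally show "L (projector \<psi>) = convex_combination (n * n) m p (\<lambda>i. projector (\<phi> i))" .
  qed auto
  moreover have "vec n (\<lambda>k. \<Sum>i<m. p i * schmidt_coefficients n (\<phi> i) $ k) \<succ> schmidt_coefficients n \<psi>"
    unfolding majorizes_def
  proof (intro conjI ballI)
    have "schmidt_coefficients n \<psi> \<in> carrier_vec n" using schmidt_decomposition[OF \<psi>c] by metis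
    then have dim: "dim_vec (schmidt_coefficients n \<psi>) = n" by simp
    then show "dim_vec (vec n (\<lambda>k. \<Sum>i<m. p i * schmidt_coefficients n (\<phi> i) $ k)) = dim_vec (schmidt_coefficients n \<psi>)"
      by simp
    fix k assume "k \<in> {1..dim_vec (schmidt_coefficients n \<psi>)}"
    then have k: "k \<le> n" by (simp add: dim)
    obtain X Y where X: "X \<in> carrier_mat n k" and Y: "Y \<in> carrier_mat k n"
      and XY: "norm2 (\<psi> - tensor_vec (X * Y)) = (\<Sum>i=k..<n. schmidt_coefficients n \<psi> $ i)"
      using eckart_young_upper[OF \<psi>c k] by blast
    define w where "w = tensor_vec (X * Y)"
    have XYc: "X * Y \<in> carrier_mat n n" using X Y by (rule mult_carrier_mat)
    have w: "w \<in> carrier_vec (n * n)" unfolding w_def using XYc by (rule tensor_vec_carrier)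
    have tail: "p i * (\<Sum>t=k..<n. schmidt_coefficients n (\<phi> i) $ t) \<le> norm2 (C (h i) *\<^sub>v (\<psi> - w))" if i: "i < m" for i
    proof (cases "p i = 0")
      case True
      then show ?thesis by (simp add: norm2_nonneg)
    next
      case False
      then have pi: "p i > 0" using p0[of i] by simp
      define c where "c = complex_of_real (1 / sqrt (p i))"
      have c: "complex_of_real (sqrt (p i)) * c = 1"
        using pi by (simp add: c_def of_real_mult[symmetric] del: of_real_mult of_real_divide)
      have Ai: "A (h i) \<in> carrier_mat n n" and Bi: "B (h i) \<in> carrier_mat n n" using AB hI[OF i] by auto
      \<comment> \<open>The factor \<open>c\<close> cancels \<open>sqrt (p i)\<close>, which makes
        \<open>X' * Y'\<close> a competitor for the normalised branch state, still with inner
        dimension \<open>k\<close>.\<close>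
      define X' where "X' = c \<cdot>\<^sub>m (A (h i) * X)"
      define Y' where "Y' = Y * transpose_mat (B (h i))"
      have X': "X' \<in> carrier_mat n k" unfolding X'_def using Ai X by (intro smult_carrier_mat mult_carrier_mat)
      have Y': "Y' \<in> carrier_mat k n" unfolding Y'_def using Bi Y by (intro mult_carrier_mat[OF Y]) simp
      have "C (h i) *\<^sub>v w = tensor_vec (A (h i) * (X * Y) * transpose_mat (B (h i)))"
        unfolding C_def w_def by (rule kronecker_mult_tensor_vec[OF Ai Bi XYc])
      also have "A (h i) * (X * Y) * transpose_mat (B (h i)) = A (h i) * X * Y'"
        using Ai Bi X Y by (simp add: Y'_def mult_mat_assoc)
      also have "\<dots> = complex_of_real (sqrt (p i)) \<cdot>\<^sub>m (X' * Y')"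
      proof -
        have "X' * Y' = c \<cdot>\<^sub>m (A (h i) * X * Y')"
          unfolding X'_def by (rule mult_smult_assoc_mat[OF mult_carrier_mat[OF Ai X] Y'])
        then show ?thesis
          by (intro eq_matI) (auto simp: mult.assoc[symmetric] c simp del: index_mult_mat(1))
      qed
      finally have Cw: "C (h i) *\<^sub>v w = complex_of_real (sqrt (p i)) \<cdot>\<^sub>v tensor_vec (X' * Y')"
        by (simp add: tensor_vec_smult)
      have XY'c: "tensor_vec (X' * Y') \<in> carrier_vec (n * n)"
        by (rule tensor_vec_carrier[OF mult_carrier_mat[OF X' Y']])
      have \<phi>c: "\<phi> i \<in> carrier_vec (n * n)" using \<phi>[OF i] by (simp add: pure_state_iff)
      have "C (h i) *\<^sub>v (\<psi> - w) = C (h i) *\<^sub>v \<psi> - C (h i) *\<^sub>v w"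
        using Cc[OF hI[OF i]] \<psi>c w by (rule mult_minus_distrib_mat_vec)
      also have "\<dots> = complex_of_real (sqrt (p i)) \<cdot>\<^sub>v (\<phi> i - tensor_vec (X' * Y'))"
        unfolding C\<psi>[OF i] Cw using \<phi>c XY'c by (auto intro!: eq_vecI simp: algebra_simps)
      finally have "norm2 (C (h i) *\<^sub>v (\<psi> - w)) = p i * norm2 (\<phi> i - tensor_vec (X' * Y'))"
        using pi by (simp add: norm2_smult)
      then show ?thesis
        using eckart_young_lower[OF \<phi>c k X' Y'] pi by simp
    qed
    have "(\<Sum>t<k. vec n (\<lambda>k. \<Sum>i<m. p i * schmidt_coefficients n (\<phi> i) $ k) $ t)
        = (\<Sum>t<k. \<Sum>i<m. p i * schmidt_coefficients n (\<phi> i) $ t)"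
      using k by (intro sum.cong) auto
    also have "\<dots> = (\<Sum>i<m. p i * (\<Sum>t<k. schmidt_coefficients n (\<phi> i) $ t))"
      by (subst sum.swap) (simp add: sum_distrib_left)
    \<comment> \<open>Since the total is 1, prefix sums are traded for tails, which are the
      quantities that have been bounded.\<close>
    also have "\<dots> = (\<Sum>i<m. p i - p i * (\<Sum>t=k..<n. schmidt_coefficients n (\<phi> i) $ t))"
    proof (intro sum.cong refl)
      fix i assume "i \<in> {..<m}"
      then have "(\<Sum>t<k. schmidt_coefficients n (\<phi> i) $ t) = 1 - (\<Sum>t=k..<n. schmidt_coefficients n (\<phi> i) $ t)"
        using schmidt_coefficients_sum[OF \<phi>] sum_split_at[OF k, of "($) (schmidt_coefficients n (\<phi> i))"] by simp
      then show "p i * (\<Sum>t<k. schmidt_coefficients n (\<phi> i) $ t) = p i - p i * (\<Sum>t=k..<n. schmidt_coefficients n (\<phi> i) $ t)"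
        by (simp only: right_diff_distrib mult_1_right)
    qed
    also have "\<dots> = 1 - (\<Sum>i<m. p i * (\<Sum>t=k..<n. schmidt_coefficients n (\<phi> i) $ t))"
      by (simp add: sum_subtractf p1)
    also have "\<dots> \<ge> 1 - (\<Sum>i<m. norm2 (C (h i) *\<^sub>v (\<psi> - w)))"
      using tail by (intro diff_mono order_refl sum_mono) auto
    also have "(\<Sum>i<m. norm2 (C (h i) *\<^sub>v (\<psi> - w))) = norm2 (\<psi> - w)"
      by (rule norm_h) (use \<psi>c w in auto)
    also have "norm2 (\<psi> - w) = (\<Sum>t=k..<n. schmidt_coefficients n \<psi> $ t)" using XY by (simp add: w_def)
    also have "1 - \<dots> = (\<Sum>t<k. schmidt_coefficients n \<psi> $ t)"
      using schmidt_coefficients_sum[OF \<psi>] sum_split_at[OF k, of "($) (schmidt_coefficients n \<psi>)"] by simp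
    finally show "(\<Sum>t<k. schmidt_coefficients n \<psi> $ t) \<le> (\<Sum>t<k. vec n (\<lambda>k. \<Sum>i<m. p i * schmidt_coefficients n (\<phi> i) $ k) $ t)" .
  qed
  ultimately show ?thesis by blast
qed


section \<open>From a decomposition to a single measurement\<close>

text \<open>\<open>A i\<close> rescales the amplitudes \<open>sqrt (l $ k)\<close> to
  \<open>sqrt (p i * s i $ k)\<close>, and local unitaries rotate the standard bases into the
  Schmidt bases of \<open>\<phi> i\<close>. Being diagonal, the \<open>A i\<close> commute, as
  \<open>LOCC1A\<close> demands.\<close>

lemma decomposition_imp_S_plus:
  assumes dec: "pure_state_decomposition (n * n) \<rho> m p \<phi>"
    and maj: "vec n (\<lambda>k. \<Sum>i<m. p i * schmidt_coefficients n (\<phi> i) $ k) \<succ> \<mu>"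
  shows "\<rho> \<in> S_plus n \<mu>"
proof -
  have p: "\<And>i. i < m \<Longrightarrow> 0 \<le> p i" "(\<Sum>i<m. p i) = 1" and \<phi>: "\<And>i. i < m \<Longrightarrow> pure_state (n * n) (\<phi> i)"
    and \<rho>: "\<rho> = convex_combination (n * n) m p (\<lambda>i. projector (\<phi> i))"
    using dec by (auto simp: pure_state_decomposition_def probability_weights_def)
  define s where "s = (\<lambda>i. schmidt_coefficients n (\<phi> i))"
  have \<phi>c: "\<phi> i \<in> carrier_vec (n * n)" if "i < m" for i using \<phi>[OF that] by (simp add: pure_state_iff)
  have "\<exists>U V. i < m \<longrightarrow> unitary_mat n U \<and> unitary_mat n V \<and> \<phi> i = tensor_vec (U * sqrt_diag n (s i) * V)" for i
    using schmidt_decomposition[OF \<phi>c] unfolding s_def by metis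
  then obtain U V where UV: "\<And>i. i < m \<Longrightarrow> unitary_mat n (U i) \<and> unitary_mat n (V i) \<and>
      \<phi> i = tensor_vec (U i * sqrt_diag n (s i) * V i)"
    by metis
  have s_nonneg: "0 \<le> s i $ k" if "i < m" "k < n" for i k
    using schmidt_decomposition[OF \<phi>c[OF that(1)]] that(2) unfolding s_def by metis
  have s_mono: "s i $ k' \<le> s i $ k" if "i < m" "k \<le> k'" "k' < n" for i k k'
    using schmidt_decomposition[OF \<phi>c[OF that(1)]] that(2,3) unfolding s_def by metis
  define l where "l = vec n (\<lambda>k. \<Sum>i<m. p i * s i $ k)"
  have l: "l \<in> carrier_vec n" by (simp add: l_def)
  have l_index: "l $ k = (\<Sum>i<m. p i * s i $ k)" if "k < n" for k using that by (simp add: l_def)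
  have l_nonneg: "0 \<le> l $ k" if "k < n" for k
    unfolding l_index[OF that] using p(1) s_nonneg that by (intro sum_nonneg mult_nonneg_nonneg) auto
  \<comment> \<open>All summands decrease in the same order, so the average is already sorted and is
    the Schmidt vector of \<open>\<phi>0\<close>.\<close>
  have l_mono: "l $ k' \<le> l $ k" if "k \<le> k'" "k' < n" for k k'
    using that p(1) s_mono by (simp add: l_index) (intro sum_mono mult_left_mono, auto)
  define \<phi>0 where "\<phi>0 = tensor_vec (sqrt_diag n l)"
  have \<phi>0: "\<phi>0 \<in> carrier_vec (n * n)" unfolding \<phi>0_def by (intro tensor_vec_carrier) simp
  have "norm2 \<phi>0 = (\<Sum>k<n. l $ k)"
    using l_nonneg by (simp add: \<phi>0_def norm2_tensor_vec sqrt_diag_def frob_mat_diag)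
  also have "\<dots> = (\<Sum>i<m. p i * (\<Sum>k<n. s i $ k))"
    by (simp add: l_index sum_distrib_left) (rule sum.swap)
  also have "\<dots> = 1" using schmidt_coefficients_sum[OF \<phi>] p(2) by (simp add: s_def)
  finally have pure0: "pure_state (n * n) \<phi>0" using \<phi>0 by (simp add: pure_state_iff)
  have "schmidt_coefficients n \<phi>0 = l"
    unfolding \<phi>0_def by (rule schmidt_coefficients_diag[OF l l_mono l_nonneg])
  then have maj0: "schmidt_coefficients n \<phi>0 \<succ> \<mu>" using maj by (simp add: l_def s_def)
  have "projector \<phi>0 = convex_combination (n * n) 1 (\<lambda>_. 1) (\<lambda>_. projector \<phi>0)"
    using projector_carrier[OF \<phi>0] by (intro eq_matI) (auto simp: convex_combination_def)
  then have in_S: "projector \<phi>0 \<in> S_set n \<mu>"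
    unfolding S_set_def convex_closure_def using pure0 maj0
    by (auto simp: probability_weights_def intro!: exI[of _ 1] exI[of _ "\<lambda>_. 1 :: real"] exI[of _ "\<lambda>_. projector \<phi>0"])

  \<comment> \<open>Where \<open>l $ k = 0\<close>, every \<open>p i * s i $ k\<close> vanishes as
    well, and the entry has no effect on \<open>\<phi>0\<close>; the value \<open>sqrt (p i)\<close>
    makes the squares sum to 1 there too.\<close>
  define c where "c = (\<lambda>i k. if l $ k = 0 then sqrt (p i) else sqrt (p i * s i $ k / l $ k))"
  have c: "c i k * sqrt (l $ k) = sqrt (p i) * sqrt (s i $ k)" if i: "i < m" and k: "k < n" for i k
  proof (cases "l $ k = 0")
    case True
    then have "(\<Sum>i<m. p i * s i $ k) = 0" using l_index[OF k] by simp
    then have "p i * s i $ k = 0"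
      using p(1) s_nonneg k i by (subst (asm) sum_nonneg_eq_0_iff) auto
    then show ?thesis using True by auto
  next
    case False
    then show ?thesis using l_nonneg[OF k] by (simp add: c_def real_sqrt_mult[symmetric])
  qed
  have c2: "(\<Sum>i<m. (c i k)\<^sup>2) = 1" if k: "k < n" for k
  proof (cases "l $ k = 0")
    case True
    then show ?thesis using p by (simp add: c_def)
  next
    case False
    then have "(\<Sum>i<m. (c i k)\<^sup>2) = (\<Sum>i<m. p i * s i $ k / l $ k)"
      using p(1) s_nonneg k l_nonneg[OF k] by (intro sum.cong refl) (simp add: c_def)
    also have "\<dots> = 1" using False l_index[OF k] by (simp add: sum_divide_distrib[symmetric])
    finally show ?thesis .
  qed
  define A where "A = (\<lambda>i. mat_diag n (\<lambda>k. complex_of_real (c i k)))"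
  have A: "A i \<in> carrier_mat n n" for i by (simp add: A_def)
  have A_adj: "mat_adjoint (A i) = A i" for i by (intro eq_matI) (auto simp: A_def mat_diag_def)
  have AA: "mat_adjoint (A i) * A i = mat_diag n (\<lambda>k. complex_of_real (c i k) * complex_of_real (c i k))" for i
    unfolding A_adj by (simp add: A_def)
  have AD: "A i * sqrt_diag n l = complex_of_real (sqrt (p i)) \<cdot>\<^sub>m sqrt_diag n (s i)" if "i < m" for i
    unfolding A_def sqrt_diag_def mat_diag_diag
    by (intro eq_matI) (auto simp: mat_diag_def c[OF that] of_real_mult[symmetric] simp del: of_real_mult)
  \<comment> \<open>Bob applies the transpose of \<open>V i\<close>, which multiplies the
    coefficient matrix on the right by \<open>V i\<close> itself.\<close>
  define L where "L = kraus_map (n * n) m (\<lambda>i. (U i * A i) \<otimes>\<^sub>k transpose_mat (V i))"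
  have "mat_sum n n {..<m} (\<lambda>i. mat_adjoint (A i) * A i) = 1\<^sub>m n"
  proof (rule eq_matI)
    fix x y assume "x < dim_row (1\<^sub>m n)" "y < dim_col (1\<^sub>m n)"
    then have xy: "x < n" "y < n" by auto
    have "(\<Sum>i<m. complex_of_real (c i x) * complex_of_real (c i x)) = 1"
      using arg_cong[OF c2[OF xy(1)], of complex_of_real] by (simp add: power2_eq_square)
    then show "mat_sum n n {..<m} (\<lambda>i. mat_adjoint (A i) * A i) $$ (x, y) = 1\<^sub>m n $$ (x, y)"
      using xy unfolding AA by (auto simp: mat_diag_def)
  qed auto
  moreover have "A i * A j = A j * A i" for i j by (simp add: A_def mult.commute)
  ultimately have "L \<in> LOCC1A n"
    unfolding LOCC1A_def L_def using UV A unitary_mat_transpose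
    by (intro CollectI exI[of _ m] exI[of _ A] exI[of _ U] exI[of _ "\<lambda>i. transpose_mat (V i)"]) auto
  moreover have "L (projector \<phi>0) = \<rho>"
    unfolding L_def kraus_map_def \<rho> convex_combination_def
  proof (rule mat_sum_cong)
    fix i assume "i \<in> {..<m}"
    then have i: "i < m" by simp
    have Uc: "U i \<in> carrier_mat n n" and Vc: "V i \<in> carrier_mat n n" using UV[OF i] unitary_matD by auto
    let ?C = "(U i * A i) \<otimes>\<^sub>k transpose_mat (V i)"
    have C: "?C \<in> carrier_mat (n * n) (n * n)"
      using Uc Vc A by (intro kronecker_carrier) (auto intro: mult_carrier_mat)
    have "?C *\<^sub>v \<phi>0 = tensor_vec (U i * A i * sqrt_diag n l * transpose_mat (transpose_mat (V i)))"
      unfolding \<phi>0_def using Vc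
      by (intro kronecker_mult_tensor_vec[OF mult_carrier_mat[OF Uc A] _ sqrt_diag_carrier]) simp
    also have "U i * A i * sqrt_diag n l * transpose_mat (transpose_mat (V i)) = U i * (A i * sqrt_diag n l) * V i"
      using Uc Vc A[of i] by (simp add: mult_mat_assoc)
    also have "\<dots> = complex_of_real (sqrt (p i)) \<cdot>\<^sub>m (U i * sqrt_diag n (s i) * V i)"
      using Uc Vc by (simp add: AD[OF i] mult_smult_distrib[of _ n n _ n] mult_smult_assoc_mat[of _ n n _ n] mult_carrier_mat[of _ n n])
    finally have "?C *\<^sub>v \<phi>0 = complex_of_real (sqrt (p i)) \<cdot>\<^sub>v \<phi> i"
      using UV[OF i] by (simp add: tensor_vec_smult)
    then show "?C * projector \<phi>0 * mat_adjoint ?C = complex_of_real (p i) \<cdot>\<^sub>m projector (\<phi> i)"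
      using p(1)[OF i] by (simp add: mult_projector_adjoint[OF C \<phi>0] projector_smult)
  qed
  ultimately show ?thesis unfolding S_plus_def using pure0 in_S by blast
qed


section \<open>LOCC protocols\<close>

lemma kraus_map_carrier: "kraus_map d m K \<sigma> \<in> carrier_mat d d"
  by (simp add: kraus_map_def)

lemma kraus_map_single:
  assumes "K 0 \<in> carrier_mat d d'" "\<sigma> \<in> carrier_mat d' d'"
  shows "kraus_map d 1 K \<sigma> = K 0 * \<sigma> * mat_adjoint (K 0)"
proof -
  have "K 0 * \<sigma> * mat_adjoint (K 0) \<in> carrier_mat d d"
    using assms by (auto intro: mult_carrier_mat)
  then show ?thesis by (simp add: kraus_map_def lessThan_Suc mat_sum_single)
qed

lemma kraus_map_smult:
  assumes "\<And>i. i < m \<Longrightarrow> K i \<in> carrier_mat d d'" "\<sigma> \<in> carrier_mat d' d'"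
  shows "kraus_map d m K (c \<cdot>\<^sub>m \<sigma>) = c \<cdot>\<^sub>m kraus_map d m K \<sigma>"
proof -
  have "kraus_map d m K (c \<cdot>\<^sub>m \<sigma>) = mat_sum d d {..<m} (\<lambda>i. c \<cdot>\<^sub>m (K i * \<sigma> * mat_adjoint (K i)))"
    unfolding kraus_map_def
  proof (rule mat_sum_cong)
    fix i assume "i \<in> {..<m}"
    then have K: "K i \<in> carrier_mat d d'" using assms by simp
    have "K i * (c \<cdot>\<^sub>m \<sigma>) = c \<cdot>\<^sub>m (K i * \<sigma>)" by (rule mult_smult_distrib[OF K assms(2)])
    then show "K i * (c \<cdot>\<^sub>m \<sigma>) * mat_adjoint (K i) = c \<cdot>\<^sub>m (K i * \<sigma> * mat_adjoint (K i))"
      using mult_smult_assoc_mat[OF mult_carrier_mat[OF K assms(2)] mat_adjoint_carrier[OF K]] by simp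
  qed
  also have "\<dots> = c \<cdot>\<^sub>m kraus_map d m K \<sigma>"
  proof (rule eq_matI)
    fix x y assume "x < dim_row (c \<cdot>\<^sub>m kraus_map d m K \<sigma>)" "y < dim_col (c \<cdot>\<^sub>m kraus_map d m K \<sigma>)"
    then have xy: "x < d" "y < d" by (auto simp: kraus_map_def)
    have "(c \<cdot>\<^sub>m (K i * \<sigma> * mat_adjoint (K i))) $$ (x, y) = c * (K i * \<sigma> * mat_adjoint (K i)) $$ (x, y)" if "i < m" for i
      using xy assms(1)[OF that] by simp
    then show "mat_sum d d {..<m} (\<lambda>i. c \<cdot>\<^sub>m (K i * \<sigma> * mat_adjoint (K i))) $$ (x, y) = (c \<cdot>\<^sub>m kraus_map d m K \<sigma>) $$ (x, y)"
      using xy by (simp add: kraus_map_def sum_distrib_left del: index_smult_mat(1) index_mult_mat(1))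
       (simp add: sum_distrib_left del: index_mult_mat(1))
  qed (auto simp: kraus_map_def)
  finally show ?thesis .
qed

text \<open>Read off from the separable form, whose value is an entrywise sum of the right
  size.\<close>

lemma locc_carrier:
  assumes "locc a' b' a b L" "\<sigma> \<in> carrier_mat (a * b) (a * b)"
  shows "L \<sigma> \<in> carrier_mat (a' * b') (a' * b')"
  using locc_separable[OF assms(1)] assms(2) by (auto simp: separable_def)

lemma conjugation_mult:
  fixes E F \<sigma> :: cmat
  assumes "E \<in> carrier_mat b c" "F \<in> carrier_mat a b" "\<sigma> \<in> carrier_mat c c"
  shows "F * (E * \<sigma> * mat_adjoint E) * mat_adjoint F = (F * E) * \<sigma> * mat_adjoint (F * E)"
  using assms by (simp add: mat_adjoint_mult mult_mat_assoc)

text \<open>The building block of one-way protocols: Alice measures, Bob answers with a unitary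
  depending on her outcome, and the continuation may depend on it as well. Every outcome has a
  single Kraus operator, so no information is discarded.\<close>

lemma locc_alice_bob:
  fixes m n :: nat
  assumes A: "\<And>j. j < m \<Longrightarrow> A j \<in> carrier_mat n n"
    and A1: "mat_sum n n {..<m} (\<lambda>j. mat_adjoint (A j) * A j) = 1\<^sub>m n"
    and V: "\<And>j. j < m \<Longrightarrow> unitary_mat n (V j)" and L: "\<And>j. j < m \<Longrightarrow> locc n n n n (L j)"
  obtains L' where "locc n n n n L'" "\<And>\<sigma>. \<sigma> \<in> carrier_mat (n * n) (n * n) \<Longrightarrow>
    L' \<sigma> = mat_sum (n * n) (n * n) {..<m} (\<lambda>j. L j ((A j \<otimes>\<^sub>k V j) * \<sigma> * mat_adjoint (A j \<otimes>\<^sub>k V j)))"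
proof -
  \<comment> \<open>Bob's unitary is an instrument with one outcome and one Kraus operator.\<close>
  let ?B = "\<lambda>j \<sigma>. mat_sum (n * n) (n * n) {..<1 :: nat} (\<lambda>_. L j (kraus_map (n * n) 1 (\<lambda>_. 1\<^sub>m n \<otimes>\<^sub>k V j) \<sigma>))"
  let ?L = "\<lambda>\<sigma>. mat_sum (n * n) (n * n) {..<m} (\<lambda>j. ?B j (kraus_map (n * n) 1 (\<lambda>_. A j \<otimes>\<^sub>k 1\<^sub>m n) \<sigma>))"
  have single: "mat_sum n n {..<1 :: nat} (\<lambda>l. X) = X" if "X \<in> carrier_mat n n" for X :: cmat
    using that by (simp add: lessThan_Suc mat_sum_single)
  have "locc n n n n (?B j)" if j: "j < m" for j
  proof (rule locc.bob)
    note Vj = unitary_matD[OF V[OF j]]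
    show "instrument n 1 (\<lambda>_. n) (\<lambda>_. 1) (\<lambda>_ _. V j)"
      using Vj by (simp add: instrument_def lessThan_Suc mat_sum_single)
  qed (use L j in auto)
  moreover have "instrument n m (\<lambda>_. n) (\<lambda>_. 1) (\<lambda>j _. A j)"
  proof -
    have "mat_sum n n {..<m} (\<lambda>j. mat_sum n n {..<1 :: nat} (\<lambda>_. mat_adjoint (A j) * A j)) = 1\<^sub>m n"
      unfolding A1[symmetric] using A by (intro mat_sum_cong single) (auto intro: mult_carrier_mat)
    then show ?thesis using A by (simp add: instrument_def)
  qed
  ultimately have "locc n n n n ?L" by (intro locc.alice) auto
  moreover have "?L \<sigma> = mat_sum (n * n) (n * n) {..<m} (\<lambda>j. L j ((A j \<otimes>\<^sub>k V j) * \<sigma> * mat_adjoint (A j \<otimes>\<^sub>k V j)))"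
    if \<sigma>: "\<sigma> \<in> carrier_mat (n * n) (n * n)" for \<sigma>
  proof (rule mat_sum_cong)
    fix j assume "j \<in> {..<m}"
    then have j: "j < m" by simp
    note Aj = A[OF j] and Vj = unitary_matD(1)[OF V[OF j]]
    let ?E = "A j \<otimes>\<^sub>k 1\<^sub>m n" and ?F = "1\<^sub>m n \<otimes>\<^sub>k V j"
    have E: "?E \<in> carrier_mat (n * n) (n * n)" and F: "?F \<in> carrier_mat (n * n) (n * n)"
      using Aj Vj by (auto intro: kronecker_carrier)
    have AV: "A j \<otimes>\<^sub>k V j = ?F * ?E" using Aj Vj by (simp add: kronecker_mult)
    have F_map: "kraus_map (n * n) 1 (\<lambda>_. ?F) (kraus_map (n * n) 1 (\<lambda>_. ?E) \<sigma>) =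
        ?F * kraus_map (n * n) 1 (\<lambda>_. ?E) \<sigma> * mat_adjoint ?F"
      by (rule kraus_map_single[of "\<lambda>_. ?F", OF F kraus_map_carrier])
    have E_map: "kraus_map (n * n) 1 (\<lambda>_. ?E) \<sigma> = ?E * \<sigma> * mat_adjoint ?E"
      by (rule kraus_map_single[of "\<lambda>_. ?E", OF E \<sigma>])
    have eq: "kraus_map (n * n) 1 (\<lambda>_. ?F) (kraus_map (n * n) 1 (\<lambda>_. ?E) \<sigma>) =
        (A j \<otimes>\<^sub>k V j) * \<sigma> * mat_adjoint (A j \<otimes>\<^sub>k V j)"
      unfolding F_map unfolding E_map AV using E F \<sigma> by (rule conjugation_mult)
    have "L j (kraus_map (n * n) 1 (\<lambda>_. ?F) (kraus_map (n * n) 1 (\<lambda>_. ?E) \<sigma>)) \<in> carrier_mat (n * n) (n * n)"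
      by (rule locc_carrier[OF L[OF j] kraus_map_carrier])
    then show "?B j (kraus_map (n * n) 1 (\<lambda>_. A j \<otimes>\<^sub>k 1\<^sub>m n) \<sigma>) = L j ((A j \<otimes>\<^sub>k V j) * \<sigma> * mat_adjoint (A j \<otimes>\<^sub>k V j))"
      unfolding eq by (simp add: lessThan_Suc mat_sum_single)
  qed
  ultimately show ?thesis by (rule that)
qed

text \<open>Alice's final unitary \<open>U i\<close> is absorbed into her measurement, where it
  cancels from the completeness relation.\<close>

lemma LOCC1A_imp_locc:
  assumes "L \<in> LOCC1A n"
  obtains L' where "locc n n n n L'" "\<And>\<sigma>. \<sigma> \<in> carrier_mat (n * n) (n * n) \<Longrightarrow> L' \<sigma> = L \<sigma>"
proof -
  obtain m A U V where L: "L = kraus_map (n * n) m (\<lambda>i. (U i * A i) \<otimes>\<^sub>k V i)"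
    and AUV: "\<And>i. i < m \<Longrightarrow> A i \<in> carrier_mat n n \<and> unitary_mat n (U i) \<and> unitary_mat n (V i)"
    and one: "mat_sum n n {..<m} (\<lambda>i. mat_adjoint (A i) * A i) = 1\<^sub>m n"
    using assms unfolding LOCC1A_def by blast
  have UA: "U i * A i \<in> carrier_mat n n" if "i < m" for i
    using AUV[OF that] unitary_matD(1) by (auto intro: mult_carrier_mat)
  have "mat_sum n n {..<m} (\<lambda>i. mat_adjoint (U i * A i) * (U i * A i)) = mat_sum n n {..<m} (\<lambda>i. mat_adjoint (A i) * A i)"
  proof (rule mat_sum_cong)
    fix i assume "i \<in> {..<m}"
    then have A: "A i \<in> carrier_mat n n" and U: "unitary_mat n (U i)" using AUV by auto
    have "mat_adjoint (U i * A i) * (U i * A i) = mat_adjoint (A i) * (mat_adjoint (U i) * U i) * A i"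
      using A unitary_matD(1)[OF U] by (simp add: mat_adjoint_mult mult_mat_assoc)
    then show "mat_adjoint (U i * A i) * (U i * A i) = mat_adjoint (A i) * A i"
      using A unitary_matD[OF U] by simp
  qed
  then have one': "mat_sum n n {..<m} (\<lambda>i. mat_adjoint (U i * A i) * (U i * A i)) = 1\<^sub>m n"
    using one by simp
  have V: "unitary_mat n (V i)" if "i < m" for i using AUV[OF that] by simp
  show ?thesis
  proof (rule locc_alice_bob[OF UA one' V locc.stop])
    fix L' assume "locc n n n n L'" "\<And>\<sigma>. \<sigma> \<in> carrier_mat (n * n) (n * n) \<Longrightarrow>
      L' \<sigma> = mat_sum (n * n) (n * n) {..<m} (\<lambda>j. ((U j * A j) \<otimes>\<^sub>k V j) * \<sigma> * mat_adjoint ((U j * A j) \<otimes>\<^sub>k V j))"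
    then show ?thesis using that by (simp add: L kraus_map_def)
  qed
qed

text \<open>In the composed protocol \<open>L\<close> receives the target state of the preceding
  stage multiplied by the branch probability.\<close>

lemma LOCC1A_smult:
  assumes "L \<in> LOCC1A n" "\<sigma> \<in> carrier_mat (n * n) (n * n)"
  shows "L (c \<cdot>\<^sub>m \<sigma>) = c \<cdot>\<^sub>m L \<sigma>"
proof -
  obtain m A U V where L: "L = kraus_map (n * n) m (\<lambda>i. (U i * A i) \<otimes>\<^sub>k V i)"
    and AUV: "\<And>i. i < m \<Longrightarrow> A i \<in> carrier_mat n n \<and> unitary_mat n (U i) \<and> unitary_mat n (V i)"
    using assms(1) unfolding LOCC1A_def by blast
  have "(U i * A i) \<otimes>\<^sub>k V i \<in> carrier_mat (n * n) (n * n)" if "i < m" for i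
    using AUV[OF that] unitary_matD(1) by (intro kronecker_carrier mult_carrier_mat) auto
  then show ?thesis unfolding L by (rule kraus_map_smult[OF _ assms(2)])
qed

text \<open>Rank-one projectors are extremal. Let \<open>\<zeta>\<close> be the part of
  \<open>\<chi> i\<close> orthogonal to \<open>\<phi>\<close>. The expectation in
  \<open>\<zeta>\<close> is zero on the left and a sum of nonnegative terms on the right; as
  \<open>p i\<close> is positive, \<open>\<zeta>\<close> vanishes and \<open>\<chi> i\<close> is a
  phase times \<open>\<phi>\<close>.\<close>

lemma projector_in_convex_combination:
  assumes \<phi>: "pure_state d \<phi>" and p: "probability_weights m p"
    and \<chi>: "\<And>i. i < m \<Longrightarrow> pure_state d (\<chi> i)"
    and eq: "projector \<phi> = convex_combination d m p (\<lambda>i. projector (\<chi> i))"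
  obtains i where "i < m" "projector \<phi> = projector (\<chi> i)"
proof -
  have "(\<Sum>i<m. p i) = 1" using p by (simp add: probability_weights_def)
  then have "\<exists>i<m. p i \<noteq> 0" by (metis (no_types, lifting) lessThan_iff sum.neutral zero_neq_one)
  then obtain i where i: "i < m" "p i \<noteq> 0" by blast
  have p0: "0 \<le> p j" if "j < m" for j using p that by (simp add: probability_weights_def)
  have \<phi>c: "\<phi> \<in> carrier_vec d" "norm2 \<phi> = 1" using \<phi> by (auto simp: pure_state_iff)
  have \<chi>c: "\<chi> j \<in> carrier_vec d" "norm2 (\<chi> j) = 1" if "j < m" for j using \<chi>[OF that] by (auto simp: pure_state_iff)
  define c where "c = \<chi> i \<bullet>c \<phi>"
  define \<zeta> where "\<zeta> = \<chi> i - c \<cdot>\<^sub>v \<phi>"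
  have \<zeta>: "\<zeta> \<in> carrier_vec d" using \<phi>c \<chi>c[OF i(1)] by (simp add: \<zeta>_def)
  have sub: "v \<bullet>c w - c * (\<phi> \<bullet>c w) = (v - c \<cdot>\<^sub>v \<phi>) \<bullet>c w"
    if "v \<in> carrier_vec d" "w \<in> carrier_vec d" for v w
    using that \<phi>c by (simp add: cscalar_prod_sum[of _ d] sum_distrib_left sum_subtractf algebra_simps)
  have "\<zeta> \<bullet>c \<phi> = 0"
    using sub[OF \<chi>c(1)[OF i(1)] \<phi>c(1)] \<phi>c(2) by (simp add: \<zeta>_def[symmetric] c_def[symmetric] cscalar_prod_self)
  then have \<phi>\<zeta>: "\<phi> \<bullet>c \<zeta> = 0" using cscalar_prod_cnj[OF \<zeta> \<phi>c(1)] by simp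
  \<comment> \<open>The expectation of a projector in \<open>\<zeta>\<close>, written in matrix
    entries because the mixture is an entrywise sum.\<close>
  have quad: "(\<Sum>x<d. \<Sum>y<d. cnj (\<zeta> $ x) * projector v $$ (x, y) * \<zeta> $ y) = complex_of_real ((cmod (v \<bullet>c \<zeta>))\<^sup>2)"
    if "v \<in> carrier_vec d" for v
  proof -
    have "complex_of_real ((cmod (v \<bullet>c \<zeta>))\<^sup>2) = (\<Sum>x<d. v $ x * cnj (\<zeta> $ x)) * cnj (\<Sum>y<d. v $ y * cnj (\<zeta> $ y))"
      using that \<zeta> by (simp only: complex_norm_square cscalar_prod_sum)
    also have "\<dots> = (\<Sum>x<d. \<Sum>y<d. cnj (\<zeta> $ x) * projector v $$ (x, y) * \<zeta> $ y)"
      unfolding cnj_sum sum_product using that by (intro sum.cong refl) (auto simp: projector_index)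
    finally show ?thesis by simp
  qed
  have "complex_of_real (\<Sum>j<m. p j * (cmod (\<chi> j \<bullet>c \<zeta>))\<^sup>2) =
      (\<Sum>j<m. complex_of_real (p j) * (\<Sum>x<d. \<Sum>y<d. cnj (\<zeta> $ x) * projector (\<chi> j) $$ (x, y) * \<zeta> $ y))"
    using quad \<chi>c(1) by simp
  also have "\<dots> = (\<Sum>j<m. \<Sum>x<d. \<Sum>y<d. cnj (\<zeta> $ x) * (complex_of_real (p j) * projector (\<chi> j) $$ (x, y)) * \<zeta> $ y)"
    by (simp add: sum_distrib_left ac_simps)
  also have "\<dots> = (\<Sum>x<d. \<Sum>j<m. \<Sum>y<d. cnj (\<zeta> $ x) * (complex_of_real (p j) * projector (\<chi> j) $$ (x, y)) * \<zeta> $ y)"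
    by (rule sum.swap)
  also have "\<dots> = (\<Sum>x<d. \<Sum>y<d. \<Sum>j<m. cnj (\<zeta> $ x) * (complex_of_real (p j) * projector (\<chi> j) $$ (x, y)) * \<zeta> $ y)"
    by (intro sum.cong refl sum.swap)
  also have "\<dots> = (\<Sum>x<d. \<Sum>y<d. cnj (\<zeta> $ x) * projector \<phi> $$ (x, y) * \<zeta> $ y)"
  proof (intro sum.cong refl)
    fix x y assume xy: "x \<in> {..<d}" "y \<in> {..<d}"
    have "(complex_of_real (p j) \<cdot>\<^sub>m projector (\<chi> j)) $$ (x, y) = complex_of_real (p j) * projector (\<chi> j) $$ (x, y)" if "j < m" for j
      using xy projector_carrier[OF \<chi>c(1)[OF that]] by simp
    then have "projector \<phi> $$ (x, y) = (\<Sum>j<m. complex_of_real (p j) * projector (\<chi> j) $$ (x, y))"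
      using xy unfolding eq convex_combination_def by simp
    then show "(\<Sum>j<m. cnj (\<zeta> $ x) * (complex_of_real (p j) * projector (\<chi> j) $$ (x, y)) * \<zeta> $ y) =
        cnj (\<zeta> $ x) * projector \<phi> $$ (x, y) * \<zeta> $ y"
      by (simp add: sum_distrib_left sum_distrib_right)
  qed
  also have "\<dots> = 0" using quad[OF \<phi>c(1)] \<phi>\<zeta> by simp
  finally have "(\<Sum>j<m. p j * (cmod (\<chi> j \<bullet>c \<zeta>))\<^sup>2) = 0" by (simp only: of_real_eq_0_iff)
  then have "p i * (cmod (\<chi> i \<bullet>c \<zeta>))\<^sup>2 = 0"
    using p0 i by (subst (asm) sum_nonneg_eq_0_iff) auto
  then have "\<chi> i \<bullet>c \<zeta> = 0" using i by simp
  then have "\<zeta> \<bullet>c \<zeta> = 0"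
    using sub[OF \<chi>c(1)[OF i(1)] \<zeta>] \<phi>\<zeta> by (simp add: \<zeta>_def[symmetric])
  then have "\<zeta> = 0\<^sub>v d" using \<zeta> by (simp add: cscalar_prod_self norm2_eq_0)
  have \<chi>\<phi>: "\<chi> i = c \<cdot>\<^sub>v \<phi>"
  proof (rule eq_vecI)
    fix x assume "x < dim_vec (c \<cdot>\<^sub>v \<phi>)"
    then have x: "x < d" using \<phi>c by simp
    have "\<zeta> $ x = 0" using \<open>\<zeta> = 0\<^sub>v d\<close> x by simp
    then show "\<chi> i $ x = (c \<cdot>\<^sub>v \<phi>) $ x" using x \<phi>c \<chi>c[OF i(1)] by (simp add: \<zeta>_def)
  qed (use \<phi>c \<chi>c[OF i(1)] in auto)
  then have "(cmod c)\<^sup>2 = 1" using \<chi>c(2)[OF i(1)] \<phi>c(2) by (simp add: norm2_smult)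
  then have "projector (\<chi> i) = projector \<phi>"
    unfolding \<chi>\<phi> projector_smult by (intro eq_matI) (auto simp: projector_def)
  then show ?thesis using that i by simp
qed

lemma pure_state_in_S_set:
  assumes "pure_state (n * n) \<phi>" "projector \<phi> \<in> S_set n \<mu>"
  shows "schmidt_coefficients n \<phi> \<succ> \<mu>"
proof -
  obtain m p Y where eq: "projector \<phi> = convex_combination (n * n) m p Y" and p: "probability_weights m p"
    and Y: "\<And>i. i < m \<Longrightarrow> \<exists>\<psi>. Y i = projector \<psi> \<and> pure_state (n * n) \<psi> \<and> schmidt_coefficients n \<psi> \<succ> \<mu>"
    using assms(2) unfolding S_set_def convex_closure_def by blast
  obtain \<chi> where \<chi>: "\<And>i. i < m \<Longrightarrow> Y i = projector (\<chi> i) \<and> pure_state (n * n) (\<chi> i) \<and> schmidt_coefficients n (\<chi> i) \<succ> \<mu>"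
    using Y by metis
  have "projector \<phi> = convex_combination (n * n) m p (\<lambda>i. projector (\<chi> i))"
    unfolding eq convex_combination_def using \<chi> by (intro mat_sum_cong) auto
  then obtain i where i: "i < m" "projector \<phi> = projector (\<chi> i)"
    using projector_in_convex_combination[OF assms(1) p, of \<chi>] \<chi> by blast
  \<comment> \<open>Schmidt coefficients are computed from the projector, so vectors with equal
    projectors share them.\<close>
  then show ?thesis using \<chi>[OF i(1)] by (simp add: schmidt_coefficients_def)
qed


section \<open>Nielsen's theorem\<close>

text \<open>
  Each step of the induction averages \<open>l\<close> with a transposition of it, which makes one more entry agree
  with \<open>m\<close>. Only \<open>m\<close> has to be sorted, so the averaged vector never needs to be sorted again.
\<close>

lemma convex_permutations_of_prefix_sums:
  fixes l m :: "nat \<Rightarrow> real"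
  assumes "\<And>k. k \<le> n \<Longrightarrow> (\<Sum>i<k. m i) \<le> (\<Sum>i<k. l i)" "(\<Sum>i<n. m i) = (\<Sum>i<n. l i)"
    and m: "\<And>i j. i \<le> j \<Longrightarrow> j < n \<Longrightarrow> m j \<le> m i"
  shows "\<exists>q. (\<forall>\<pi>. 0 \<le> q \<pi>) \<and> (\<Sum>\<pi> | \<pi> permutes {..<n}. q \<pi>) = 1 \<and>
    (\<forall>k<n. m k = (\<Sum>\<pi> | \<pi> permutes {..<n}. q \<pi> * l (\<pi> k)))"
  using assms(1,2)
proof (induction "card {i. i < n \<and> l i \<noteq> m i}" arbitrary: l rule: less_induct)
  case less
  let ?P = "{\<pi>. \<pi> permutes {..<n}}"
  have fin: "finite ?P" by (rule finite_permutations) simp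
  show ?case
  proof (cases "\<forall>i<n. l i = m i")
    case True
    have id: "id \<in> ?P" by (simp add: permutes_id)
    show ?thesis
    proof (intro exI[of _ "\<lambda>\<pi>. if \<pi> = id then 1 else 0"] conjI allI impI)
      show "(\<Sum>\<pi>\<in>?P. if \<pi> = id then 1 else (0 :: real)) = 1" using id fin by simp
      fix k assume "k < n"
      have "(\<Sum>\<pi>\<in>?P. (if \<pi> = id then 1 else 0) * l (\<pi> k)) = (\<Sum>\<pi>\<in>?P. if \<pi> = id then l k else 0)"
        by (rule sum.cong) auto
      then show "m k = (\<Sum>\<pi>\<in>?P. (if \<pi> = id then 1 else 0) * l (\<pi> k))"
        using id fin True \<open>k < n\<close> by simp
    qed auto
  next
    case False
    \<comment> \<open>With equal totals, the vectors can only differ if some entry of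
      \<open>l\<close> is too small.\<close>
    have "\<exists>k<n. l k < m k"
    proof (rule ccontr)
      assume "\<not> (\<exists>k<n. l k < m k)"
      then have le: "\<And>k. k < n \<Longrightarrow> m k \<le> l k" by (meson not_less)
      have "(\<Sum>i<n. l i - m i) = 0" using less(3) by (simp add: sum_subtractf)
      then have "\<forall>i\<in>{..<n}. l i - m i = 0" using le by (subst (asm) sum_nonneg_eq_0_iff) auto
      then show False using False by auto
    qed
    define k where "k = (LEAST k. k < n \<and> l k < m k)"
    have k: "k < n" "l k < m k" using LeastI_ex[OF \<open>\<exists>k<n. l k < m k\<close>] by (auto simp: k_def)
    have below: "m i \<le> l i" if "i < k" for i
      using not_less_Least[of i "\<lambda>k. k < n \<and> l k < m k"] that k(1) unfolding k_def[symmetric] by auto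
    \<comment> \<open>Positions of surplus before the first deficit. If there were none,
      \<open>l\<close> would agree with \<open>m\<close> below \<open>k\<close> and be smaller at
      \<open>k\<close>, against the prefix inequality at \<open>Suc k\<close>.\<close>
    define J where "J = {j. j < k \<and> m j < l j}"
    have "J \<noteq> {}"
    proof
      assume "J = {}"
      then have "\<And>i. i < k \<Longrightarrow> l i = m i" using below by (force simp: J_def)
      then have "(\<Sum>i<Suc k. l i) < (\<Sum>i<Suc k. m i)" using k by simp
      then show False using less(2)[of "Suc k"] k by simp
    qed
    have "finite J" by (simp add: J_def)
    \<comment> \<open>Taking the last surplus before \<open>k\<close> makes all entries strictly
      between \<open>j\<close> and \<open>k\<close> agree, which controls the prefix sums ending
      there.\<close>
    define j where "j = Max J"
    have "j \<in> J" using \<open>finite J\<close> \<open>J \<noteq> {}\<close> by (simp add: j_def)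
    then have j: "j < k" "m j < l j" by (auto simp: J_def)
    have between: "l i = m i" if "j < i" "i < k" for i
    proof -
      have "i \<notin> J" using that(1) Max_ge[OF \<open>finite J\<close>] by (metis j_def leD)
      then show ?thesis using below[OF that(2)] that by (auto simp: J_def)
    qed
    have mjk: "m k \<le> m j" using m[of j k] j k by simp
    \<comment> \<open>The largest amount that can be moved from \<open>j\<close> to \<open>k\<close>
      without overshooting either target; it settles at least one of the two entries.\<close>
    define \<delta> where "\<delta> = min (l j - m j) (m k - l k)"
    have \<delta>: "0 < \<delta>" "\<delta> \<le> l j - m j" "\<delta> \<le> m k - l k" "\<delta> = l j - m j \<or> \<delta> = m k - l k"
      using j k by (auto simp: \<delta>_def)
    \<comment> \<open>Mixing with the transposition in proportion \<open>t\<close> moves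
      \<open>t * (l j - l k)\<close> from \<open>j\<close> to \<open>k\<close>; this has to be
      \<open>\<delta>\<close>.\<close>
    define t where "t = \<delta> / (l j - l k)"
    have jk: "0 < l j - l k" using j k mjk by simp
    have t: "0 \<le> t" "t \<le> 1" using \<delta> jk j k mjk by (auto simp: t_def)
    define \<tau> where "\<tau> = transpose j k"
    have \<tau>: "\<tau> permutes {..<n}" unfolding \<tau>_def using j k by (intro permutes_swap_id) auto
    define l' where "l' = (\<lambda>i. (1 - t) * l i + t * l (\<tau> i))"
    have tm: "t * (l j - l k) = \<delta>" using jk by (simp add: t_def)
    have l'_eq: "l' i = l i - (if i = j then \<delta> else 0) + (if i = k then \<delta> else 0)" for i
    proof (cases "i = j \<or> i = k")
      case True
      then show ?thesis using tm j by (auto simp: l'_def \<tau>_def algebra_simps)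
    next
      case False
      then show ?thesis by (simp add: l'_def \<tau>_def transpose_apply_other algebra_simps)
    qed
    have l'_sum: "(\<Sum>i<x. l' i) = (\<Sum>i<x. l i) - (if j < x then \<delta> else 0) + (if k < x then \<delta> else 0)" for x
      by (simp add: l'_eq sum.distrib sum_subtractf)
    have "card {i. i < n \<and> l' i \<noteq> m i} < card {i. i < n \<and> l i \<noteq> m i}"
    proof (rule psubset_card_mono)
      have "{i. i < n \<and> l' i \<noteq> m i} \<subseteq> {i. i < n \<and> l i \<noteq> m i}"
        using j k by (auto simp: l'_eq)
      moreover have "\<exists>i<n. l i \<noteq> m i \<and> l' i = m i"
        using \<delta>(4)
      proof
        assume "\<delta> = l j - m j"
        then show ?thesis using j k by (intro exI[of _ j]) (auto simp: l'_eq)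
      next
        assume "\<delta> = m k - l k"
        then show ?thesis using j k by (intro exI[of _ k]) (auto simp: l'_eq)
      qed
      ultimately show "{i. i < n \<and> l' i \<noteq> m i} \<subset> {i. i < n \<and> l i \<noteq> m i}" by auto
    qed simp
    moreover have "(\<Sum>i<x. m i) \<le> (\<Sum>i<x. l' i)" if x: "x \<le> n" for x
    \<comment> \<open>Only prefixes containing \<open>j\<close> but not \<open>k\<close> lose
      \<open>\<delta>\<close>. Their surplus is at least \<open>l j - m j\<close>, because the
      entries after \<open>j\<close> agree.\<close>
    proof (cases "j < x \<and> x \<le> k")
      case True
      have "(\<Sum>i<x. l i - m i) = (\<Sum>i<Suc j. l i - m i) + (\<Sum>i=Suc j..<x. l i - m i)"
        using True by (intro sum_split_at) simp
      also have "(\<Sum>i=Suc j..<x. l i - m i) = 0" using between True by (intro sum.neutral) auto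
      also have "(\<Sum>i<Suc j. l i - m i) + 0 \<ge> \<delta>"
        using \<delta>(2) less(2)[of j] j k by (simp add: sum_subtractf)
      finally show ?thesis using True by (simp add: l'_sum sum_subtractf)
    next
      case False
      then show ?thesis using less(2)[OF x] j by (auto simp: l'_sum)
    qed
    moreover have "(\<Sum>i<n. m i) = (\<Sum>i<n. l' i)" using less(3) j k by (simp add: l'_sum)
    ultimately obtain q where q: "\<And>\<pi>. 0 \<le> q \<pi>" "(\<Sum>\<pi>\<in>?P. q \<pi>) = 1"
      "\<And>k. k < n \<Longrightarrow> m k = (\<Sum>\<pi>\<in>?P. q \<pi> * l' (\<pi> k))"
      using less(1)[of l'] by blast
    \<comment> \<open>Left composition with \<open>\<tau>\<close> is a bijection on the
      permutations; it turns weights for \<open>l'\<close> into weights for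
      \<open>l\<close>.\<close>
    have shift: "(\<Sum>\<pi>\<in>?P. f \<pi>) = (\<Sum>\<pi>\<in>?P. f (\<tau> \<circ> \<pi>))" for f :: "(nat \<Rightarrow> nat) \<Rightarrow> real"
      by (rule setum_permutations_compose_left[OF \<tau>])
    show ?thesis
    proof (intro exI[of _ "\<lambda>\<pi>. (1 - t) * q \<pi> + t * q (\<tau> \<circ> \<pi>)"] conjI allI impI)
      show "0 \<le> (1 - t) * q \<pi> + t * q (\<tau> \<circ> \<pi>)" for \<pi> using t q(1) by simp
      have "(\<Sum>\<pi>\<in>?P. q (\<tau> \<circ> \<pi>)) = 1" using shift[of q] q(2) by simp
      then show "(\<Sum>\<pi>\<in>?P. (1 - t) * q \<pi> + t * q (\<tau> \<circ> \<pi>)) = 1"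
        using q(2) by (simp add: sum.distrib sum_distrib_left[symmetric])
      fix x assume x: "x < n"
      have "m x = (1 - t) * (\<Sum>\<pi>\<in>?P. q \<pi> * l (\<pi> x)) + t * (\<Sum>\<pi>\<in>?P. q \<pi> * l (\<tau> (\<pi> x)))"
        unfolding q(3)[OF x] l'_def by (simp add: algebra_simps sum.distrib sum_distrib_left sum_subtractf)
      also have "(\<Sum>\<pi>\<in>?P. q \<pi> * l (\<tau> (\<pi> x))) = (\<Sum>\<pi>\<in>?P. q (\<tau> \<circ> \<pi>) * l (\<pi> x))"
        by (subst shift) (simp add: \<tau>_def)
      finally show "m x = (\<Sum>\<pi>\<in>?P. ((1 - t) * q \<pi> + t * q (\<tau> \<circ> \<pi>)) * l (\<pi> x))"
        by (simp add: algebra_simps sum.distrib sum_distrib_left sum_subtractf)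
    qed
  qed
qed

text \<open>Every outcome yields the same state \<open>\<phi>\<close>, with probability
  \<open>q j\<close>. In Schmidt coordinates Alice rescales amplitude \<open>k\<close> and moves it
  to position \<open>h j k\<close>, and Bob permutes his basis to match. Completeness is exactly the
  representation of \<open>\<mu>\<close> as a weighted sum of permutations of
  \<open>l\<close>.\<close>

lemma nielsen:
  assumes \<psi>: "pure_state (n * n) \<psi>" and \<phi>: "pure_state (n * n) \<phi>"
    and maj: "schmidt_coefficients n \<phi> \<succ> schmidt_coefficients n \<psi>"
  obtains m q A V where "\<And>j. j < m \<Longrightarrow> 0 \<le> q j" "(\<Sum>j<(m :: nat). q j) = (1 :: real)"
    "\<And>j. j < m \<Longrightarrow> A j \<in> carrier_mat n n" "\<And>j. j < m \<Longrightarrow> unitary_mat n (V j)"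
    "mat_sum n n {..<m} (\<lambda>j. mat_adjoint (A j) * A j) = 1\<^sub>m n"
    "\<And>j. j < m \<Longrightarrow> (A j \<otimes>\<^sub>k V j) *\<^sub>v \<psi> = complex_of_real (sqrt (q j)) \<cdot>\<^sub>v \<phi>"
proof -
  define \<mu> where "\<mu> = schmidt_coefficients n \<psi>"
  define l where "l = schmidt_coefficients n \<phi>"
  have \<psi>c: "\<psi> \<in> carrier_vec (n * n)" and \<phi>c: "\<phi> \<in> carrier_vec (n * n)"
    using \<psi> \<phi> by (auto simp: pure_state_iff)
  obtain U W where U: "unitary_mat n U" and W: "unitary_mat n W"
    and \<psi>_eq: "\<psi> = tensor_vec (U * sqrt_diag n \<mu> * W)" and \<mu>c: "\<mu> \<in> carrier_vec n"
    and \<mu>_mono: "\<And>i j. i \<le> j \<Longrightarrow> j < n \<Longrightarrow> \<mu> $ j \<le> \<mu> $ i" and \<mu>_nonneg: "\<And>i. i < n \<Longrightarrow> 0 \<le> \<mu> $ i"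
    using schmidt_decomposition[OF \<psi>c] unfolding \<mu>_def by metis
  obtain U' W' where U': "unitary_mat n U'" and W': "unitary_mat n W'"
    and \<phi>_eq: "\<phi> = tensor_vec (U' * sqrt_diag n l * W')" and l_nonneg: "\<And>i. i < n \<Longrightarrow> 0 \<le> l $ i"
    using schmidt_decomposition[OF \<phi>c] unfolding l_def by metis
  note Uc = unitary_matD[OF U] and Wc = unitary_matD[OF W] and U'c = unitary_matD[OF U'] and W'c = unitary_matD[OF W']
  define P where "P = {\<pi>. \<pi> permutes {..<n}}"
  have finP: "finite P" unfolding P_def by (rule finite_permutations) simp
  \<comment> \<open>\<open>majorizes\<close> compares nonempty prefixes only; the empty one is
    supplied here.\<close>
  have prefix: "(\<Sum>i<k. \<mu> $ i) \<le> (\<Sum>i<k. l $ i)" if "k \<le> n" for k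
  proof (cases "k = 0")
    case False
    then show ?thesis using maj that \<mu>c by (simp add: majorizes_def \<mu>_def[symmetric] l_def[symmetric])
  qed simp
  have total: "(\<Sum>i<n. \<mu> $ i) = (\<Sum>i<n. l $ i)"
    using schmidt_coefficients_sum[OF \<psi>] schmidt_coefficients_sum[OF \<phi>] by (simp add: \<mu>_def l_def)
  obtain Q where Q: "\<And>\<pi>. 0 \<le> Q \<pi>" "(\<Sum>\<pi>\<in>P. Q \<pi>) = 1"
    "\<And>k. k < n \<Longrightarrow> \<mu> $ k = (\<Sum>\<pi>\<in>P. Q \<pi> * l $ (\<pi> k))"
    using convex_permutations_of_prefix_sums[OF prefix total \<mu>_mono] unfolding P_def by blast
  define m where "m = card P"
  obtain h where h: "bij_betw h {..<m} P"
    using ex_bij_betw_nat_finite[OF finP] by (auto simp: m_def lessThan_atLeast0)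
  have hP: "h j permutes {..<n}" if "j < m" for j using h that by (auto simp: bij_betw_def P_def)
  define q where "q = (\<lambda>j. Q (h j))"
  have q0: "0 \<le> q j" for j using Q(1) by (simp add: q_def)
  have q1: "(\<Sum>j<m. q j) = 1"
    unfolding q_def using sum.reindex_bij_betw[OF h, of Q] Q(2) by simp
  have q\<mu>: "\<mu> $ k = (\<Sum>j<m. q j * l $ (h j k))" if "k < n" for k
    unfolding q_def using sum.reindex_bij_betw[OF h, of "\<lambda>\<pi>. Q \<pi> * l $ (\<pi> k)"] Q(3)[OF that] by simp
  have hn: "h j k < n" if "j < m" "k < n" for j k
    using permutes_in_image[OF hP[OF that(1)], of k] that(2) by simp
  have h_inj: "h j k = h j k' \<longleftrightarrow> k = k'" if "j < m" for j k k'
    using permutes_inj[OF hP[OF that]] by (auto dest: injD)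
  txt \<open>Where \<open>\<mu> $ k = 0\<close>, the entry only has to complete the Kraus operators to a measurement.\<close>
  define c where "c = (\<lambda>j k. if \<mu> $ k = 0 then sqrt (q j) else sqrt (q j * l $ (h j k) / \<mu> $ k))"
  have c: "c j k * sqrt (\<mu> $ k) = sqrt (q j) * sqrt (l $ (h j k))" if j: "j < m" and k: "k < n" for j k
  proof (cases "\<mu> $ k = 0")
    case True
    then have "(\<Sum>j<m. q j * l $ (h j k)) = 0" using q\<mu>[OF k] by simp
    then have "q j * l $ (h j k) = 0"
      using q0 l_nonneg hn k j by (subst (asm) sum_nonneg_eq_0_iff) auto
    then show ?thesis using True by auto
  next
    case False
    then show ?thesis using \<mu>_nonneg[OF k] by (simp add: c_def real_sqrt_mult[symmetric])
  qed
  have c2: "(\<Sum>j<m. (c j k)\<^sup>2) = 1" if k: "k < n" for k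
  proof (cases "\<mu> $ k = 0")
    case True
    then show ?thesis using q0 q1 by (simp add: c_def)
  next
    case False
    then have "(\<Sum>j<m. (c j k)\<^sup>2) = (\<Sum>j<m. q j * l $ (h j k) / \<mu> $ k)"
      using q0 l_nonneg hn k \<mu>_nonneg[OF k] by (intro sum.cong refl) (simp add: c_def)
    also have "\<dots> = 1" using False q\<mu>[OF k] by (simp add: sum_divide_distrib[symmetric])
    finally show ?thesis .
  qed
  \<comment> \<open>\<open>K j\<close> sends basis vector \<open>k\<close> to a multiple of basis
    vector \<open>h j k\<close>. \<open>R j\<close>, on the right of the diagonal matrix, relabels
    Bob's basis in the same way, so the product is diagonal again.\<close>
  define K where "K = (\<lambda>j. mat n n (\<lambda>(a, k). if a = h j k then complex_of_real (c j k) else 0))"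
  define R where "R = (\<lambda>j. mat n n (\<lambda>(k, b). if b = h j k then 1 else (0 :: complex)))"
  have Kc: "K j \<in> carrier_mat n n" and Rc: "R j \<in> carrier_mat n n" for j by (simp_all add: K_def R_def)
  have R: "unitary_mat n (R j)" if j: "j < m" for j
  proof -
    have "R j * mat_adjoint (R j) = 1\<^sub>m n"
    proof (rule eq_matI)
      fix x y assume "x < dim_row (1\<^sub>m n)" "y < dim_col (1\<^sub>m n)"
      then have xy: "x < n" "y < n" by auto
      have "(R j * mat_adjoint (R j)) $$ (x, y) = (\<Sum>b<n. (if b = h j x then 1 else 0) * cnj (if b = h j y then 1 else 0))"
        using xy by (simp add: R_def scalar_prod_def lessThan_atLeast0)
      also have "\<dots> = (\<Sum>b<n. if b = h j x then (if x = y then 1 else 0) else 0)"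
        using h_inj[OF j] by (intro sum.cong) auto
      also have "\<dots> = 1\<^sub>m n $$ (x, y)" using xy hn[OF j] by simp
      finally show "(R j * mat_adjoint (R j)) $$ (x, y) = 1\<^sub>m n $$ (x, y)" .
    qed (simp_all add: R_def)
    \<comment> \<open>The relation just proved is the left-inverse equation for the adjoint, so
      unitarity is obtained there and carried back.\<close>
    then have "unitary_mat n (mat_adjoint (R j))" using Rc[of j] by (intro unitary_matI) simp_all
    then show ?thesis using unitary_mat_adjoint by fastforce
  qed
  have KK: "mat_adjoint (K j) * K j = mat_diag n (\<lambda>k. complex_of_real ((c j k)\<^sup>2))" if j: "j < m" for j
  proof (rule eq_matI)
    fix x y assume "x < dim_row (mat_diag n (\<lambda>k. complex_of_real ((c j k)\<^sup>2)))" "y < dim_col (mat_diag n (\<lambda>k. complex_of_real ((c j k)\<^sup>2)))"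
    then have xy: "x < n" "y < n" by (auto simp: mat_diag_def)
    have "(mat_adjoint (K j) * K j) $$ (x, y) =
        (\<Sum>a<n. cnj (if a = h j x then complex_of_real (c j x) else 0) * (if a = h j y then complex_of_real (c j y) else 0))"
      using xy by (simp add: K_def scalar_prod_def lessThan_atLeast0)
    also have "\<dots> = (\<Sum>a<n. if a = h j x then (if x = y then complex_of_real ((c j x)\<^sup>2) else 0) else 0)"
      using h_inj[OF j] by (intro sum.cong) (auto simp: power2_eq_square)
    also have "\<dots> = mat_diag n (\<lambda>k. complex_of_real ((c j k)\<^sup>2)) $$ (x, y)"
      using xy hn[OF j] by (simp add: mat_diag_def)
    finally show "(mat_adjoint (K j) * K j) $$ (x, y) = mat_diag n (\<lambda>k. complex_of_real ((c j k)\<^sup>2)) $$ (x, y)" .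
  qed (simp_all add: K_def mat_diag_def)
  have KDR: "K j * sqrt_diag n \<mu> * R j = complex_of_real (sqrt (q j)) \<cdot>\<^sub>m sqrt_diag n l" if j: "j < m" for j
  proof (rule eq_matI)
    fix x y assume "x < dim_row (complex_of_real (sqrt (q j)) \<cdot>\<^sub>m sqrt_diag n l)" "y < dim_col (complex_of_real (sqrt (q j)) \<cdot>\<^sub>m sqrt_diag n l)"
    then have xy: "x < n" "y < n" by auto
    obtain k where k: "k < n" "h j k = x"
      using permutes_image[OF hP[OF j]] xy(1) by (metis imageE lessThan_iff)
    have "(K j * sqrt_diag n \<mu> * R j) $$ (x, y) =
       (\<Sum>k'<n. (if x = h j k' then complex_of_real (c j k') else 0) * complex_of_real (sqrt (\<mu> $ k')) * (if y = h j k' then 1 else 0))"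
      using xy Kc[of j] unfolding sqrt_diag_def
      by (subst mat_diag_mult_right[of _ n]) (auto simp: K_def R_def scalar_prod_def lessThan_atLeast0)
    also have "\<dots> = (\<Sum>k'<n. if k' = k then (if x = y then complex_of_real (c j k * sqrt (\<mu> $ k)) else 0) else 0)"
      using h_inj[OF j] k by (intro sum.cong) auto
    also have "\<dots> = (complex_of_real (sqrt (q j)) \<cdot>\<^sub>m sqrt_diag n l) $$ (x, y)"
      using xy k c[OF j k(1)] by (simp add: sqrt_diag_def mat_diag_def)
    finally show "(K j * sqrt_diag n \<mu> * R j) $$ (x, y) = (complex_of_real (sqrt (q j)) \<cdot>\<^sub>m sqrt_diag n l) $$ (x, y)" .
  qed (simp_all add: K_def R_def)
  \<comment> \<open>The adjoints of \<open>U\<close> and \<open>W\<close> undo the Schmidt bases of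
    \<open>\<psi>\<close>, and \<open>U'\<close> and \<open>W'\<close> install those of
    \<open>\<phi>\<close>.\<close>
  define A where "A = (\<lambda>j. U' * K j * mat_adjoint U)"
  define V where "V = (\<lambda>j. transpose_mat (mat_adjoint W * R j * W'))"
  have Ac: "A j \<in> carrier_mat n n" for j
    unfolding A_def by (intro mult_carrier_mat[OF mult_carrier_mat[OF U'c(1) Kc]] mat_adjoint_carrier Uc)
  have Vu: "unitary_mat n (V j)" if "j < m" for j
    unfolding V_def by (intro unitary_mat_transpose unitary_mat_mult unitary_mat_adjoint W W' R that)
  have "mat_sum n n {..<m} (\<lambda>j. mat_adjoint (A j) * A j) =
      mat_sum n n {..<m} (\<lambda>j. U * mat_diag n (\<lambda>k. complex_of_real ((c j k)\<^sup>2)) * mat_adjoint U)"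
  proof (rule mat_sum_cong)
    fix j assume "j \<in> {..<m}"
    then have j: "j < m" by simp
    have "mat_adjoint (A j) * A j = U * (mat_adjoint (K j) * ((mat_adjoint U' * U') * K j)) * mat_adjoint U"
      using Uc(1) U'c(1) Kc[of j] by (simp add: A_def mat_adjoint_mult mult_mat_assoc)
    also have "\<dots> = U * (mat_adjoint (K j) * K j) * mat_adjoint U" using U'c Kc[of j] by simp
    finally show "mat_adjoint (A j) * A j = U * mat_diag n (\<lambda>k. complex_of_real ((c j k)\<^sup>2)) * mat_adjoint U"
      by (simp only: KK[OF j])
  qed
  also have "\<dots> = U * mat_sum n n {..<m} (\<lambda>j. mat_diag n (\<lambda>k. complex_of_real ((c j k)\<^sup>2))) * mat_adjoint U"
    using Uc(1) by (intro mat_sum_mult_mult[symmetric]) auto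
  also have "mat_sum n n {..<m} (\<lambda>j. mat_diag n (\<lambda>k. complex_of_real ((c j k)\<^sup>2))) = 1\<^sub>m n"
  proof (rule eq_matI)
    fix x y assume "x < dim_row (1\<^sub>m n)" "y < dim_col (1\<^sub>m n)"
    then have xy: "x < n" "y < n" by auto
    have "(\<Sum>j<m. complex_of_real ((c j x)\<^sup>2)) = 1" using c2[OF xy(1)] by (metis of_real_1 of_real_sum)
    then show "mat_sum n n {..<m} (\<lambda>j. mat_diag n (\<lambda>k. complex_of_real ((c j k)\<^sup>2))) $$ (x, y) = 1\<^sub>m n $$ (x, y)"
      using xy by (auto simp: mat_diag_def)
  qed auto
  also have "U * 1\<^sub>m n * mat_adjoint U = 1\<^sub>m n" using Uc by simp
  finally have A1: "mat_sum n n {..<m} (\<lambda>j. mat_adjoint (A j) * A j) = 1\<^sub>m n" .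
  have "(A j \<otimes>\<^sub>k V j) *\<^sub>v \<psi> = complex_of_real (sqrt (q j)) \<cdot>\<^sub>v \<phi>" if j: "j < m" for j
  proof -
    have UDW: "U * sqrt_diag n \<mu> * W \<in> carrier_mat n n"
      by (rule mult_carrier_mat[OF mult_carrier_mat[OF Uc(1) sqrt_diag_carrier] Wc(1)])
    have "(A j \<otimes>\<^sub>k V j) *\<^sub>v \<psi> = tensor_vec (A j * (U * sqrt_diag n \<mu> * W) * transpose_mat (V j))"
      unfolding \<psi>_eq by (rule kronecker_mult_tensor_vec[OF Ac unitary_matD(1)[OF Vu[OF j]] UDW])
    also have "A j * (U * sqrt_diag n \<mu> * W) * transpose_mat (V j) =
        U' * (K j * ((mat_adjoint U * U) * (sqrt_diag n \<mu> * ((W * mat_adjoint W) * (R j * W')))))"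
      using Uc(1) U'c(1) Wc(1) W'c(1) Kc[of j] Rc[of j] by (simp add: A_def V_def mult_mat_assoc)
    also have "\<dots> = U' * (K j * sqrt_diag n \<mu> * R j) * W'"
      using Uc Wc U'c(1) W'c(1) Kc[of j] Rc[of j] by (simp add: mult_mat_assoc)
    also have "\<dots> = complex_of_real (sqrt (q j)) \<cdot>\<^sub>m (U' * sqrt_diag n l * W')"
      unfolding KDR[OF j] using U'c(1) W'c(1)
      by (simp add: mult_smult_distrib[of _ n n _ n] mult_smult_assoc_mat[of _ n n _ n] mult_carrier_mat[of _ n n])
    finally show ?thesis by (simp add: tensor_vec_smult \<phi>_eq)
  qed
  from that[OF q0 q1 Ac Vu A1 this] show ?thesis .
qed

text \<open>Branch \<open>j\<close> of Nielsen's protocol delivers \<open>q j\<close> times the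
  projector of \<open>\<phi>\<close>; the continuation gives \<open>q j\<close> times
  \<open>\<rho>\<close>, and these weights sum to 1.\<close>

lemma S_plus_imp_locc_convertible:
  assumes \<psi>: "pure_state (n * n) \<psi>" and \<rho>: "\<rho> \<in> S_plus n (schmidt_coefficients n \<psi>)"
  shows "locc_convertible n \<psi> \<rho>"
proof -
  obtain L \<phi> where L: "L \<in> LOCC1A n" and \<phi>: "pure_state (n * n) \<phi>"
    and S: "projector \<phi> \<in> S_set n (schmidt_coefficients n \<psi>)" and \<rho>_eq: "\<rho> = L (projector \<phi>)"
    using \<rho> unfolding S_plus_def by blast
  have \<psi>c: "\<psi> \<in> carrier_vec (n * n)" and \<phi>c: "\<phi> \<in> carrier_vec (n * n)"
    using \<psi> \<phi> by (auto simp: pure_state_iff)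
  obtain m :: nat and q A V where q: "\<And>j. j < m \<Longrightarrow> 0 \<le> q j" "(\<Sum>j<m. q j) = 1"
    and A: "\<And>j. j < m \<Longrightarrow> A j \<in> carrier_mat n n" and V: "\<And>j. j < m \<Longrightarrow> unitary_mat n (V j)"
    and A1: "mat_sum n n {..<m} (\<lambda>j. mat_adjoint (A j) * A j) = 1\<^sub>m n"
    and AV: "\<And>j. j < m \<Longrightarrow> (A j \<otimes>\<^sub>k V j) *\<^sub>v \<psi> = complex_of_real (sqrt (q j)) \<cdot>\<^sub>v \<phi>"
  proof (rule nielsen[OF \<psi> \<phi> pure_state_in_S_set[OF \<phi> S]], goal_cases)
    case (1 m q A V)
    from 1(1)[OF 1(2-7)] show ?case .
  qed
  obtain L1 where L1: "locc n n n n L1" "\<And>\<sigma>. \<sigma> \<in> carrier_mat (n * n) (n * n) \<Longrightarrow> L1 \<sigma> = L \<sigma>"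
    using LOCC1A_imp_locc[OF L] by blast
  obtain L' where L': "locc n n n n L'" "\<And>\<sigma>. \<sigma> \<in> carrier_mat (n * n) (n * n) \<Longrightarrow>
      L' \<sigma> = mat_sum (n * n) (n * n) {..<m} (\<lambda>j. L1 ((A j \<otimes>\<^sub>k V j) * \<sigma> * mat_adjoint (A j \<otimes>\<^sub>k V j)))"
    using locc_alice_bob[of m A n V "\<lambda>_. L1", OF A A1 V L1(1)] by blast
  have \<rho>c: "\<rho> \<in> carrier_mat (n * n) (n * n)"
    using locc_carrier[OF L1(1) projector_carrier[OF \<phi>c]] L1(2)[OF projector_carrier[OF \<phi>c]] by (simp add: \<rho>_eq)
  have "L' (projector \<psi>) = mat_sum (n * n) (n * n) {..<m} (\<lambda>j. complex_of_real (q j) \<cdot>\<^sub>m \<rho>)"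
    unfolding L'(2)[OF projector_carrier[OF \<psi>c]]
  proof (rule mat_sum_cong)
    fix j assume "j \<in> {..<m}"
    then have j: "j < m" by simp
    have "(A j \<otimes>\<^sub>k V j) * projector \<psi> * mat_adjoint (A j \<otimes>\<^sub>k V j) = complex_of_real (q j) \<cdot>\<^sub>m projector \<phi>"
      using mult_projector_adjoint[OF kronecker_carrier[OF A[OF j] unitary_matD(1)[OF V[OF j]]] \<psi>c] q(1)[OF j]
      by (simp add: AV[OF j] projector_smult)
    moreover have "L1 (complex_of_real (q j) \<cdot>\<^sub>m projector \<phi>) = complex_of_real (q j) \<cdot>\<^sub>m \<rho>"
      using L1(2)[of "complex_of_real (q j) \<cdot>\<^sub>m projector \<phi>"] LOCC1A_smult[OF L] projector_carrier[OF \<phi>c]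
      by (simp add: \<rho>_eq)
    ultimately show "L1 ((A j \<otimes>\<^sub>k V j) * projector \<psi> * mat_adjoint (A j \<otimes>\<^sub>k V j)) = complex_of_real (q j) \<cdot>\<^sub>m \<rho>"
      by simp
  qed
  also have "\<dots> = \<rho>"
  proof (rule eq_matI)
    fix x y assume xy: "x < dim_row \<rho>" "y < dim_col \<rho>"
    have "(\<Sum>j<m. complex_of_real (q j)) = 1" using q(2) by (metis of_real_1 of_real_sum)
    then show "mat_sum (n * n) (n * n) {..<m} (\<lambda>j. complex_of_real (q j) \<cdot>\<^sub>m \<rho>) $$ (x, y) = \<rho> $$ (x, y)"
      using xy \<rho>c by (simp add: sum_distrib_right[symmetric])
  qed (use \<rho>c in auto)
  finally show ?thesis using L'(1) unfolding locc_convertible_def by blast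
qed

theorem theorem1:
  fixes n :: nat and \<mu> :: "real vec" and \<psi> :: "complex vec" and \<rho> :: "complex mat"
  assumes "schmidt_vector n \<mu>"
    and "pure_state (n * n) \<psi>"
    and "schmidt_coefficients n \<psi> = \<mu>"
    and "density_matrix (n * n) \<rho>"
  shows "(\<rho> \<in> S_plus n \<mu> \<longleftrightarrow>
           (\<exists>m p \<phi>. pure_state_decomposition (n * n) \<rho> m p \<phi> \<and>
              vec n (\<lambda>k. \<Sum>i<m. p i * schmidt_coefficients n (\<phi> i) $ k) \<succ> \<mu>)) \<and>
         (locc_convertible n \<psi> \<rho> \<longleftrightarrow> \<rho> \<in> S_plus n \<mu>)"
proof -
  have "locc_convertible n \<psi> \<rho>" if "\<rho> \<in> S_plus n \<mu>"
    using S_plus_imp_locc_convertible[OF assms(2)] that assms(3) by simp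
  moreover have "\<exists>m p \<phi>. pure_state_decomposition (n * n) \<rho> m p \<phi> \<and>
      vec n (\<lambda>k. \<Sum>i<m. p i * schmidt_coefficients n (\<phi> i) $ k) \<succ> \<mu>" if "locc_convertible n \<psi> \<rho>"
    using that separable_majorizes[OF locc_separable assms(2)] assms(3)
    unfolding locc_convertible_def by blast
  ultimately show ?thesis using decomposition_imp_S_plus by blast
qed

end
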